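(* The octagon additive continued fraction (octagon Farey) algorithm is an acceleration of the diagonal changes algorithm on the regular octagon surface $X_{\mathcal O}$, in the following sense. Let $\theta\in[0,\pi]$ be a direction such that $F^k(\theta)$ is not an endpoint of any sector $\overline\Sigma_j$, for every $k\ge 0$, and let $\theta=[s_0;s_1,s_2,\dots]_{\mathcal O}$ be its octagon Farey expansion, i.e. $s_k\in\{0,\dots,7\}$ is the unique index with $F^k(\theta)\in\overline\Sigma_{s_k}$. Put $h_0=\mathrm{id}$, $h_k=(\gamma\nu_{s_{k-1}})(\gamma\nu_{s_{k-2}})\cdots(\gamma\nu_{s_0})$ for $k\ge 1$, and let $$Q^{(k)}=h_k^{-1}\,\nu_{s_k}^{-1}\cdot Q_0\qquad(k\ge 0)$$ be the sequence of quadrangulations of $X_{\mathcal O}$ produced by the octagon Farey algorithm, starting from $Q^{(0)}=\nu_{s_0}^{-1}\cdot Q_0$. Then every $Q^{(k)}$ is an admissible quadrangulation of $X_{\mathcal O}$ with respect to $\theta$, and for every $k\ge 0$ the quadrangulation $Q^{(k+1)}$ is obtained from $Q^{(k)}$ by a finite non-empty sequence of diagonal changes moves in direction $\theta$, i.e. of staircase moves each performed in a staircase which is well slanted with respect to $\theta$ in the current quadrangulation.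
   Context: **The surface.** $\mathcal O\subset\mathbb C\cong\mathbb R^2$ is the regular octagon with side length $1$ and vertices, in counterclockwise order, $(0,0)$, $(1,0)$, $(1+\frac{\sqrt2}{2},\frac{\sqrt2}{2})$, $(1+\frac{\sqrt2}{2},1+\frac{\sqrt2}{2})$, $(1,1+\sqrt2)$, $(0,1+\sqrt2)$, $(-\frac{\sqrt2}{2},1+\frac{\sqrt2}{2})$, $(-\frac{\sqrt2}{2},\frac{\sqrt2}{2})$. $X_{\mathcal O}$ is the translation surface obtained by gluing opposite parallel sides by translations; it has genus $2$ and one conical singularity (the image of the vertices), of total angle $6\pi$. A saddle connection is a straight segment joining the singularity to itself with no singularity in its interior; it is identified with its displacement vector in $\mathbb R^2$ when convenient. Affine diffeomorphisms may reverse orientation. The matrices $\nu_j$ and $\gamma$ below are derivatives of affine automorphisms of $X_{\mathcal O}$, and the affine automorphism with a given derivative is unique. If $g$ is a product of these matrices and their inverses and $Q$ is a decomposition of $X_{\mathcal O}$ into quadrilaterals, $g\cdot Q$ denotes the image of $Q$ under the affine automorphism with derivative $g$. **Octagon Farey map.** For $j=0,\dots,7$ let $\overline\Sigma_j=\{\theta: \frac{j\pi}{8}\le\theta\le\frac{(j+1)\pi}{8}\}\subset[0,\pi]$, where $\theta$ stands for the direction of $(\cos\theta,\sin\theta)$. Let $$\nu_0=\begin{pmatrix}1&0\\0&1\end{pmatrix},\ \nu_1=\tfrac1{\sqrt2}\begin{pmatrix}1&1\\1&-1\end{pmatrix},\ \nu_2=\tfrac1{\sqrt2}\begin{pmatrix}1&1\\-1&1\end{pmatrix},\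 \nu_3=\begin{pmatrix}0&1\\1&0\end{pmatrix},$$ $$\nu_4=\begin{pmatrix}0&1\\-1&0\end{pmatrix},\ \nu_5=\tfrac1{\sqrt2}\begin{pmatrix}-1&1\\1&1\end{pmatrix},\ \nu_6=\tfrac1{\sqrt2}\begin{pmatrix}-1&1\\-1&-1\end{pmatrix},\ \nu_7=\begin{pmatrix}-1&0\\0&1\end{pmatrix},$$ so that $\nu_j$ maps $\overline\Sigma_j$ linearly onto $\overline\Sigma_0$, and let $\gamma=\begin{pmatrix}-1&2(1+\sqrt2)\\0&1\end{pmatrix}$, which maps $\overline\Sigma_0$ onto $\overline\Sigma_1\cup\dots\cup\overline\Sigma_7$. The octagon Farey map $F$ sends a direction $\theta\in\overline\Sigma_j$ to the direction of $\gamma\nu_j(\cos\theta,\sin\theta)$ (in the coordinate $u=\cot\theta$ it is the Möbius map of $\gamma\nu_j$). In particular $s_k\in\{1,\dots,7\}$ for $k\ge1$. **The quadrangulation $Q_0$.** The saddle connections of $X_{\mathcal O}$ in direction $0$ are the horizontal side of $\mathcal O$ (length $1$) and the two horizontal diagonals of $\mathcal O$ of length $1+\sqrt2$; those in direction $\pi/8$ are the two short diagonals of $\mathcal O$ in that direction, with vector $(1+\frac{\sqrt2}2,\frac{\sqrt2}2)$, and the long diagonal with vector $(1+\sqrt2,1)$. These six saddle connections have disjoint interiors, and cutting $X_{\mathcal O}$ along them gives three parallelograms, whose pairs of side vectors are $\{(1+\frac{\sqrt2}2,\frac{\sqrt2}2),(1,0)\}$, $\{(1+\frac{\sqrt2}2,\frac{\sqrt2}2),(1+\sqrt2,0)\}$,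 $\{(1+\sqrt2,1),(1+\sqrt2,0)\}$. This decomposition is $Q_0$. **Diagonal changes in direction $\theta$.** A nonzero vector is *left* (resp. *right* ) of $\theta$ if its angle lies in $(\theta,\theta+\pi)$ (resp. $(\theta-\pi,\theta)$) modulo $2\pi$. A quadrilateral in $X_{\mathcal O}$ is the image of an isometrically embedded Euclidean quadrilateral with vertices at the singularity and no other singularities. It is admissible with respect to $\theta$ if it has two bottom sides $w_l,w_r$ starting from a common vertex, with $w_l$ left of $\theta$ and $w_r$ right of $\theta$, and two top sides ending at the opposite vertex, such that the top left side (the one starting at the endpoint of $w_l$) is right of $\theta$ and the top right side (the one starting at the endpoint of $w_r$) is left of $\theta$. The pair $(w_l,w_r)$ is its base wedge; its diagonal $w_d$ goes from the common starting vertex of the bottom sides to the opposite vertex. An admissible quadrangulation of $X_{\mathcal O}$ with respect to $\theta$ is a decomposition of $X_{\mathcal O}$ into admissible quadrilaterals $q_1,\dots,q_k$ (here $k=3$; quadrangulations are considered without labels). It determines permutations $\pi_l,\pi_r$ of $\{1,\dots,k\}$: the top left side of $q_i$ is glued to the bottom right side of $q_{\pi_l(i)}$, and the top right side of $q_i$ is glued to the bottom left side of $q_{\pi_r(i)}$. A staircase is the union of the quadrilaterals $q_i$ with $i$ in a cycle $c$ of $\pi_l$ or of $\pi_r$. For a cycle $c$ of $\pi_r$ it is well slanted with respect to $\theta$ if for every $i\in c$ the diagonal $w_{i,d}$ of $q_i$ is left of $\theta$; the staircase move then simultaneously replaces the base wedge $(w_{i,l},w_{i,r})$ by $(w_{i,d},w_{i,r})$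 for all $i\in c$, leaving the other wedges unchanged. For a cycle $c$ of $\pi_l$ it is well slanted if for every $i\in c$ the diagonal $w_{i,d}$ is right of $\theta$; the staircase move then replaces $(w_{i,l},w_{i,r})$ by $(w_{i,l},w_{i,d})$ for all $i\in c$, leaving the other wedges unchanged. The new wedges are the base wedges of a new admissible quadrangulation with respect to $\theta$, which is the result of the move. Its permutations are: for $c$ a cycle of $\pi_r$, $\pi_l'(i)=\pi_l(\pi_r(i))$ if $i\in c$, $\pi_l'(i)=\pi_l(i)$ otherwise, and $\pi_r'=\pi_r$; for $c$ a cycle of $\pi_l$, $\pi_r'(i)=\pi_r(\pi_l(i))$ if $i\in c$, $\pi_r'(i)=\pi_r(i)$ otherwise, and $\pi_l'=\pi_l$. *)

theory Defs
  imports "HOL-Analysis.Analysis" "HOL-Combinatorics.Combinatorics"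
begin

abbreviation vec2 :: "real \<Rightarrow> real \<Rightarrow> real^2" where
  "vec2 x y \<equiv> vector [x, y]"

abbreviation mat2 :: "real \<Rightarrow> real \<Rightarrow> real \<Rightarrow> real \<Rightarrow> real^2^2" where
  "mat2 a b c d \<equiv> vector [vector [a, b], vector [c, d]]"

section \<open>The octagon surface\<close>

definition octv :: "nat \<Rightarrow> real^2" where
  "octv i =
     [vec2 0 0, vec2 1 0,
      vec2 (1 + sqrt 2 / 2) (sqrt 2 / 2), vec2 (1 + sqrt 2 / 2) (1 + sqrt 2 / 2),
      vec2 1 (1 + sqrt 2), vec2 0 (1 + sqrt 2),
      vec2 (- (sqrt 2 / 2)) (1 + sqrt 2 / 2), vec2 (- (sqrt 2 / 2)) (sqrt 2 / 2)] ! (i mod 8)"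

definition octagon :: "(real^2) set" where
  "octagon = convex hull (octv ` {..<8})"

text \<open>The translation that carries side \<open>i\<close> onto the opposite side \<open>i + 4\<close> sends its initial
  vertex \<open>octv i\<close> to \<open>octv (i + 5)\<close> (and its final vertex \<open>octv (i + 1)\<close> to \<open>octv (i + 4)\<close>).\<close>

definition glue :: "real^2 \<Rightarrow> real^2 \<Rightarrow> bool" where
  "glue p q \<longleftrightarrow>
     (\<exists>i<8. p \<in> closed_segment (octv i) (octv (i + 1)) \<and> q = p + (octv (i + 5) - octv i))"

definition same_point :: "real^2 \<Rightarrow> real^2 \<Rightarrow> bool" where
  "same_point p q \<longleftrightarrow> p \<in> octagon \<and> q \<in> octagon \<and> equivclp glue p q"

lemma part_equivp_same_point: "part_equivp same_point"
proof (rule part_equivpI)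
  have "octv 0 \<in> octagon"
    unfolding octagon_def by (rule hull_inc) simp
  then show "\<exists>p. same_point p p"
    unfolding same_point_def by auto
  show "symp same_point"
    by (rule sympI) (auto simp: same_point_def intro: equivclp_sym)
  show "transp same_point"
    by (rule transpI) (auto simp: same_point_def intro: equivclp_trans)
qed

quotient_type octsurf = "real^2" / partial: same_point
  by (rule part_equivp_same_point)

text \<open>The quotient map; it is only meaningful on \<^const>\<open>octagon\<close>.\<close>

definition proj :: "real^2 \<Rightarrow> octsurf" where
  "proj p = abs_octsurf p"

definition sing :: octsurf where
  "sing = proj (octv 0)"

instantiation octsurf :: topological_space
begin

definition open_octsurf :: "octsurf set \<Rightarrow> bool" where
  "open_octsurf U \<longleftrightarrow> openin (top_of_set octagon) {p \<in> octagon. proj p \<in> U}"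

instance
proof
  show "open (UNIV :: octsurf set)"
    by (simp add: open_octsurf_def)
next
  fix S T :: "octsurf set"
  assume "open S" "open T"
  moreover have "{p \<in> octagon. proj p \<in> S \<inter> T}
      = {p \<in> octagon. proj p \<in> S} \<inter> {p \<in> octagon. proj p \<in> T}"
    by auto
  ultimately show "open (S \<inter> T)"
    by (simp only: open_octsurf_def openin_Int)
next
  fix K :: "octsurf set set"
  assume K: "\<forall>S\<in>K. open S"
  have "{p \<in> octagon. proj p \<in> \<Union>K} = (\<Union>S\<in>K. {p \<in> octagon. proj p \<in> S})"
    by auto
  with K show "open (\<Union>K)"
    by (auto simp: open_octsurf_def)
qed

end

section \<open>Translation structure and affine automorphisms\<close>

text \<open>\<open>\<phi>\<close> is locally a translation: near \<open>z\<close> it is given by \<open>w \<mapsto> p + (w - z)\<close> for representatives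
  \<open>p\<close> of \<open>\<phi> z\<close>. The representative may depend on \<open>w\<close>, since a point on a side has two
  representatives, one for each half of a neighbourhood, and the singularity has eight. For open
  \<open>U\<close> with \<open>\<phi> ` U\<close> avoiding the singularity, the injective maps with this property are the charts
  (strictly, their inverses) of the translation surface.\<close>

definition translation_on :: "(real^2) set \<Rightarrow> (real^2 \<Rightarrow> octsurf) \<Rightarrow> bool" where
  "translation_on U \<phi> \<longleftrightarrow>
     (\<forall>z\<in>U. \<exists>e>0. \<forall>w\<in>U \<inter> ball z e.
        \<exists>p\<in>octagon. p + (w - z) \<in> octagon \<and> proj p = \<phi> z \<and> proj (p + (w - z)) = \<phi> w)"

text \<open>\<open>\<phi>\<close> parametrizes a piece of the surface without the singularity by translations; the last condition
  says that \<open>f\<close> is affine there with linear part \<open>A\<close>, as it conjugates \<open>\<phi>\<close> to another such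
  parametrization over \<open>A U\<close>. The linear part may reverse orientation.\<close>

definition affine_aut :: "real^2^2 \<Rightarrow> (octsurf \<Rightarrow> octsurf) \<Rightarrow> bool" where
  "affine_aut A f \<longleftrightarrow>
     invertible A \<and> (\<exists>g. homeomorphism UNIV UNIV f g) \<and> f sing = sing \<and>
     (\<forall>U \<phi>. open U \<and> translation_on U \<phi> \<and> sing \<notin> \<phi> ` U \<longrightarrow>
        translation_on ((\<lambda>z. A *v z) ` U) (\<lambda>w. f (\<phi> (matrix_inv A *v w))))"

definition aut_of :: "real^2^2 \<Rightarrow> octsurf \<Rightarrow> octsurf" where
  "aut_of A = (THE f. affine_aut A f)"

section \<open>Admissible quadrangulations\<close>

text \<open>A decomposition into quadrilaterals is represented by the set of its open cells, i.e. of the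
  images of the interiors of the quadrilaterals. (The closed image of a quadrilateral with two
  sides glued together would not determine the quadrilateral.)\<close>

definition act :: "real^2^2 \<Rightarrow> octsurf set set \<Rightarrow> octsurf set set" where
  "act A Q = (\<lambda>c. aut_of A ` c) ` Q"

definition dir :: "real \<Rightarrow> real^2" where
  "dir t = vec2 (cos t) (sin t)"

definition left_of :: "real \<Rightarrow> real^2 \<Rightarrow> bool" where
  "left_of \<theta> v \<longleftrightarrow> (\<exists>r>0. \<exists>t\<in>{\<theta><..<\<theta> + pi}. v = r *\<^sub>R dir t)"

definition right_of :: "real \<Rightarrow> real^2 \<Rightarrow> bool" where
  "right_of \<theta> v \<longleftrightarrow> (\<exists>r>0. \<exists>t\<in>{\<theta> - pi<..<\<theta>}. v = r *\<^sub>R dir t)"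

text \<open>A quadrilateral in the plane with vertices, in counterclockwise order, \<open>0\<close>, \<open>br\<close>, \<open>dg\<close>, \<open>bl\<close>,
  together with a map \<open>emb\<close> of it to the surface.\<close>

record quad =
  bl :: "real^2"
  br :: "real^2"
  dg :: "real^2"
  emb :: "real^2 \<Rightarrow> octsurf"

text \<open>The two positively oriented triangles lie on opposite sides of the diagonal from \<open>0\<close> to \<open>dg\<close>.
  In a quadrilateral that is admissible with \<open>0\<close> as its bottom vertex this diagonal is
  always interior, even if the quadrilateral is not convex. The orientation condition is also what
  distinguishes the bottom vertex from the top one: the left/right conditions alone
  are invariant under a rotation by \<open>\<pi>\<close> exchanging them.\<close>

definition region :: "quad \<Rightarrow> (real^2) set" where
  "region q = convex hull {0, br q, dg q} \<union> convex hull {0, dg q, bl q}"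

definition embedded_quad :: "quad \<Rightarrow> bool" where
  "embedded_quad q \<longleftrightarrow>
     det (vector [br q, dg q] :: real^2^2) > 0 \<and> det (vector [dg q, bl q] :: real^2^2) > 0 \<and>
     translation_on (region q) (emb q) \<and> inj_on (emb q) (interior (region q)) \<and>
     (\<forall>z\<in>region q. emb q z = sing \<longleftrightarrow> z \<in> {0, br q, dg q, bl q})"

definition admissible :: "real \<Rightarrow> quad \<Rightarrow> bool" where
  "admissible \<theta> q \<longleftrightarrow> embedded_quad q \<and>
     left_of \<theta> (bl q) \<and> right_of \<theta> (br q) \<and>
     right_of \<theta> (dg q - bl q) \<and> left_of \<theta> (dg q - br q)"

definition open_cell :: "quad \<Rightarrow> octsurf set" where
  "open_cell q = emb q ` interior (region q)"

definition closed_cell :: "quad \<Rightarrow> octsurf set" where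
  "closed_cell q = emb q ` region q"

definition bottom_left :: "quad \<Rightarrow> octsurf set" where
  "bottom_left q = emb q ` closed_segment 0 (bl q)"

definition bottom_right :: "quad \<Rightarrow> octsurf set" where
  "bottom_right q = emb q ` closed_segment 0 (br q)"

definition top_left :: "quad \<Rightarrow> octsurf set" where
  "top_left q = emb q ` closed_segment (bl q) (dg q)"

definition top_right :: "quad \<Rightarrow> octsurf set" where
  "top_right q = emb q ` closed_segment (br q) (dg q)"

definition diagonal :: "quad \<Rightarrow> octsurf set" where
  "diagonal q = emb q ` closed_segment 0 (dg q)"

definition labelled_quadrangulation :: "real \<Rightarrow> (nat \<Rightarrow> quad) \<Rightarrow> bool" where
  "labelled_quadrangulation \<theta> q \<longleftrightarrow>
     (\<forall>i\<in>{1..3}. admissible \<theta> (q i)) \<and>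
     disjoint_family_on (\<lambda>i. open_cell (q i)) {1..3} \<and>
     (\<Union>i\<in>{1..3}. closed_cell (q i)) = UNIV"

definition cells :: "(nat \<Rightarrow> quad) \<Rightarrow> octsurf set set" where
  "cells q = (\<lambda>i. open_cell (q i)) ` {1..3}"

definition admissible_quadrangulation :: "real \<Rightarrow> octsurf set set \<Rightarrow> bool" where
  "admissible_quadrangulation \<theta> Q \<longleftrightarrow> (\<exists>q. labelled_quadrangulation \<theta> q \<and> Q = cells q)"

section \<open>Staircase moves\<close>

definition perm_left :: "(nat \<Rightarrow> quad) \<Rightarrow> (nat \<Rightarrow> nat) \<Rightarrow> bool" where
  "perm_left q \<pi> \<longleftrightarrow> \<pi> permutes {1..3} \<and> (\<forall>i\<in>{1..3}. top_left (q i) = bottom_right (q (\<pi> i)))"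

definition perm_right :: "(nat \<Rightarrow> quad) \<Rightarrow> (nat \<Rightarrow> nat) \<Rightarrow> bool" where
  "perm_right q \<pi> \<longleftrightarrow> \<pi> permutes {1..3} \<and> (\<forall>i\<in>{1..3}. top_right (q i) = bottom_left (q (\<pi> i)))"

definition wedge :: "quad \<Rightarrow> octsurf set \<times> octsurf set" where
  "wedge q = (bottom_left q, bottom_right q)"

definition right_staircase_move ::
    "real \<Rightarrow> (nat \<Rightarrow> quad) \<Rightarrow> nat set \<Rightarrow> (nat \<Rightarrow> quad) \<Rightarrow> bool" where
  "right_staircase_move \<theta> q c q' \<longleftrightarrow>
     (\<exists>\<pi>. perm_right q \<pi> \<and> c \<subseteq> {1..3} \<and> cyclic_on \<pi> c) \<and>
     (\<forall>i\<in>c. left_of \<theta> (dg (q i))) \<and>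
     (\<forall>i\<in>{1..3}. wedge (q' i) = (if i \<in> c then (diagonal (q i), bottom_right (q i)) else wedge (q i)))"

definition left_staircase_move ::
    "real \<Rightarrow> (nat \<Rightarrow> quad) \<Rightarrow> nat set \<Rightarrow> (nat \<Rightarrow> quad) \<Rightarrow> bool" where
  "left_staircase_move \<theta> q c q' \<longleftrightarrow>
     (\<exists>\<pi>. perm_left q \<pi> \<and> c \<subseteq> {1..3} \<and> cyclic_on \<pi> c) \<and>
     (\<forall>i\<in>c. right_of \<theta> (dg (q i))) \<and>
     (\<forall>i\<in>{1..3}. wedge (q' i) = (if i \<in> c then (bottom_left (q i), diagonal (q i)) else wedge (q i)))"

text \<open>The base wedges contain all sides, so they determine the resulting quadrangulation.\<close>

definition diagonal_change :: "real \<Rightarrow> octsurf set set \<Rightarrow> octsurf set set \<Rightarrow> bool" where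
  "diagonal_change \<theta> Q Q' \<longleftrightarrow>
     (\<exists>q q' c. labelled_quadrangulation \<theta> q \<and> Q = cells q \<and>
        labelled_quadrangulation \<theta> q' \<and> Q' = cells q' \<and>
        (right_staircase_move \<theta> q c q' \<or> left_staircase_move \<theta> q c q'))"

section \<open>The octagon Farey algorithm\<close>

definition nu :: "nat \<Rightarrow> real^2^2" where
  "nu j =
     [mat2 1 0 0 1,
      (1 / sqrt 2) *\<^sub>R mat2 1 1 1 (-1),
      (1 / sqrt 2) *\<^sub>R mat2 1 1 (-1) 1,
      mat2 0 1 1 0,
      mat2 0 1 (-1) 0,
      (1 / sqrt 2) *\<^sub>R mat2 (-1) 1 1 1,
      (1 / sqrt 2) *\<^sub>R mat2 (-1) 1 (-1) (-1),
      mat2 (-1) 0 0 1] ! j"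

definition gam :: "real^2^2" where
  "gam = mat2 (-1) (2 * (1 + sqrt 2)) 0 1"

definition sector :: "nat \<Rightarrow> real set" where
  "sector j = {real j * pi / 8 .. real (j + 1) * pi / 8}"

text \<open>Where two sectors meet, both branches give the same direction.\<close>

definition farey :: "real \<Rightarrow> real" where
  "farey \<theta> = (THE \<eta>. \<eta> \<in> {0..pi} \<and>
     (\<exists>j<8. \<theta> \<in> sector j \<and> (\<exists>r>0. (gam ** nu j) *v dir \<theta> = r *\<^sub>R dir \<eta>)))"

primrec hmat :: "(nat \<Rightarrow> nat) \<Rightarrow> nat \<Rightarrow> real^2^2" where
  "hmat s 0 = mat 1"
| "hmat s (Suc k) = (gam ** nu (s k)) ** hmat s k"

text \<open>The six saddle connections in directions \<open>0\<close> and \<open>\<pi>/8\<close>.\<close>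

definition cuts :: "octsurf set" where
  "cuts = proj `
     (closed_segment (octv 0) (octv 1) \<union> closed_segment (octv 7) (octv 2) \<union>
      closed_segment (octv 6) (octv 3) \<union>
      closed_segment (octv 0) (octv 2) \<union> closed_segment (octv 6) (octv 4) \<union>
      closed_segment (octv 7) (octv 3))"

definition Q0 :: "octsurf set set" where
  "Q0 = components (UNIV - cuts)"

definition farey_quadrangulation :: "(nat \<Rightarrow> nat) \<Rightarrow> nat \<Rightarrow> octsurf set set" where
  "farey_quadrangulation s k = act (matrix_inv (hmat s k) ** matrix_inv (nu (s k))) Q0"

end

theory Submission
  imports Defs
begin

text \<open>A decomposition of the surface into convex quadrilaterals is recorded as a bijection from the disjoint
  union of half-open quadrilaterals to the complement of the singularity. A staircase move merely regroups
  the triangles into which the diagonals cut these quadrilaterals, so that it preserves such decompositions;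
  it never matters how the new quadrilaterals lie in the octagon. In the end a decomposition is recognized
  by the directions of its sides alone: in each of the directions \<open>0\<close> and \<open>pi / 8\<close> there are only
  three saddle connections, and the cells are the components of the complement of the sides.

  By rigidity of translations, an affine automorphism is determined by its derivative. The symmetries of the
  octagon yield the automorphisms with derivatives \<^const>\<open>nu\<close>, and the decomposition \<^const>\<open>Q0\<close>
  yields the one with derivative \<^const>\<open>gam\<close>, which preserves \<^const>\<open>Q0\<close>. Hence, up to an automorphism, each step of
  the Farey algorithm starts at \<^const>\<open>Q0\<close>, now with base sides in the directions \<open>pi\<close> and
  \<open>pi / 8\<close>, and ends at the image of \<^const>\<open>Q0\<close> under the inverse of \<open>nu j\<close>, for a direction in the
  \<open>j\<close>th sector and \<open>j > 0\<close>. For each of the seven values of \<open>j\<close> this is an explicit chain of moves, in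
  which only vectors and permutations have to be computed.\<close>

section \<open>Planar quadrilaterals\<close>

text \<open>The starting point \<open>Q0\<close> comes from \<open>gam\<close> being an involution
  that preserves \<open>Q0\<close>: since h_(k+1) = gam nu h_k, the quadrangulation h_k^-1 nu^-1 Q0
  equals h_(k+1)^-1 gam Q0 = h_(k+1)^-1 Q0. So one automorphism, with derivative h_(k+1)^-1, carries
  \<open>Q0\<close> to Q^(k) and the image of \<open>Q0\<close> under the inverse of
  \<open>nu j\<close>, j = s_(k+1), to Q^(k+1). The obstacle is that the parallelograms of
  \<open>Q0\<close> do not fit into the octagon, so their embeddings would have to be assembled by
  hand. The only decomposition verified inside the octagon is therefore the one into two trapezoids
  and a rectangle. Two moves and a rotation lead from it to \<open>Q0\<close>, and this indirect
  description is also what produces the automorphism \<open>gam\<close>. As \<open>aut_of\<close> is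
  a definite description, constructing automorphisms is not enough: uniqueness has to hold among all
  maps satisfying \<open>affine_aut\<close>, hence the rigidity argument. Admissibility of each
  Q^(k) comes with the chain of moves, because the source of a diagonal change is
  admissible.\<close>

definition cross :: "real^2 \<Rightarrow> real^2 \<Rightarrow> real" where
  "cross a b = a$1 * b$2 - a$2 * b$1"

lemma det_vector_cross: "det (vector [a, b] :: real^2^2) = cross a b"
  by (simp add: det_2 cross_def)

lemma cross_simps:
  "cross (a + b) c = cross a c + cross b c" "cross a (b + c) = cross a b + cross a c"
  "cross (a - b) c = cross a c - cross b c" "cross a (b - c) = cross a b - cross a c"
  "cross (t *\<^sub>R a) b = t * cross a b" "cross a (t *\<^sub>R b) = t * cross a b"
  "cross (- a) b = - cross a b" "cross a (- b) = - cross a b"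
  "cross a a = 0" "cross 0 a = 0" "cross a 0 = 0"
  by (simp_all add: cross_def algebra_simps)

lemma cross_swap: "cross a b = - cross b a"
  by (simp add: cross_def)

lemma cramer:
  assumes "cross a b \<noteq> 0"
  shows "z = (cross z b / cross a b) *\<^sub>R a + (cross a z / cross a b) *\<^sub>R b"
proof -
  have *: "cross a b *\<^sub>R z = cross z b *\<^sub>R a + cross a z *\<^sub>R b"
    by (simp add: vec_eq_iff forall_2 cross_def algebra_simps)
  have "z = inverse (cross a b) *\<^sub>R (cross a b *\<^sub>R z)"
    using assms by simp
  then show ?thesis
    unfolding * by (simp add: scaleR_right_distrib divide_inverse mult.commute)
qed

text \<open>The vertices of a quadrilateral in counterclockwise order are \<open>0\<close>, \<open>b\<close>, \<open>d\<close>, \<open>l\<close>.\<close>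

definition convex_quad :: "real^2 \<Rightarrow> real^2 \<Rightarrow> real^2 \<Rightarrow> bool" where
  "convex_quad b d l \<longleftrightarrow> cross b l > 0 \<and> cross b d > 0 \<and> cross (d - b) (l - d) > 0 \<and> cross d l > 0"

definition closed_quad :: "real^2 \<Rightarrow> real^2 \<Rightarrow> real^2 \<Rightarrow> (real^2) set" where
  "closed_quad b d l = {z. cross b z \<ge> 0 \<and> cross z l \<ge> 0 \<and>
     cross (d - b) (z - b) \<ge> 0 \<and> cross (l - d) (z - d) \<ge> 0}"

definition open_quad :: "real^2 \<Rightarrow> real^2 \<Rightarrow> real^2 \<Rightarrow> (real^2) set" where
  "open_quad b d l = {z. cross b z > 0 \<and> cross z l > 0 \<and>
     cross (d - b) (z - b) > 0 \<and> cross (l - d) (z - d) > 0}"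

text \<open>Of the sides, only the two open bottom ones belong to a half-open quadrilateral, so that half-open
  quadrilaterals decompose a surface without its vertices. Cutting one along a diagonal yields a lower and
  an upper triangle of the kinds below.\<close>

definition half_open_quad :: "real^2 \<Rightarrow> real^2 \<Rightarrow> real^2 \<Rightarrow> (real^2) set" where
  "half_open_quad b d l = {z. z \<noteq> 0 \<and> cross b z \<ge> 0 \<and> cross z l \<ge> 0 \<and>
     cross (d - b) (z - b) > 0 \<and> cross (l - d) (z - d) > 0}"

definition closed_tri :: "real^2 \<Rightarrow> real^2 \<Rightarrow> (real^2) set" where
  "closed_tri a b = {z. cross a z \<ge> 0 \<and> cross z b \<ge> 0 \<and> cross (b - a) (z - a) \<ge> 0}"

definition lower_tri :: "real^2 \<Rightarrow> real^2 \<Rightarrow> (real^2) set" where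
  "lower_tri a b = {z. z \<noteq> 0 \<and> cross a z \<ge> 0 \<and> cross z b \<ge> 0 \<and> cross (b - a) (z - a) > 0}"

definition upper_tri :: "real^2 \<Rightarrow> real^2 \<Rightarrow> (real^2) set" where
  "upper_tri a b = {z. cross a z > 0 \<and> cross z b \<ge> 0 \<and> cross (b - a) (z - a) > 0}"

text \<open>Barycentric coordinates: each half-plane condition of the triangle with vertices 0,
  \<open>a\<close>, \<open>b\<close> is the sign of one coordinate, scaled by
  \<open>cross a b\<close>.\<close>

lemma tri_coords:
  assumes "cross a b > 0"
  obtains v w where "z = v *\<^sub>R a + w *\<^sub>R b" "cross z b = v * cross a b" "cross a z = w * cross a b"
    "cross (b - a) (z - a) = (1 - v - w) * cross a b"
proof
  show 1: "z = (cross z b / cross a b) *\<^sub>R a + (cross a z / cross a b) *\<^sub>R b"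
    using assms by (intro cramer) simp
  show "cross (b - a) (z - a) = (1 - cross z b / cross a b - cross a z / cross a b) * cross a b"
    using assms by (simp add: left_diff_distrib) (simp add: cross_def algebra_simps)
qed (use assms in auto)

lemma tri_mem_coords:
  assumes "cross a b > 0"
  shows "z \<in> closed_tri a b \<Longrightarrow> \<exists>v w. z = v *\<^sub>R a + w *\<^sub>R b \<and> v \<ge> 0 \<and> w \<ge> 0 \<and> 1 - v - w \<ge> 0"
    "z \<in> lower_tri a b \<Longrightarrow> \<exists>v w. z = v *\<^sub>R a + w *\<^sub>R b \<and> v \<ge> 0 \<and> w \<ge> 0 \<and> 1 - v - w > 0"
    "z \<in> upper_tri a b \<Longrightarrow> \<exists>v w. z = v *\<^sub>R a + w *\<^sub>R b \<and> v \<ge> 0 \<and> w > 0 \<and> 1 - v - w > 0"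
proof -
  obtain v w where *: "z = v *\<^sub>R a + w *\<^sub>R b" "cross z b = v * cross a b" "cross a z = w * cross a b"
    "cross (b - a) (z - a) = (1 - v - w) * cross a b"
    by (rule tri_coords[OF assms])
  have "cross z b \<ge> 0 \<longleftrightarrow> v \<ge> 0" "cross a z \<ge> 0 \<longleftrightarrow> w \<ge> 0" "cross a z > 0 \<longleftrightarrow> w > 0"
      "cross (b - a) (z - a) \<ge> 0 \<longleftrightarrow> 1 - v - w \<ge> 0" "cross (b - a) (z - a) > 0 \<longleftrightarrow> 1 - v - w > 0"
    unfolding *(2-4) using assms by (auto simp: zero_le_mult_iff zero_less_mult_iff)
  then show "z \<in> closed_tri a b \<Longrightarrow> \<exists>v w. z = v *\<^sub>R a + w *\<^sub>R b \<and> v \<ge> 0 \<and> w \<ge> 0 \<and> 1 - v - w \<ge> 0"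
    "z \<in> lower_tri a b \<Longrightarrow> \<exists>v w. z = v *\<^sub>R a + w *\<^sub>R b \<and> v \<ge> 0 \<and> w \<ge> 0 \<and> 1 - v - w > 0"
    "z \<in> upper_tri a b \<Longrightarrow> \<exists>v w. z = v *\<^sub>R a + w *\<^sub>R b \<and> v \<ge> 0 \<and> w > 0 \<and> 1 - v - w > 0"
    using *(1) by (auto simp: closed_tri_def lower_tri_def upper_tri_def)
qed

lemma convex_hull_tri:
  assumes "cross a b > 0"
  shows "convex hull {0, a, b} = closed_tri a b"
proof (rule set_eqI)
  fix z
  show "z \<in> convex hull {0, a, b} \<longleftrightarrow> z \<in> closed_tri a b"
  proof
    assume "z \<in> convex hull {0, a, b}"
    then obtain u v w where *: "u \<ge> 0" "v \<ge> 0" "w \<ge> 0" "u + v + w = 1" "z = v *\<^sub>R a + w *\<^sub>R b"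
      unfolding convex_hull_3 by auto
    have "cross (b - a) (z - a) = (1 - v - w) * cross a b" "cross a z = w * cross a b" "cross z b = v * cross a b"
      unfolding * by (simp_all add: cross_def algebra_simps)
    moreover have "1 - v - w = u" using *(4) by simp
    ultimately show "z \<in> closed_tri a b"
      using * assms by (simp add: closed_tri_def)
  next
    assume z: "z \<in> closed_tri a b"
    then obtain v w where *: "z = v *\<^sub>R a + w *\<^sub>R b" "v \<ge> 0" "w \<ge> 0" "1 - v - w \<ge> 0"
      using tri_mem_coords(1)[OF assms] by blast
    then have "\<exists>u\<ge>0. \<exists>v\<ge>0. \<exists>w\<ge>0. u + v + w = 1 \<and> z = u *\<^sub>R 0 + v *\<^sub>R a + w *\<^sub>R b"
      by (intro exI[of _ "1 - v - w"] conjI exI[of _ v] exI[of _ w]) auto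
    then show "z \<in> convex hull {0, a, b}"
      unfolding convex_hull_3 by blast
  qed
qed

text \<open>Each triangle shares two side conditions with the quadrilateral. The other two are
  nonnegative combinations of the corner determinants of \<open>convex_quad\<close>, with
  barycentric coordinates as coefficients.\<close>

lemma tri_subset_quad:
  assumes q: "convex_quad b d l"
  shows "closed_tri b d \<subseteq> closed_quad b d l" "closed_tri d l \<subseteq> closed_quad b d l"
    "closed_tri b l \<subseteq> closed_quad b d l"
proof -
  have pos: "cross b d > 0" "cross d l > 0" "cross b l > 0" "cross (d - b) (l - d) > 0"
    using q by (auto simp: convex_quad_def)
  show "closed_tri b d \<subseteq> closed_quad b d l"
  proof
    fix z assume z: "z \<in> closed_tri b d"
    obtain v w where *: "z = v *\<^sub>R b + w *\<^sub>R d" and vw: "v \<ge> 0" "w \<ge> 0" "1 - v - w \<ge> 0"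
        using tri_mem_coords(1)[OF pos(1)] z by blast
    have "cross z l = v * cross b l + w * cross d l"
      unfolding * by (simp add: cross_simps)
    moreover have "cross (l - d) (z - d) = (1 - v - w) * cross d l + v * cross (d - b) (l - d)"
      unfolding * by (simp add: cross_def algebra_simps)
    ultimately show "z \<in> closed_quad b d l"
      using z vw pos by (auto simp: closed_quad_def closed_tri_def intro!: add_nonneg_nonneg mult_nonneg_nonneg)
  qed
  show "closed_tri d l \<subseteq> closed_quad b d l"
  proof
    fix z assume z: "z \<in> closed_tri d l"
    obtain v w where *: "z = v *\<^sub>R d + w *\<^sub>R l" and vw: "v \<ge> 0" "w \<ge> 0" "1 - v - w \<ge> 0"
        using tri_mem_coords(1)[OF pos(2)] z by blast
    have "cross b z = v * cross b d + w * cross b l"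
      unfolding * by (simp add: cross_simps)
    moreover have "cross (d - b) (z - b) = (1 - v - w) * cross b d + w * cross (d - b) (l - d)"
      unfolding * by (simp add: cross_def algebra_simps)
    ultimately show "z \<in> closed_quad b d l"
      using z vw pos by (auto simp: closed_quad_def closed_tri_def intro!: add_nonneg_nonneg mult_nonneg_nonneg)
  qed
  show "closed_tri b l \<subseteq> closed_quad b d l"
  proof
    fix z assume z: "z \<in> closed_tri b l"
    obtain v w where *: "z = v *\<^sub>R b + w *\<^sub>R l" and vw: "v \<ge> 0" "w \<ge> 0" "1 - v - w \<ge> 0"
        using tri_mem_coords(1)[OF pos(3)] z by blast
    have "cross (d - b) (z - b) = (1 - v - w) * cross b d + w * cross (d - b) (l - d)"
      unfolding * by (simp add: cross_def algebra_simps)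
    moreover have "cross (l - d) (z - d) = (1 - v - w) * cross d l + v * cross (d - b) (l - d)"
      unfolding * by (simp add: cross_def algebra_simps)
    ultimately show "z \<in> closed_quad b d l"
      using z vw pos by (auto simp: closed_quad_def closed_tri_def intro!: add_nonneg_nonneg mult_nonneg_nonneg)
  qed
qed

lemma closed_quad_split:
  assumes "convex_quad b d l"
  shows "closed_quad b d l = closed_tri b d \<union> closed_tri d l"
proof (intro equalityI subsetI)
  fix z assume "z \<in> closed_quad b d l"
  then show "z \<in> closed_tri b d \<union> closed_tri d l"
    using cross_swap[of z d] by (cases "cross z d \<ge> 0") (auto simp: closed_quad_def closed_tri_def)
qed (use tri_subset_quad[OF assms] in auto)

text \<open>The cut along the other diagonal, from \<open>b\<close> to \<open>l\<close>; the upper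
  triangle is described from \<open>b\<close> as its origin. A move compares old cells cut along the
  main diagonal with new cells cut in this way.\<close>

lemma closed_quad_split':
  assumes q: "convex_quad b d l"
  shows "closed_quad b d l = closed_tri b l \<union> (\<lambda>z. b + z) ` closed_tri (d - b) (l - b)"
proof (intro equalityI subsetI)
  fix z assume z: "z \<in> closed_quad b d l"
  show "z \<in> closed_tri b l \<union> (\<lambda>z. b + z) ` closed_tri (d - b) (l - b)"
  proof (cases "cross (l - b) (z - b) \<ge> 0")
    case True
    then show ?thesis using z by (auto simp: closed_quad_def closed_tri_def)
  next
    case False
    then have "z - b \<in> closed_tri (d - b) (l - b)"
      using z cross_swap[of "z - b" "l - b"] by (auto simp: closed_quad_def closed_tri_def)
    then show ?thesis by (intro UnI2 image_eqI[of _ _ "z - b"]) auto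
  qed
next
  fix z assume "z \<in> closed_tri b l \<union> (\<lambda>z. b + z) ` closed_tri (d - b) (l - b)"
  then show "z \<in> closed_quad b d l"
  proof
    assume "z \<in> (\<lambda>z. b + z) ` closed_tri (d - b) (l - b)"
    then obtain y where y: "y \<in> closed_tri (d - b) (l - b)" "z = b + y" by auto
    have pos: "cross b d > 0" "cross d l > 0" "cross b l > 0" "cross (d - b) (l - b) > 0"
      using q by (auto simp: convex_quad_def cross_def algebra_simps)
    obtain v w where *: "y = v *\<^sub>R (d - b) + w *\<^sub>R (l - b)" and vw: "v \<ge> 0" "w \<ge> 0" "1 - v - w \<ge> 0"
        using tri_mem_coords(1)[OF pos(4)] y(1) by blast
    have "cross b z = v * cross b d + w * cross b l"
      unfolding * y(2) by (simp add: cross_def algebra_simps)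
    moreover have "cross z l = (1 - v - w) * cross b l + v * cross d l"
      unfolding * y(2) by (simp add: cross_def algebra_simps)
    moreover have "cross (d - b) (z - b) = cross (d - b) y"
        "cross (l - d) (z - d) = cross ((l - b) - (d - b)) (y - (d - b))"
      unfolding y(2) by (simp_all add: cross_def algebra_simps)
    ultimately show ?thesis
      using y(1) vw pos by (auto simp: closed_quad_def closed_tri_def intro!: add_nonneg_nonneg mult_nonneg_nonneg)
  qed (use tri_subset_quad[OF q] in auto)
qed

lemma half_open_quad_split:
  assumes q: "convex_quad b d l"
  shows "half_open_quad b d l = lower_tri b d \<union> upper_tri d l"
    "lower_tri b d \<inter> upper_tri d l = {}"
proof -
  have pos: "cross b d > 0" "cross d l > 0" "cross b l > 0" "cross (d - b) (l - d) > 0"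
    using q by (auto simp: convex_quad_def)
  show "lower_tri b d \<inter> upper_tri d l = {}"
    using cross_swap[of d] by (auto simp: lower_tri_def upper_tri_def)
  show "half_open_quad b d l = lower_tri b d \<union> upper_tri d l"
  proof (intro equalityI subsetI)
    fix z assume "z \<in> half_open_quad b d l"
    then show "z \<in> lower_tri b d \<union> upper_tri d l"
      using cross_swap[of z d] by (cases "cross z d \<ge> 0") (auto simp: half_open_quad_def lower_tri_def upper_tri_def)
  next
    fix z assume "z \<in> lower_tri b d \<union> upper_tri d l"
    then show "z \<in> half_open_quad b d l"
    proof
      assume z: "z \<in> lower_tri b d"
      obtain v w where *: "z = v *\<^sub>R b + w *\<^sub>R d" and vw: "v \<ge> 0" "w \<ge> 0" "1 - v - w > 0"
        using tri_mem_coords(2)[OF pos(1)] z by blast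
      have "cross z l = v * cross b l + w * cross d l"
        unfolding * by (simp add: cross_simps)
      moreover have "cross (l - d) (z - d) = (1 - v - w) * cross d l + v * cross (d - b) (l - d)"
        unfolding * by (simp add: cross_def algebra_simps)
      ultimately show ?thesis
        using z vw pos by (auto simp: half_open_quad_def lower_tri_def intro!: add_nonneg_nonneg add_pos_nonneg mult_nonneg_nonneg)
    next
      assume z: "z \<in> upper_tri d l"
      obtain v w where *: "z = v *\<^sub>R d + w *\<^sub>R l" and vw: "v \<ge> 0" "w > 0" "1 - v - w > 0"
        using tri_mem_coords(3)[OF pos(2)] z by blast
      have "cross b z = v * cross b d + w * cross b l"
        unfolding * by (simp add: cross_simps)
      moreover have "cross (d - b) (z - b) = (1 - v - w) * cross b d + w * cross (d - b) (l - d)"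
        unfolding * by (simp add: cross_def algebra_simps)
      ultimately show ?thesis
        using z vw pos cross_simps(11)[of d]
        by (auto simp: half_open_quad_def upper_tri_def intro!: add_nonneg_nonneg add_pos_nonneg mult_nonneg_nonneg)
    qed
  qed
qed

text \<open>The open edge from \<open>b\<close> to \<open>l\<close> goes to the upper triangle. In
  the cut of \<open>half_open_quad_split\<close> the corresponding edge of the upper triangle is the
  bottom left side of the cell, so the same half-open triangle fits both cuts and a move neither
  loses nor doubles points.\<close>

lemma half_open_quad_split':
  assumes q: "convex_quad b d l"
  shows "half_open_quad b d l = lower_tri b l \<union> (\<lambda>z. b + z) ` upper_tri (d - b) (l - b)"
    "lower_tri b l \<inter> (\<lambda>z. b + z) ` upper_tri (d - b) (l - b) = {}"
proof -
  have pos: "cross b d > 0" "cross d l > 0" "cross b l > 0" "cross (d - b) (l - d) > 0" "cross (d - b) (l - b) > 0"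
    using q by (auto simp: convex_quad_def cross_def algebra_simps)
  show "lower_tri b l \<inter> (\<lambda>z. b + z) ` upper_tri (d - b) (l - b) = {}"
    using cross_swap[of _ "l - b"] by (auto simp: lower_tri_def upper_tri_def)
  show "half_open_quad b d l = lower_tri b l \<union> (\<lambda>z. b + z) ` upper_tri (d - b) (l - b)"
  proof (intro equalityI subsetI)
    fix z assume z: "z \<in> half_open_quad b d l"
    show "z \<in> lower_tri b l \<union> (\<lambda>z. b + z) ` upper_tri (d - b) (l - b)"
    proof (cases "cross (l - b) (z - b) > 0")
      case True
      then show ?thesis using z by (auto simp: half_open_quad_def lower_tri_def)
    next
      case False
      then have "z - b \<in> upper_tri (d - b) (l - b)"
        using z cross_swap[of "z - b" "l - b"] by (auto simp: half_open_quad_def upper_tri_def)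
      then show ?thesis by (intro UnI2 image_eqI[of _ _ "z - b"]) auto
    qed
  next
    fix z assume "z \<in> lower_tri b l \<union> (\<lambda>z. b + z) ` upper_tri (d - b) (l - b)"
    then show "z \<in> half_open_quad b d l"
    proof
      assume z: "z \<in> lower_tri b l"
      obtain v w where *: "z = v *\<^sub>R b + w *\<^sub>R l" and vw: "v \<ge> 0" "w \<ge> 0" "1 - v - w > 0"
        using tri_mem_coords(2)[OF pos(3)] z by blast
      have "cross (d - b) (z - b) = (1 - v - w) * cross b d + w * cross (d - b) (l - d)"
        unfolding * by (simp add: cross_def algebra_simps)
      moreover have "cross (l - d) (z - d) = (1 - v - w) * cross d l + v * cross (d - b) (l - d)"
        unfolding * by (simp add: cross_def algebra_simps)
      ultimately show ?thesis
        using z vw pos by (auto simp: half_open_quad_def lower_tri_def intro!: add_pos_nonneg mult_nonneg_nonneg)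
    next
      assume "z \<in> (\<lambda>z. b + z) ` upper_tri (d - b) (l - b)"
      then obtain y where y: "y \<in> upper_tri (d - b) (l - b)" "z = b + y" by auto
      obtain v w where *: "y = v *\<^sub>R (d - b) + w *\<^sub>R (l - b)" and vw: "v \<ge> 0" "w > 0" "1 - v - w > 0"
        using tri_mem_coords(3)[OF pos(5)] y(1) by blast
      have 1: "cross b z = v * cross b d + w * cross b l"
        unfolding * y(2) by (simp add: cross_def algebra_simps)
      have 2: "cross b z > 0"
        unfolding 1 using vw pos by (intro add_nonneg_pos mult_nonneg_nonneg mult_pos_pos) auto
      have "cross z l = (1 - v - w) * cross b l + v * cross d l"
        unfolding * y(2) by (simp add: cross_def algebra_simps)
      then have 3: "cross z l \<ge> 0" using vw pos by (auto intro!: add_nonneg_nonneg)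
      have "z \<noteq> 0" using 2 by (auto simp: cross_simps)
      then show ?thesis
        using y 2 3 by (auto simp: half_open_quad_def upper_tri_def algebra_simps)
    qed
  qed
qed

lemma region_eq:
  assumes "convex_quad (br q) (dg q) (bl q)"
  shows "region q = closed_quad (br q) (dg q) (bl q)"
  using assms unfolding region_def
  by (subst closed_quad_split) (auto simp: convex_hull_tri convex_quad_def)

lemma cross_as_inner: "cross a z = inner (vec2 (- a$2) (a$1)) z"
  by (simp add: inner_vec_def sum_2 cross_def)

lemma interior_cross_ge:
  assumes "a \<noteq> 0"
  shows "interior {z. cross a z \<ge> c} = {z. cross a z > c}"
proof -
  have "vec2 (- a$2) (a$1) \<noteq> 0"
    using assms by (auto simp: vec_eq_iff forall_2)
  then show ?thesis
    unfolding cross_as_inner by (rule interior_halfspace_ge)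
qed

lemma interior_closed_quad:
  assumes "convex_quad b d l"
  shows "interior (closed_quad b d l) = open_quad b d l"
proof -
  have ne: "b \<noteq> 0" "- l \<noteq> 0" "d - b \<noteq> 0" "l - d \<noteq> 0"
    using assms by (auto simp: convex_quad_def cross_simps)
  have *: "cross z l = cross (- l) z" "cross (d - b) (z - b) = cross (d - b) z - cross (d - b) b"
    "cross (l - d) (z - d) = cross (l - d) z - cross (l - d) d" for z
    by (simp_all add: cross_def algebra_simps)
  have "closed_quad b d l = {z. cross b z \<ge> 0} \<inter> {z. cross (- l) z \<ge> 0} \<inter>
      {z. cross (d - b) z \<ge> cross (d - b) b} \<inter> {z. cross (l - d) z \<ge> cross (l - d) d}"
    unfolding closed_quad_def * by auto
  then have "interior (closed_quad b d l) = {z. cross b z > 0} \<inter> {z. cross (- l) z > 0} \<inter>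
      {z. cross (d - b) z > cross (d - b) b} \<inter> {z. cross (l - d) z > cross (l - d) d}"
    by (simp only: interior_Int interior_cross_ge[OF ne(1)] interior_cross_ge[OF ne(2)]
        interior_cross_ge[OF ne(3)] interior_cross_ge[OF ne(4)])
  also have "\<dots> = open_quad b d l"
    unfolding open_quad_def * by auto
  finally show ?thesis .
qed

section \<open>The octagon by linear inequalities, its sides, and the points identified by the
  gluing\<close>

lemma less_8_cases: "(i::nat) < 8 \<longleftrightarrow> i = 0 \<or> i = 1 \<or> i = 2 \<or> i = 3 \<or> i = 4 \<or> i = 5 \<or> i = 6 \<or> i = 7"
  by auto

lemma octv_eqs:
  "octv 0 = vec2 0 0" "octv (Suc 0) = vec2 1 0" "octv 1 = vec2 1 0"
  "octv 2 = vec2 (1 + sqrt 2 / 2) (sqrt 2 / 2)" "octv 3 = vec2 (1 + sqrt 2 / 2) (1 + sqrt 2 / 2)"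
  "octv 4 = vec2 1 (1 + sqrt 2)" "octv 5 = vec2 0 (1 + sqrt 2)"
  "octv 6 = vec2 (- (sqrt 2 / 2)) (1 + sqrt 2 / 2)" "octv 7 = vec2 (- (sqrt 2 / 2)) (sqrt 2 / 2)"
  "octv (Suc (Suc 0)) = vec2 (1 + sqrt 2 / 2) (sqrt 2 / 2)"
  "octv (Suc (Suc (Suc 0))) = vec2 (1 + sqrt 2 / 2) (1 + sqrt 2 / 2)"
  "octv 8 = octv 0" "octv 9 = octv 1" "octv 10 = octv 2" "octv 11 = octv 3" "octv 12 = octv 4"
  by (simp_all add: octv_def)

lemma octv_opposite:
  assumes "i < 8"
  shows "octv (i + 4) = octv (i + 1) + (octv (i + 5) - octv i)"
  using assms unfolding less_8_cases by (auto simp: octv_eqs vec_eq_iff forall_2)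

definition octverts :: "(real^2) set" where
  "octverts = octv ` {..<8}"

definition glue_vectors :: "(real^2) set" where
  "glue_vectors = (\<lambda>i. octv (i + 5) - octv i) ` {..<8}"

lemma octverts_eq: "octverts = {octv 0, octv 1, octv 2, octv 3, octv 4, octv 5, octv 6, octv 7}"
proof -
  have "{..<8::nat} = {0,1,2,3,4,5,6,7}" by auto
  then show ?thesis by (simp add: octverts_def)
qed

lemma mem_octverts:
  "p \<in> octverts \<longleftrightarrow> p$1 = 0 \<and> p$2 = 0 \<or> p$1 = 1 \<and> p$2 = 0 \<or>
     p$1 = 1 + sqrt 2 / 2 \<and> p$2 = sqrt 2 / 2 \<or> p$1 = 1 + sqrt 2 / 2 \<and> p$2 = 1 + sqrt 2 / 2 \<or>
     p$1 = 1 \<and> p$2 = 1 + sqrt 2 \<or> p$1 = 0 \<and> p$2 = 1 + sqrt 2 \<or>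
     p$1 = - (sqrt 2 / 2) \<and> p$2 = 1 + sqrt 2 / 2 \<or> p$1 = - (sqrt 2 / 2) \<and> p$2 = sqrt 2 / 2"
  by (simp add: octverts_eq octv_eqs vec_eq_iff forall_2)

lemma vec2_arith:
  "vec2 a b + vec2 c d = vec2 (a + c) (b + d)" "vec2 a b - vec2 c d = vec2 (a - c) (b - d)"
  "- vec2 a b = vec2 (- a) (- b)" "t *\<^sub>R vec2 a b = vec2 (t * a) (t * b)" "vec2 0 0 = 0"
  by (simp_all add: vec_eq_iff forall_2)

lemma glue_vectors_eq:
  "glue_vectors = {vec2 0 (1 + sqrt 2), vec2 (- (sqrt 2 / 2) - 1) (1 + sqrt 2 / 2),
     vec2 (- (1 + sqrt 2)) 0, vec2 (- (1 + sqrt 2 / 2)) (- (1 + sqrt 2 / 2)),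
     vec2 0 (- (1 + sqrt 2)), vec2 (1 + sqrt 2 / 2) (- (1 + sqrt 2 / 2)),
     vec2 (1 + sqrt 2) 0, vec2 (1 + sqrt 2 / 2) (1 + sqrt 2 / 2)}"
proof -
  have "{..<8::nat} = {0,1,2,3,4,5,6,7}" by auto
  then show ?thesis
    unfolding glue_vectors_def
    by (simp only: image_insert image_empty) (simp add: octv_eqs vec2_arith algebra_simps)
qed

lemma convex_side: "convex {p::real^2. a * p$1 + b * p$2 \<le> c}"
proof -
  have "{p::real^2. a * p$1 + b * p$2 \<le> c} = {p. inner (vec2 a b) p \<le> c}"
    by (simp add: inner_vec_def sum_2)
  then show ?thesis by (simp add: convex_halfspace_le)
qed

definition octagon_ineqs :: "real^2 \<Rightarrow> bool" where
  "octagon_ineqs p \<longleftrightarrow> 0 \<le> p$2 \<and> p$1 - p$2 \<le> 1 \<and> p$1 \<le> 1 + sqrt 2 / 2 \<and> p$1 + p$2 \<le> 2 + sqrt 2 \<and>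
    p$2 \<le> 1 + sqrt 2 \<and> p$2 - p$1 \<le> 1 + sqrt 2 \<and> - (sqrt 2 / 2) \<le> p$1 \<and> 0 \<le> p$1 + p$2"

lemma convex_octagon_ineqs: "convex {p. octagon_ineqs p}"
proof -
  have "{p. octagon_ineqs p} =
    {p. 0 * p$1 + (-1) * p$2 \<le> 0} \<inter> {p. 1 * p$1 + (-1) * p$2 \<le> 1} \<inter> {p. 1 * p$1 + 0 * p$2 \<le> 1 + sqrt 2 / 2} \<inter>
    {p. 1 * p$1 + 1 * p$2 \<le> 2 + sqrt 2} \<inter> {p. 0 * p$1 + 1 * p$2 \<le> 1 + sqrt 2} \<inter>
    {p. (-1) * p$1 + 1 * p$2 \<le> 1 + sqrt 2} \<inter> {p. (-1) * p$1 + 0 * p$2 \<le> sqrt 2 / 2} \<inter> {p. (-1) * p$1 + (-1) * p$2 \<le> 0}"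
    by (auto simp: octagon_ineqs_def)
  then show ?thesis
    by (simp only:) (intro convex_Int convex_side)
qed

lemma sqrt2_bounds: "1.4 < sqrt 2" "sqrt 2 < 1.5"
  by (rule real_less_rsqrt real_less_lsqrt; simp add: power2_eq_square)+

lemma sqrt2_mult [simp]: "sqrt 2 * (sqrt 2 * x) = 2 * x"
  by (simp add: mult.assoc[symmetric])

lemma closed_quad_subset_octagon:
  assumes "convex_quad b d l" "a \<in> octagon" "a + b \<in> octagon" "a + d \<in> octagon" "a + l \<in> octagon"
  shows "(\<lambda>z. a + z) ` closed_quad b d l \<subseteq> octagon"
proof -
  have conv: "convex octagon" by (simp add: octagon_def)
  have "closed_quad b d l = convex hull {0, b, d} \<union> convex hull {0, d, l}"
    using assms(1) by (simp add: closed_quad_split convex_hull_tri convex_quad_def)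
  moreover have "(\<lambda>z. a + z) ` (convex hull {0, b, d}) \<subseteq> octagon" "(\<lambda>z. a + z) ` (convex hull {0, d, l}) \<subseteq> octagon"
    using assms by (simp_all add: convex_hull_translation[symmetric] hull_minimal conv)
  ultimately show ?thesis by (auto simp: image_Un)
qed

lemma octv_in_octagon: "octv i \<in> octagon"
proof -
  have "octv i = octv (i mod 8)" by (simp add: octv_def)
  then show ?thesis unfolding octagon_def by (metis hull_inc imageI lessThan_iff mod_less_divisor zero_less_numeral)
qed

lemma vec2_cross: "cross (vec2 a b) z = a * z$2 - b * z$1"
  "cross z (vec2 a b) = z$1 * b - z$2 * a" 
  by (simp_all add: cross_def)

text \<open>For the harder inclusion the two horizontal diagonals cut the octagon into a trapezoid,
  a rectangle and a trapezoid; each is a convex quadrilateral whose corners are vertices of the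
  octagon.\<close>

lemma octagon_eq: "octagon = {p. octagon_ineqs p}"
proof (intro equalityI)
  show "octagon \<subseteq> {p. octagon_ineqs p}"
    unfolding octagon_def octverts_def[symmetric] octverts_eq
    using sqrt2_bounds
    by (intro hull_minimal convex_octagon_ineqs) (auto simp: octagon_ineqs_def octv_eqs)
next
  note defs = octagon_ineqs_def convex_quad_def vec2_cross closed_quad_def octv_eqs cross_def
  have v: "octv i \<in> octagon" for i by (rule octv_in_octagon)
  show "{p. octagon_ineqs p} \<subseteq> octagon"
  proof
    fix p assume "p \<in> {p. octagon_ineqs p}"
    then have p: "octagon_ineqs p" by simp
    consider "p$2 \<le> sqrt 2 / 2" | "sqrt 2 / 2 \<le> p$2" "p$2 \<le> 1 + sqrt 2 / 2" | "1 + sqrt 2 / 2 \<le> p$2"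
      by linarith
    then show "p \<in> octagon"
    proof cases
      case 1
      have q: "convex_quad (octv 2 - octv 1) (octv 7 - octv 1) (octv 0 - octv 1)"
        using sqrt2_bounds by (simp add: defs algebra_simps)
      \<comment> \<open>The side conditions of the trapezoid are inequalities of the octagon and of
        the strip, scaled by side lengths. Multiplied out, they are linear in the coordinates and
        their products with \<open>sqrt 2\<close>.\<close>
      have "sqrt 2 * (p$2 - p$1 + 1) \<ge> 0" "sqrt 2 * (p$1 + p$2) \<ge> 0" "(1 + sqrt 2) * (sqrt 2 / 2 - p$2) \<ge> 0" "p$2 \<ge> 0"
        using p 1 by (auto simp: octagon_ineqs_def)
      then have "p - octv 1 \<in> closed_quad (octv 2 - octv 1) (octv 7 - octv 1) (octv 0 - octv 1)"
        using p by (simp add: defs algebra_simps add_divide_distrib diff_divide_distrib; (intro conjI; linarith)?)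
      moreover have "(\<lambda>z. octv 1 + z) ` closed_quad (octv 2 - octv 1) (octv 7 - octv 1) (octv 0 - octv 1) \<subseteq> octagon"
        by (rule closed_quad_subset_octagon[OF q]) (auto simp: v)
      moreover have "octv 1 + (p - octv 1) = p" by simp
      ultimately show ?thesis by (metis image_eqI subsetD)
    next
      case 2
      have q: "convex_quad (octv 3 - octv 2) (octv 6 - octv 2) (octv 7 - octv 2)"
        using sqrt2_bounds by (simp add: defs algebra_simps)
      have "(1 + sqrt 2) * (p$2 - sqrt 2 / 2) \<ge> 0" "(1 + sqrt 2) * (1 + sqrt 2 / 2 - p$2) \<ge> 0"
        using p 2 by (auto simp: octagon_ineqs_def)
      then have "p - octv 2 \<in> closed_quad (octv 3 - octv 2) (octv 6 - octv 2) (octv 7 - octv 2)"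
        using p by (simp add: defs algebra_simps add_divide_distrib diff_divide_distrib; (intro conjI; linarith)?)
      moreover have "(\<lambda>z. octv 2 + z) ` closed_quad (octv 3 - octv 2) (octv 6 - octv 2) (octv 7 - octv 2) \<subseteq> octagon"
        by (rule closed_quad_subset_octagon[OF q]) (auto simp: v)
      moreover have "octv 2 + (p - octv 2) = p" by simp
      ultimately show ?thesis by (metis image_eqI subsetD)
    next
      case 3
      have q: "convex_quad (octv 4 - octv 3) (octv 5 - octv 3) (octv 6 - octv 3)"
        using sqrt2_bounds by (simp add: defs algebra_simps)
      have "sqrt 2 * (2 + sqrt 2 - p$1 - p$2) \<ge> 0" "sqrt 2 * (1 + sqrt 2 + p$1 - p$2) \<ge> 0" "(1 + sqrt 2) * (p$2 - 1 - sqrt 2 / 2) \<ge> 0"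
        using p 3 by (auto simp: octagon_ineqs_def)
      then have "p - octv 3 \<in> closed_quad (octv 4 - octv 3) (octv 5 - octv 3) (octv 6 - octv 3)"
        using p by (simp add: defs algebra_simps add_divide_distrib diff_divide_distrib; (intro conjI; linarith)?)
      moreover have "(\<lambda>z. octv 3 + z) ` closed_quad (octv 4 - octv 3) (octv 5 - octv 3) (octv 6 - octv 3) \<subseteq> octagon"
        by (rule closed_quad_subset_octagon[OF q]) (auto simp: v)
      moreover have "octv 3 + (p - octv 3) = p" by simp
      ultimately show ?thesis by (metis image_eqI subsetD)
    qed
  qed
qed

lemma convex_octagon: "convex octagon" by (simp add: octagon_def)
lemma compact_octagon: "compact octagon"
  unfolding octagon_def by (intro finite_imp_compact_convex_hull) auto

text \<open>Only the line through side \<open>i\<close>, in the order of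
  \<open>octagon_ineqs\<close>; for points of the octagon it amounts to the side itself, by
  \<open>on_side_segment\<close>.\<close>

definition on_side :: "nat \<Rightarrow> real^2 \<Rightarrow> bool" where
  "on_side i p \<longleftrightarrow> [p$2 = 0, p$1 - p$2 = 1, p$1 = 1 + sqrt 2 / 2, p$1 + p$2 = 2 + sqrt 2,
      p$2 = 1 + sqrt 2, p$2 - p$1 = 1 + sqrt 2, p$1 = - (sqrt 2 / 2), p$1 + p$2 = 0] ! i"

lemma adjacent_sides:
  assumes "i < 8" "on_side i p" "on_side ((i + 1) mod 8) p"
  shows "p = octv ((i + 1) mod 8)"
  using assms(1) unfolding less_8_cases
  using assms(2,3)
  by (elim disjE; hypsubst; simp add: on_side_def octv_eqs vec_eq_iff forall_2)

lemma nonadjacent_sides: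
  assumes "p \<in> octagon" "i < 8" "j < 8" "i < j" "j \<noteq> i + 1" "i \<noteq> 0 \<or> j \<noteq> 7" "on_side i p" "on_side j p"
  shows False
proof -
  note p = assms(1)[unfolded octagon_eq mem_Collect_eq octagon_ineqs_def]
  have "(i, j) \<in> {(0, 2), (0, 3), (0, 4), (0, 5), (0, 6), (1, 3), (1, 4), (1, 5), (1, 6), (1, 7), (2, 4), (2, 5), (2, 6), (2, 7), (3, 5), (3, 6), (3, 7), (4, 6), (4, 7), (5, 7)}"
    using assms(2-6) unfolding less_8_cases by (elim disjE; simp)
  then show False
    using assms(7,8) p sqrt2_bounds(1)
    by (elim insertE emptyE; clarsimp simp: on_side_def)
qed

lemma two_sides:
  assumes "p \<in> octagon" "i < 8" "j < 8" "i \<noteq> j" "on_side i p" "on_side j p"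
  shows "p \<in> octverts"
proof -
  have *: "p \<in> octverts" if "i < 8" "j < 8" "i < j" "on_side i p" "on_side j p" for i j
  proof -
    have "j = i + 1 \<or> i = 0 \<and> j = 7"
      using nonadjacent_sides[OF assms(1) that(1,2,3) _ _ that(4,5)] by blast
    then have "p = octv j \<or> p = octv 0"
      using adjacent_sides[of i p] adjacent_sides[of 7 p] that by auto
    then show ?thesis using that by (auto simp: octverts_def)
  qed
  show ?thesis
    using *[of i j] *[of j i] assms by (cases "i < j") auto
qed

text \<open>The octagon lies in the strip between two opposite sides, and a glue vector crosses the
  full width of such a strip. Hence both ends must lie on its boundary lines.\<close>

lemma glue_vector_sides:
  assumes "p \<in> octagon" "q \<in> octagon" "q - p \<in> glue_vectors"
  obtains i where "i < 8" "on_side i p" "on_side ((i + 4) mod 8) q" "q - p = octv (i + 5) - octv i"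
proof -
  from assms(3) obtain i where i: "i < 8" "q - p = octv (i + 5) - octv i"
    unfolding glue_vectors_def by auto
  have q: "q = p + (octv (i + 5) - octv i)"
    using i(2) by (simp add: algebra_simps)
  have "on_side i p" "on_side ((i + 4) mod 8) q"
    using i(1) assms(1,2) unfolding less_8_cases octagon_eq q
    by (auto simp: on_side_def octagon_ineqs_def octv_eqs)
  with i that show thesis by blast
qed

lemma on_side_segment:
  assumes "p \<in> octagon" "i < 8" "on_side i p"
  shows "p \<in> closed_segment (octv i) (octv (i + 1))"
proof -
  have *: "p \<in> closed_segment (octv i) (octv (i + 1))"
    if "0 \<le> u" "u \<le> 1" "p = (1 - u) *\<^sub>R octv i + u *\<^sub>R octv (i + 1)" for u
    using that unfolding in_segment by blast
  define u where "u = [p$1, sqrt 2 * p$2, p$2 - sqrt 2 / 2, sqrt 2 * (p$2 - 1 - sqrt 2 / 2),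
    1 - p$1, sqrt 2 * (1 + sqrt 2 - p$2), 1 + sqrt 2 / 2 - p$2, 1 - sqrt 2 * p$2] ! i"
  have r: "0 \<le> x \<Longrightarrow> 0 \<le> sqrt 2 * x" "x \<le> sqrt 2 / 2 \<Longrightarrow> sqrt 2 * x \<le> 1" for x :: real
    using mult_left_mono[of x "sqrt 2 / 2" "sqrt 2"] by auto
  have "0 \<le> u \<and> u \<le> 1"
    using assms(2) unfolding less_8_cases
    using assms(1,3) r[of "p$2"] r[of "p$2 - 1 - sqrt 2 / 2"] r[of "1 + sqrt 2 - p$2"]
    by (elim disjE; hypsubst; simp add: u_def octagon_eq octagon_ineqs_def on_side_def)
  moreover have "p = (1 - u) *\<^sub>R octv i + u *\<^sub>R octv (i + 1)"
    using assms(2) unfolding less_8_cases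
    using assms(3)
    by (elim disjE; hypsubst; simp add: u_def on_side_def octv_eqs vec_eq_iff forall_2 algebra_simps)
  ultimately show ?thesis using * by blast
qed

text \<open>Eliminates the sides from the gluing relation: what remains is a condition on a
  difference of points, which is invariant under common translations.\<close>

lemma glue_iff: "glue p q \<longleftrightarrow> p \<in> octagon \<and> q \<in> octagon \<and> q - p \<in> glue_vectors"
proof
  assume "glue p q"
  then obtain i where i: "i < 8" "p \<in> closed_segment (octv i) (octv (i + 1))" "q = p + (octv (i + 5) - octv i)"
    by (auto simp: glue_def)
  have seg: "closed_segment (octv i) (octv j) \<subseteq> octagon" for i j
    by (intro closed_segment_subset convex_octagon octv_in_octagon)
  obtain u where u: "0 \<le> u" "u \<le> 1" "p = (1 - u) *\<^sub>R octv i + u *\<^sub>R octv (i + 1)"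
    using i(2) unfolding in_segment by auto
  have "q = (1 - u) *\<^sub>R octv (i + 5) + u *\<^sub>R octv (i + 4)"
    unfolding i(3) u(3) octv_opposite[OF i(1)] by (simp add: algebra_simps)
  then have "q \<in> closed_segment (octv (i + 5)) (octv (i + 4))"
    unfolding in_segment using u by blast
  then show "p \<in> octagon \<and> q \<in> octagon \<and> q - p \<in> glue_vectors"
    using i seg by (auto simp: glue_vectors_def)
next
  assume "p \<in> octagon \<and> q \<in> octagon \<and> q - p \<in> glue_vectors"
  then obtain i where "i < 8" "on_side i p" "q - p = octv (i + 5) - octv i" "p \<in> octagon"
    using glue_vector_sides by blast
  then have "i < 8 \<and> p \<in> closed_segment (octv i) (octv (i + 1)) \<and> q = p + (octv (i + 5) - octv i)"
    using on_side_segment[of p i] by (auto simp: algebra_simps)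
  then show "glue p q"
    unfolding glue_def by blast
qed

lemma glue_vectors_uminus: "- t \<in> glue_vectors \<longleftrightarrow> t \<in> glue_vectors"
proof -
  have *: "- t \<in> glue_vectors" if t: "t \<in> glue_vectors" for t
  proof -
    obtain i where i: "i < 8" "t = octv (i + 5) - octv i"
      using t by (auto simp: glue_vectors_def)
    have "- t = octv ((i + 4) mod 8 + 5) - octv ((i + 4) mod 8)"
      using i unfolding less_8_cases by (auto simp: octv_eqs vec_eq_iff forall_2)
    then show ?thesis unfolding glue_vectors_def by (rule image_eqI) simp
  qed
  show ?thesis using *[of t] *[of "- t"] by auto
qed

lemma glue_sym: "glue p q \<longleftrightarrow> glue q p"
  using glue_vectors_uminus[of "p - q"] by (auto simp: glue_iff)

lemma octverts_subset: "octverts \<subseteq> octagon"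
  using octv_in_octagon by (auto simp: octverts_def)

lemma on_side_octv:
  assumes "i < 8" "j < 8" "on_side i (octv j)"
  shows "j = i \<or> j = (i + 1) mod 8"
  using assms(1,2) unfolding less_8_cases
  using assms(3) sqrt2_bounds(1)
  by (elim disjE; hypsubst; simp add: on_side_def octv_eqs)

lemma glue_vertex:
  assumes "p \<in> octverts" "glue p q"
  shows "q \<in> octverts"
proof -
  have mem: "p \<in> octagon" "q \<in> octagon" "q - p \<in> glue_vectors"
    using assms(2) by (auto simp: glue_iff)
  obtain i where i: "i < 8" "on_side i p" "q - p = octv (i + 5) - octv i"
    by (rule glue_vector_sides[OF mem]) blast
  have m: "octv (k mod 8) = octv k" for k by (simp add: octv_def)
  have ov: "octv k \<in> octverts" for k
    using m[of k] by (metis imageI lessThan_iff mod_less_divisor octverts_def zero_less_numeral)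
  obtain j where j: "j < 8" "p = octv j"
    using assms(1) by (auto simp: octverts_def)
  have "octv (i + 4) = octv (i + 1) + (octv (i + 5) - octv i)"
    by (rule octv_opposite[OF i(1)])
  moreover have "j = i \<or> j = (i + 1) mod 8"
    using on_side_octv[of i j] i j by simp
  moreover have "q = p + (octv (i + 5) - octv i)"
    using i(3) by (simp add: algebra_simps)
  ultimately have "q = octv (i + 5) \<or> q = octv (i + 4)"
    using j m[of "i + 1"] by auto
  then show ?thesis using ov by auto
qed

text \<open>A point that is not a vertex lies on at most one side and so has at most one partner;
  gluing twice then leads back.\<close>

lemma glue_glue:
  assumes "glue p q" "glue q s"
  shows "s = p \<or> p \<in> octverts \<and> q \<in> octverts \<and> s \<in> octverts"
proof -
  have mem: "p \<in> octagon" "q \<in> octagon" "s \<in> octagon" "p - q \<in> glue_vectors" "s - q \<in> glue_vectors"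
    using assms glue_iff glue_sym by blast+
  obtain i where i: "i < 8" "on_side i q" "p - q = octv (i + 5) - octv i"
    using glue_vector_sides[OF mem(2,1,4)] .
  obtain j where j: "j < 8" "on_side j q" "s - q = octv (j + 5) - octv j"
    using glue_vector_sides[OF mem(2,3,5)] .
  show ?thesis
  proof (cases "i = j")
    case True
    then have "s - q = p - q" using i j by simp
    then show ?thesis by simp
  next
    case False
    then have "q \<in> octverts" using two_sides i j mem by blast
    then show ?thesis using glue_vertex assms glue_sym by blast
  qed
qed

lemma same_point_iff:
  "same_point p q \<longleftrightarrow> p \<in> octagon \<and> q \<in> octagon \<and>
     (q - p \<in> insert 0 glue_vectors \<or> p \<in> octverts \<and> q \<in> octverts)"
proof
  assume "same_point p q"
  then have p: "p \<in> octagon" and q: "q \<in> octagon" and "equivclp glue p q"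
    by (auto simp: same_point_def)
  from \<open>equivclp glue p q\<close> p have "q = p \<or> glue p q \<or> p \<in> octverts \<and> q \<in> octverts"
  proof (induction rule: equivclp_induct)
    case (step y z)
    then have yz: "glue y z" using glue_sym by blast
    then have "y \<in> octagon" by (simp add: glue_iff)
    then have "y = p \<or> glue p y \<or> p \<in> octverts \<and> y \<in> octverts" using step by blast
    then show ?case using yz glue_vertex glue_glue by blast
  qed auto
  then show "p \<in> octagon \<and> q \<in> octagon \<and> (q - p \<in> insert 0 glue_vectors \<or> p \<in> octverts \<and> q \<in> octverts)"
    using p q by (auto simp: glue_iff)
next
  assume *: "p \<in> octagon \<and> q \<in> octagon \<and> (q - p \<in> insert 0 glue_vectors \<or> p \<in> octverts \<and> q \<in> octverts)"
  have step: "glue (octv i) (octv (i + 5))" if "i < 8" for i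
    using that unfolding glue_def by (intro exI[of _ i]) auto
  have e: "equivclp glue (octv i) (octv j)" if "glue (octv i) (octv j)" for i j
    using that by (rule r_into_equivclp)
  \<comment> \<open>Side \<open>i\<close> takes vertex \<open>i\<close> to vertex
    \<open>i + 5\<close>, and 5 generates the integers modulo 8: all vertices become one
    point.\<close>
  have chain: "equivclp glue (octv 0) (octv 5)" "equivclp glue (octv 5) (octv 2)" "equivclp glue (octv 2) (octv 7)"
    "equivclp glue (octv 7) (octv 4)" "equivclp glue (octv 4) (octv 1)" "equivclp glue (octv 1) (octv 6)"
    "equivclp glue (octv 6) (octv 3)"
    using step[of 0] step[of 5] step[of 2] step[of 7] step[of 4] step[of 1] step[of 6]
    by (auto intro!: e simp: octv_eqs(12-16) del: r_into_equivclp) 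
  have 0: "equivclp glue (octv 0) v" if "v \<in> octverts" for v
    using that unfolding octverts_eq
    by (elim insertE emptyE; hypsubst; meson chain equivclp_trans equivclp_refl)
  from * consider "q = p" | "glue p q" | "p \<in> octverts" "q \<in> octverts"
    by (auto simp: glue_iff)
  then have "equivclp glue p q"
    by cases (auto intro: equivclp_trans[OF equivclp_sym[OF 0] 0])
  then show "same_point p q"
    using * by (simp add: same_point_def)
qed

lemma proj_eq_iff:
  assumes "p \<in> octagon" "q \<in> octagon"
  shows "proj p = proj q \<longleftrightarrow> q - p \<in> insert 0 glue_vectors \<or> p \<in> octverts \<and> q \<in> octverts"
proof -
  have "same_point p p" "same_point q q"
    using assms by (auto simp: same_point_iff)
  then have "proj p = proj q \<longleftrightarrow> same_point p q"
    unfolding proj_def using Quotient3_rel[OF Quotient3_octsurf] by metis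
  then show ?thesis using assms by (simp add: same_point_iff)
qed

lemma proj_surj: "\<exists>p\<in>octagon. proj p = x"
proof -
  have "same_point (rep_octsurf x) (rep_octsurf x)" "abs_octsurf (rep_octsurf x) = x"
    using Quotient3_rep_reflp[OF Quotient3_octsurf] Quotient3_abs_rep[OF Quotient3_octsurf] by metis+
  then show ?thesis by (auto simp: proj_def same_point_def)
qed

lemma zero_in_octverts: "octv 0 \<in> octverts" by (simp add: octverts_def)

lemma proj_eq_sing:
  assumes "p \<in> octagon"
  shows "proj p = sing \<longleftrightarrow> p \<in> octverts"
proof -
  have *: "octv 0 - p \<notin> insert 0 glue_vectors" if "p \<notin> octverts"
    using that glue_vertex[OF zero_in_octverts, of p] glue_sym[of p "octv 0"] assms octv_in_octagon[of 0] zero_in_octverts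
    by (metis eq_iff_diff_eq_0 glue_iff insertE)
  have "proj p = sing \<longleftrightarrow> octv 0 - p \<in> insert 0 glue_vectors \<or> p \<in> octverts \<and> octv 0 \<in> octverts"
    unfolding sing_def by (rule proj_eq_iff[OF assms octv_in_octagon])
  then show ?thesis using * zero_in_octverts by blast
qed

section \<open>Topology of the surface\<close>

lemma finite_octverts: "finite octverts" by (simp add: octverts_def)
lemma finite_glue_vectors: "finite glue_vectors" by (simp add: glue_vectors_def)

text \<open>All vertex differences are included because any two vertices represent the singularity.
  Finiteness of this set gives finite fibres and a lower bound for nonzero discrepancies between
  representatives.\<close>

definition point_shifts :: "(real^2) set" where
  "point_shifts = insert 0 glue_vectors \<union> (\<lambda>(v, w). w - v) ` (octverts \<times> octverts)"

lemma finite_point_shifts: "finite point_shifts"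
  by (simp add: point_shifts_def finite_octverts finite_glue_vectors)

lemma proj_eq_shift:
  assumes "p \<in> octagon" "q \<in> octagon" "proj p = proj q"
  shows "q - p \<in> point_shifts"
  using assms proj_eq_iff[OF assms(1,2)] by (force simp: point_shifts_def)

lemma finite_representatives: "finite {p \<in> octagon. proj p = x}"
proof -
  obtain q where q: "q \<in> octagon" "proj q = x" using proj_surj by blast
  have "{p \<in> octagon. proj p = x} \<subseteq> (\<lambda>d. q + d) ` point_shifts"
  proof
    fix p assume "p \<in> {p \<in> octagon. proj p = x}"
    then have "p - q \<in> point_shifts" using proj_eq_shift q by auto
    then show "p \<in> (\<lambda>d. q + d) ` point_shifts" by (intro image_eqI[of _ _ "p - q"]) auto
  qed
  then show ?thesis using finite_point_shifts finite_subset by blast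
qed

lemma finite_common_radius:
  fixes P :: "'a \<Rightarrow> real \<Rightarrow> bool"
  assumes "finite A" "\<And>a. a \<in> A \<Longrightarrow> \<exists>e>0. P a e" "\<And>a e e'. P a e \<Longrightarrow> 0 < e' \<Longrightarrow> e' \<le> e \<Longrightarrow> P a e'"
  shows "\<exists>e>0. \<forall>a\<in>A. P a e"
  using assms(1,2)
proof (induction rule: finite_induct)
  case empty
  show ?case by (intro exI[of _ 1]) simp
next
  case (insert a A)
  then obtain e e' where "e > 0" "\<forall>a\<in>A. P a e" "e' > 0" "P a e'" by blast
  then show ?case
    by (intro exI[of _ "min e e'"]) (auto intro: assms(3))
qed

lemma open_surf_iff: "open U \<longleftrightarrow> openin (top_of_set octagon) {p \<in> octagon. proj p \<in> U}"
  by (simp add: open_octsurf_def)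

text \<open>The fibre over \<open>x\<close> is finite, so one radius serves all its points,
  including all eight vertices over the singularity.\<close>

lemma surf_nhd:
  assumes "open N" "x \<in> N"
  obtains e where "e > 0"
    "\<And>p v. p \<in> octagon \<Longrightarrow> proj p = x \<Longrightarrow> norm v < e \<Longrightarrow> p + v \<in> octagon \<Longrightarrow> proj (p + v) \<in> N"
proof -
  have "\<exists>e>0. \<forall>p\<in>{p \<in> octagon. proj p = x}. \<forall>v. norm v < e \<and> p + v \<in> octagon \<longrightarrow> proj (p + v) \<in> N"
  proof (rule finite_common_radius[OF finite_representatives])
    fix p assume "p \<in> {p \<in> octagon. proj p = x}"
    then have "p \<in> {p \<in> octagon. proj p \<in> N}" using assms by auto
    then obtain e where e: "e > 0" "ball p e \<inter> octagon \<subseteq> {p \<in> octagon. proj p \<in> N}"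
      using assms(1) unfolding open_surf_iff openin_contains_ball by blast
    have "proj (p + v) \<in> N" if "norm v < e" "p + v \<in> octagon" for v
      using e(2) that by (auto simp: dist_norm subset_iff)
    then show "\<exists>e>0. \<forall>v. norm v < e \<and> p + v \<in> octagon \<longrightarrow> proj (p + v) \<in> N" using e(1) by blast
  qed auto
  then show thesis using that by blast
qed

lemma continuous_on_proj: "continuous_on octagon proj"
  unfolding continuous_openin_preimage_eq open_surf_iff by (simp add: vimage_def Int_def)

lemma translation_on_continuous:
  assumes "translation_on S \<phi>"
  shows "continuous_on S \<phi>"
  unfolding continuous_on_topological
proof (intro ballI allI impI)
  fix z B assume z: "z \<in> S" and B: "open B" "\<phi> z \<in> B"
  obtain e1 where e1: "e1 > 0" "\<And>w. w \<in> S \<inter> ball z e1 \<Longrightarrow>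
      \<exists>p\<in>octagon. p + (w - z) \<in> octagon \<and> proj p = \<phi> z \<and> proj (p + (w - z)) = \<phi> w"
    using assms z unfolding translation_on_def by meson
  obtain e2 where e2: "e2 > 0"
    "\<And>p v. p \<in> octagon \<Longrightarrow> proj p = \<phi> z \<Longrightarrow> norm v < e2 \<Longrightarrow> p + v \<in> octagon \<Longrightarrow> proj (p + v) \<in> B"
    using surf_nhd[OF B] by metis
  have "\<phi> w \<in> B" if w: "w \<in> S" "w \<in> ball z (min e1 e2)" for w
  proof -
    obtain p where p: "p \<in> octagon" "p + (w - z) \<in> octagon" "proj p = \<phi> z" "proj (p + (w - z)) = \<phi> w"
      using e1(2)[of w] w by auto
    have "norm (w - z) < e2" using w(2) by (simp add: dist_norm norm_minus_commute)
    then show ?thesis using e2(2)[OF p(1,3) _ p(2)] p(4) by simp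
  qed
  then show "\<exists>A. open A \<and> z \<in> A \<and> (\<forall>y\<in>S. y \<in> A \<longrightarrow> \<phi> y \<in> B)"
    using e1(1) e2(1) by (intro exI[of _ "ball z (min e1 e2)"]) auto
qed

lemma compact_same_point: "compact {(p, q). p \<in> octagon \<and> q \<in> octagon \<and> proj p = proj q}"
proof -
  have "{(p, q). p \<in> octagon \<and> q \<in> octagon \<and> proj p = proj q} =
    (octagon \<times> octagon) \<inter> (((\<lambda>x. snd x - fst x) -` insert 0 glue_vectors) \<union> octverts \<times> octverts)"
    using octverts_subset by (auto simp: proj_eq_iff)
  moreover have "closed ((\<lambda>x. snd x - fst x) -` insert 0 glue_vectors :: ((real^2) \<times> (real^2)) set)"
    by (intro closed_vimage finite_imp_closed continuous_intros) (simp add: finite_glue_vectors)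
  moreover have "closed (octverts \<times> octverts)"
    by (intro closed_Times finite_imp_closed finite_octverts)
  ultimately show ?thesis
    using compact_Int_closed[OF compact_Times[OF compact_octagon compact_octagon]]
    by (simp add: closed_Un)
qed

text \<open>The saturation of a closed set is the second projection of a compact set.\<close>

lemma closed_saturation:
  assumes "closed C"
  shows "closed {q \<in> octagon. \<exists>p\<in>octagon. p \<in> C \<and> proj p = proj q}"
proof -
  have "{q \<in> octagon. \<exists>p\<in>octagon. p \<in> C \<and> proj p = proj q} =
     snd ` ({(p, q). p \<in> octagon \<and> q \<in> octagon \<and> proj p = proj q} \<inter> (C \<times> UNIV))"
    by force
  moreover have "compact \<dots>"
    by (intro compact_continuous_image compact_Int_closed compact_same_point closed_Times assms closed_UNIV
        continuous_intros)
  ultimately show ?thesis by (simp add: compact_imp_closed)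
qed

text \<open>The preimage of this set is the complement of the saturation of the closed set
  \<open>- U\<close>. Disjoint neighbourhoods of two fibres thus descend to the surface, which makes
  it Hausdorff.\<close>

lemma open_surf_nhds:
  assumes "open U"
  shows "open {s. \<forall>p\<in>octagon. proj p = s \<longrightarrow> p \<in> U}"
proof -
  have "{q \<in> octagon. proj q \<in> {s. \<forall>p\<in>octagon. proj p = s \<longrightarrow> p \<in> U}} =
     octagon - {q \<in> octagon. \<exists>p\<in>octagon. p \<in> - U \<and> proj p = proj q}"
    by auto
  moreover have "openin (top_of_set octagon) \<dots>"
    using closed_saturation[of "- U"] assms
    by (metis (no_types, lifting) Diff_Diff_Int closed_Compl closedin_closed_Int Diff_Int2 Int_absorb Int_commute openin_diff openin_subtopology_self double_complement Diff_eq closed_def openin_open)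
  ultimately show ?thesis by (simp only: open_surf_iff)
qed

instance octsurf :: t2_space
proof
  fix x y :: octsurf
  assume "x \<noteq> y"
  then have disj: "{p \<in> octagon. proj p = x} \<inter> {p \<in> octagon. proj p = y} = {}" by auto
  obtain U V where UV: "open U" "open V" "{p \<in> octagon. proj p = x} \<subseteq> U" "{p \<in> octagon. proj p = y} \<subseteq> V"
    "U \<inter> V = {}"
    by (rule separation_normal[OF finite_imp_closed[OF finite_representatives]
        finite_imp_closed[OF finite_representatives] disj])
  let ?N = "\<lambda>U. {s. \<forall>p\<in>octagon. proj p = s \<longrightarrow> p \<in> U}"
  have "open (?N U)" "open (?N V)" using UV by (auto intro: open_surf_nhds)
  moreover have "x \<in> ?N U" "y \<in> ?N V" using UV by auto
  moreover have "?N U \<inter> ?N V = {}"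
  proof (rule ccontr)
    assume "?N U \<inter> ?N V \<noteq> {}"
    then obtain s where "s \<in> ?N U" "s \<in> ?N V" by blast
    moreover obtain p where "p \<in> octagon" "proj p = s" using proj_surj by blast
    ultimately show False using UV(5) by blast
  qed
  ultimately show "\<exists>U V. open U \<and> open V \<and> x \<in> U \<and> y \<in> V \<and> U \<inter> V = {}"
    by blast
qed

lemma agree_on_closure:
  fixes f g :: "'a::topological_space \<Rightarrow> 'b::t2_space"
  assumes "continuous_on S f" "continuous_on S g" "T \<subseteq> S" "S \<subseteq> closure T" "\<And>x. x \<in> T \<Longrightarrow> f x = g x" "x \<in> S"
  shows "f x = g x"
proof -
  have "closedin (top_of_set S) (S \<inter> (\<lambda>x. (f x, g x)) -` {y. \<exists>x. y = (x, x)})"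
    by (intro continuous_closedin_preimage continuous_on_Pair assms closed_diagonal)
  then obtain K where K: "closed K" "S \<inter> (\<lambda>x. (f x, g x)) -` {y. \<exists>x. y = (x, x)} = S \<inter> K"
    unfolding closedin_closed by blast
  then have "T \<subseteq> K" using assms(3,5) by auto
  then have "closure T \<subseteq> K" using K(1) by (rule closure_minimal)
  then have "x \<in> S \<inter> K" using assms(4,6) by auto
  then show ?thesis using K(2)[symmetric] by auto
qed

section \<open>Rigidity of translations\<close>

text \<open>Away from the singularity two representatives differ by a glue vector or not at all, and
  a common shift preserves the difference. For two vertices there is no such vector in general,
  which is why rigidity stops at the singularity.\<close>

lemma proj_shift_eq:
  assumes "p \<in> octagon" "q \<in> octagon" "proj p = proj q" "proj p \<noteq> sing" "p + v \<in> octagon" "q + v \<in> octagon"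
  shows "proj (p + v) = proj (q + v)"
proof -
  have "q - p \<in> insert 0 glue_vectors"
    using assms(3,4) proj_eq_iff[OF assms(1,2)] proj_eq_sing[OF assms(1)] by blast
  moreover have "(q + v) - (p + v) = q - p" by simp
  ultimately show ?thesis
    using proj_eq_iff[OF assms(5,6)] by metis
qed

lemma octagon_segment:
  assumes "p \<in> octagon" "p + w \<in> octagon" "0 \<le> t" "t \<le> 1"
  shows "p + t *\<^sub>R w \<in> octagon"
proof -
  have "(1 - t) *\<^sub>R p + t *\<^sub>R (p + w) \<in> octagon"
    using convex_octagon assms by (simp add: convex_alt)
  then show ?thesis by (simp add: algebra_simps)
qed

text \<open>Along the segment, \<open>\<phi>\<close> is compared with the straight path from
  \<open>p\<close>. The parameters in [0,1) at which they agree form a clopen set containing 0; the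
  Hausdorff property then gives agreement at 1, where the singularity is allowed.\<close>

lemma translation_rigid:
  assumes tr: "translation_on S \<phi>" and S: "\<And>t. 0 \<le> t \<Longrightarrow> t \<le> 1 \<Longrightarrow> z + t *\<^sub>R w \<in> S"
    and p: "p \<in> octagon" "p + w \<in> octagon" "\<phi> z = proj p"
    and ns: "\<And>t. 0 \<le> t \<Longrightarrow> t < 1 \<Longrightarrow> \<phi> (z + t *\<^sub>R w) \<noteq> sing"
  shows "\<phi> (z + w) = proj (p + w)"
proof -
  let ?f = "\<lambda>t. \<phi> (z + t *\<^sub>R w)" and ?g = "\<lambda>t. proj (p + t *\<^sub>R w)"
  have pO: "p + t *\<^sub>R w \<in> octagon" if "0 \<le> t" "t \<le> 1" for t
    using octagon_segment[OF p(1,2)] that .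
  have cf: "continuous_on {0..1} ?f"
    by (rule continuous_on_compose2[OF translation_on_continuous[OF tr]]) (auto intro!: continuous_intros S)
  have cg: "continuous_on {0..1} ?g"
    by (rule continuous_on_compose2[OF continuous_on_proj]) (auto intro!: continuous_intros pO)
  let ?A = "{t \<in> {0..<1}. ?f t = ?g t}"
  have "{0..<1::real} \<subseteq> {0..1}" by auto
  then have "continuous_on {0..<1} (\<lambda>t. (?f t, ?g t))"
    by (intro continuous_on_Pair continuous_on_subset[OF cf] continuous_on_subset[OF cg])
  then have "closedin (top_of_set {0..<1}) ({0..<1} \<inter> (\<lambda>t. (?f t, ?g t)) -` {y. \<exists>x. y = (x, x)})"
    by (intro continuous_closedin_preimage closed_diagonal)
  moreover have "{0..<1} \<inter> (\<lambda>t. (?f t, ?g t)) -` {y. \<exists>x. y = (x, x)} = ?A" by auto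
  ultimately have cl: "closedin (top_of_set {0..<1}) ?A" by simp
  have op: "openin (top_of_set {0..<1}) ?A"
    unfolding openin_contains_ball
  proof (intro conjI ballI)
    fix t0 assume t0: "t0 \<in> ?A"
    then have z0: "z + t0 *\<^sub>R w \<in> S" using S by auto
    obtain e where e: "e > 0" "\<And>y. y \<in> S \<inter> ball (z + t0 *\<^sub>R w) e \<Longrightarrow>
      \<exists>q\<in>octagon. q + (y - (z + t0 *\<^sub>R w)) \<in> octagon \<and> proj q = \<phi> (z + t0 *\<^sub>R w) \<and> proj (q + (y - (z + t0 *\<^sub>R w))) = \<phi> y"
      using tr z0 unfolding translation_on_def by meson
    \<comment> \<open>The denominator \<open>1 + norm w\<close> instead of \<open>norm w\<close>
      also covers \<open>w = 0\<close>.\<close>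
    have "?f t = ?g t" if t: "t \<in> {0..<1}" "t \<in> ball t0 (e / (1 + norm w))" for t
    proof -
      have "\<bar>t - t0\<bar> * norm w \<le> \<bar>t - t0\<bar> * (1 + norm w)" by (intro mult_left_mono) auto
      also have "\<dots> < e"
        using t(2) norm_ge_zero[of w] by (simp add: dist_real_def abs_minus_commute pos_less_divide_eq add_pos_nonneg)
      finally have "norm ((t0 - t) *\<^sub>R w) < e" by (simp add: abs_minus_commute)
      then have "z + t *\<^sub>R w \<in> S \<inter> ball (z + t0 *\<^sub>R w) e"
        using t(1) by (auto simp: dist_norm algebra_simps intro!: S)
      then obtain q where q: "q \<in> octagon" "q + (z + t *\<^sub>R w - (z + t0 *\<^sub>R w)) \<in> octagon"
        "proj q = ?f t0" "proj (q + (z + t *\<^sub>R w - (z + t0 *\<^sub>R w))) = ?f t"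
        using e(2) by blast
      have d: "z + t *\<^sub>R w - (z + t0 *\<^sub>R w) = (t - t0) *\<^sub>R w" by (simp add: algebra_simps)
      have "proj (q + (t - t0) *\<^sub>R w) = proj (p + t0 *\<^sub>R w + (t - t0) *\<^sub>R w)"
        using q d t0 t(1) ns[of t0] pO[of t0] pO[of t]
        by (intro proj_shift_eq) (auto simp: algebra_simps)
      also have "p + t0 *\<^sub>R w + (t - t0) *\<^sub>R w = p + t *\<^sub>R w" by (simp add: algebra_simps)
      finally show ?thesis using q d by simp
    qed
    moreover have "e / (1 + norm w) > 0" using e(1) by (simp add: add_pos_nonneg)
    ultimately show "\<exists>e>0. ball t0 e \<inter> {0..<1} \<subseteq> ?A" by blast
  qed auto
  have "connected {0..<1::real}" by simp
  then have "?A = {} \<or> ?A = {0..<1}" using cl op unfolding connected_clopen by blast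
  moreover have "0 \<in> ?A" using p by simp
  ultimately have "?A = {0..<1}" by blast
  then have agree: "?f t = ?g t" if "t \<in> {0..<1}" for t using that by blast
  have "{0..1} \<subseteq> closure {0..<1::real}" by simp
  then have "?f 1 = ?g 1"
    using agree_on_closure[OF cf cg _ _ agree, of "{0..<1}" 1] by fastforce
  then show ?thesis by simp
qed

section \<open>Affine automorphisms\<close>

text \<open>In contrast to \<^const>\<open>affine_aut\<close>, this also constrains \<open>f\<close> near the singularity, so that it applies to
  the closed quadrilaterals.\<close>

definition locally_affine :: "real^2^2 \<Rightarrow> (octsurf \<Rightarrow> octsurf) \<Rightarrow> bool" where
  "locally_affine A f \<longleftrightarrow> (\<forall>x. \<exists>e>0. \<forall>p v. p \<in> octagon \<and> proj p = x \<and> norm v < e \<and> p + v \<in> octagon \<longrightarrow>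
     (\<exists>p'\<in>octagon. proj p' = f x \<and> p' + A *v v \<in> octagon \<and> proj (p' + A *v v) = f (proj (p + v))))"

lemma matrix_vector_small:
  fixes A :: "real^2^2"
  assumes "e > 0"
  obtains d where "d > 0" "\<And>v. norm v < d \<Longrightarrow> norm (A *v v) < e"
proof -
  have "bounded_linear (\<lambda>v. A *v v)" by (simp add: matrix_vector_mul_bounded_linear)
  then obtain K where K: "K > 0" "\<And>v. norm (A *v v) \<le> norm v * K"
    using bounded_linear.pos_bounded by blast
  have "norm (A *v v) < e" if "norm v < e / K" for v
    using K(2)[of v] that K(1) by (simp add: pos_less_divide_eq)
  then show thesis using that[of "e / K"] K(1) assms by simp
qed

lemma locally_affine_continuous:
  assumes "locally_affine A f"
  shows "continuous_on UNIV f"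
proof -
  have "openin (top_of_set octagon) {p \<in> octagon. proj p \<in> f -` B}" if B: "open B" for B
    unfolding openin_contains_ball
  proof (intro conjI ballI)
    fix p assume "p \<in> {p \<in> octagon. proj p \<in> f -` B}"
    then have p: "p \<in> octagon" "f (proj p) \<in> B" by auto
    obtain e where e: "e > 0"
      "\<And>q v. q \<in> octagon \<Longrightarrow> proj q = f (proj p) \<Longrightarrow> norm v < e \<Longrightarrow> q + v \<in> octagon \<Longrightarrow> proj (q + v) \<in> B"
      using surf_nhd[OF B p(2)] by metis
    obtain d where d: "d > 0" "\<And>v. norm v < d \<Longrightarrow> norm (A *v v) < e"
      using matrix_vector_small[OF e(1)] by metis
    obtain e1 where e1: "e1 > 0" "\<And>q v. q \<in> octagon \<Longrightarrow> proj q = proj p \<Longrightarrow> norm v < e1 \<Longrightarrow> q + v \<in> octagon \<Longrightarrow>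
      \<exists>p'\<in>octagon. proj p' = f (proj p) \<and> p' + A *v v \<in> octagon \<and> proj (p' + A *v v) = f (proj (q + v))"
      using assms unfolding locally_affine_def by meson
    have "f (proj s) \<in> B" if "s \<in> ball p (min d e1)" "s \<in> octagon" for s
    proof -
      have "norm (s - p) < min d e1" using that(1) by (simp add: dist_norm norm_minus_commute)
      then show ?thesis using e1(2)[of p "s - p"] p(1) that(2) d(2)[of "s - p"] e(2) by force
    qed
    then show "\<exists>e>0. ball p e \<inter> octagon \<subseteq> {p \<in> octagon. proj p \<in> f -` B}"
      using d(1) e1(1) by (intro exI[of _ "min d e1"]) auto
  qed auto
  then show ?thesis
    by (subst continuous_on_open_vimage) (auto simp: open_surf_iff)
qed

lemma translation_on_locally_affine:
  assumes f: "locally_affine A f" and \<phi>: "translation_on U \<phi>" and AB: "B ** A = mat 1"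
  shows "translation_on ((\<lambda>z. A *v z) ` U) (\<lambda>w. f (\<phi> (B *v w)))"
  unfolding translation_on_def
proof (intro ballI)
  have BA: "B *v (A *v z) = z" for z
    using AB by (simp add: matrix_vector_mul_assoc)
  fix z' assume "z' \<in> (\<lambda>z. A *v z) ` U"
  then obtain z where z: "z \<in> U" "z' = A *v z" by auto
  obtain e1 where e1: "e1 > 0" "\<And>w. w \<in> U \<inter> ball z e1 \<Longrightarrow>
      \<exists>p\<in>octagon. p + (w - z) \<in> octagon \<and> proj p = \<phi> z \<and> proj (p + (w - z)) = \<phi> w"
    using \<phi> z(1) unfolding translation_on_def by meson
  obtain e2 where e2: "e2 > 0" "\<And>p v. p \<in> octagon \<Longrightarrow> proj p = \<phi> z \<Longrightarrow> norm v < e2 \<Longrightarrow> p + v \<in> octagon \<Longrightarrow>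
      \<exists>p'\<in>octagon. proj p' = f (\<phi> z) \<and> p' + A *v v \<in> octagon \<and> proj (p' + A *v v) = f (proj (p + v))"
    using f unfolding locally_affine_def by meson
  obtain d where d: "d > 0" "\<And>v. norm v < d \<Longrightarrow> norm (B *v v) < min e1 e2"
    using matrix_vector_small[of "min e1 e2" B] e1(1) e2(1) by auto
  show "\<exists>e>0. \<forall>w\<in>(\<lambda>z. A *v z) ` U \<inter> ball z' e. \<exists>p\<in>octagon. p + (w - z') \<in> octagon \<and>
      proj p = f (\<phi> (B *v z')) \<and> proj (p + (w - z')) = f (\<phi> (B *v w))"
  proof (intro exI[of _ d] conjI ballI d(1))
    fix w' assume "w' \<in> (\<lambda>z. A *v z) ` U \<inter> ball z' d"
    then obtain w where w: "w \<in> U" "w' = A *v w" and "dist z' w' < d" by auto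
    then have "norm (A *v (w - z)) < d"
      by (simp add: z(2) dist_norm norm_minus_commute matrix_vector_mult_diff_distrib)
    then have n: "norm (w - z) < min e1 e2" using d(2) BA by metis
    then have "w \<in> U \<inter> ball z e1" using w(1) by (simp add: dist_norm norm_minus_commute)
    then obtain p where p: "p \<in> octagon" "p + (w - z) \<in> octagon" "proj p = \<phi> z" "proj (p + (w - z)) = \<phi> w"
      using e1(2) by blast
    obtain p' where "p' \<in> octagon" "proj p' = f (\<phi> z)" "p' + A *v (w - z) \<in> octagon"
      "proj (p' + A *v (w - z)) = f (proj (p + (w - z)))"
      using e2(2)[OF p(1,3) _ p(2)] n by auto
    then show "\<exists>p\<in>octagon. p + (w' - z') \<in> octagon \<and>
      proj p = f (\<phi> (B *v z')) \<and> proj (p + (w' - z')) = f (\<phi> (B *v w'))"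
      by (intro bexI[of _ p']) (simp_all add: z(2) w(2) BA p(4) matrix_vector_mult_diff_distrib)
  qed
qed

lemma locally_affine_compose:
  assumes f: "locally_affine A f" and g: "locally_affine B g"
  shows "locally_affine (B ** A) (g \<circ> f)"
  unfolding locally_affine_def
proof
  fix x
  obtain e1 where e1: "e1 > 0" "\<And>p v. p \<in> octagon \<Longrightarrow> proj p = x \<Longrightarrow> norm v < e1 \<Longrightarrow> p + v \<in> octagon \<Longrightarrow>
      \<exists>p'\<in>octagon. proj p' = f x \<and> p' + A *v v \<in> octagon \<and> proj (p' + A *v v) = f (proj (p + v))"
    using f unfolding locally_affine_def by meson
  obtain e2 where e2: "e2 > 0" "\<And>p v. p \<in> octagon \<Longrightarrow> proj p = f x \<Longrightarrow> norm v < e2 \<Longrightarrow> p + v \<in> octagon \<Longrightarrow>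
      \<exists>p'\<in>octagon. proj p' = g (f x) \<and> p' + B *v v \<in> octagon \<and> proj (p' + B *v v) = g (proj (p + v))"
    using g unfolding locally_affine_def by meson
  obtain d where d: "d > 0" "\<And>v. norm v < d \<Longrightarrow> norm (A *v v) < e2"
    using matrix_vector_small[OF e2(1)] by metis
  show "\<exists>e>0. \<forall>p v. p \<in> octagon \<and> proj p = x \<and> norm v < e \<and> p + v \<in> octagon \<longrightarrow>
     (\<exists>p'\<in>octagon. proj p' = (g \<circ> f) x \<and> p' + (B ** A) *v v \<in> octagon \<and>
        proj (p' + (B ** A) *v v) = (g \<circ> f) (proj (p + v)))"
  proof (intro exI[of _ "min e1 d"] conjI allI impI)
    fix p v assume *: "p \<in> octagon \<and> proj p = x \<and> norm v < min e1 d \<and> p + v \<in> octagon"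
    obtain p' where p': "p' \<in> octagon" "proj p' = f x" "p' + A *v v \<in> octagon" "proj (p' + A *v v) = f (proj (p + v))"
      using e1(2)[of p v] * by auto
    then show "\<exists>p'\<in>octagon. proj p' = (g \<circ> f) x \<and> p' + (B ** A) *v v \<in> octagon \<and>
        proj (p' + (B ** A) *v v) = (g \<circ> f) (proj (p + v))"
      using e2(2)[of p' "A *v v"] d(2)[of v] * by (auto simp: matrix_vector_mul_assoc)
  qed (use e1(1) d(1) in auto)
qed

text \<open>Both inverses are recorded, so that this notion is visibly closed under composition and
  inversion. All automorphisms constructed below are of this kind, and \<open>aut_of_eq\<close>
  identifies them with the ones chosen by \<open>aut_of\<close>.\<close>

definition surf_aut :: "real^2^2 \<Rightarrow> real^2^2 \<Rightarrow> (octsurf \<Rightarrow> octsurf) \<Rightarrow> (octsurf \<Rightarrow> octsurf) \<Rightarrow> bool" where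
  "surf_aut A B f g \<longleftrightarrow> A ** B = mat 1 \<and> B ** A = mat 1 \<and> f \<circ> g = id \<and> g \<circ> f = id \<and>
     f sing = sing \<and> locally_affine A f \<and> locally_affine B g"

lemma surf_aut_inverse: "surf_aut A B f g \<Longrightarrow> surf_aut B A g f"
  by (auto simp: surf_aut_def) (metis comp_apply id_apply)

lemma surf_aut_compose:
  assumes "surf_aut A B f g" "surf_aut A' B' f' g'"
  shows "surf_aut (A' ** A) (B ** B') (f' \<circ> f) (g \<circ> g')"
proof -
  have "(A' ** A) ** (B ** B') = A' ** (A ** B) ** B'" "(B ** B') ** (A' ** A) = B ** (B' ** A') ** A"
    by (simp_all add: matrix_mul_assoc)
  moreover have "(f' \<circ> f) \<circ> (g \<circ> g') = f' \<circ> (f \<circ> g) \<circ> g'" "(g \<circ> g') \<circ> (f' \<circ> f) = g \<circ> (g' \<circ> f') \<circ> f"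
    by (simp_all add: o_assoc)
  ultimately show ?thesis
    using assms by (auto simp: surf_aut_def matrix_mul_rid intro: locally_affine_compose)
qed

lemma matrix_inv_eqI:
  fixes A B :: "real^'n^'n"
  assumes "A ** B = mat 1" "B ** A = mat 1"
  shows "matrix_inv A = B"
proof -
  have "\<exists>A'. A ** A' = mat 1 \<and> A' ** A = mat 1" using assms by blast
  then have "A ** matrix_inv A = mat 1 \<and> matrix_inv A ** A = mat 1"
    unfolding matrix_inv_def by (rule someI_ex)
  then have "matrix_inv A = (B ** A) ** matrix_inv A" "B = B ** (A ** matrix_inv A)"
    using assms by (simp_all add: matrix_mul_lid matrix_mul_rid)
  then show ?thesis by (simp add: matrix_mul_assoc)
qed

lemma surf_aut_matrix_inv: "surf_aut A B f g \<Longrightarrow> matrix_inv A = B"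
  by (simp add: surf_aut_def matrix_inv_eqI)

lemma surf_aut_affine_aut:
  assumes "surf_aut A B f g"
  shows "affine_aut A f"
  unfolding affine_aut_def
proof (intro conjI allI impI)
  note * = assms[unfolded surf_aut_def]
  show "invertible A" using * by (auto simp: invertible_def)
  have "homeomorphism UNIV UNIV f g"
    using * by (auto simp: homeomorphism_def locally_affine_continuous surj_def)
      (metis comp_apply id_apply)+
  then show "\<exists>g. homeomorphism UNIV UNIV f g" by blast
  show "f sing = sing" using * by simp
  fix U \<phi> assume "open U \<and> translation_on U \<phi> \<and> sing \<notin> \<phi> ` U"
  then show "translation_on ((\<lambda>z. A *v z) ` U) (\<lambda>w. f (\<phi> (matrix_inv A *v w)))"
    unfolding surf_aut_matrix_inv[OF assms] using * translation_on_locally_affine by blast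
qed

section \<open>Uniqueness of the affine automorphism with a given derivative\<close>

definition octagon_center :: "real^2" where
  "octagon_center = vec2 (1 / 2) ((1 + sqrt 2) / 2)"

definition open_octagon :: "(real^2) set" where
  "open_octagon = {p. 0 < p$2 \<and> p$1 - p$2 < 1 \<and> p$1 < 1 + sqrt 2 / 2 \<and> p$1 + p$2 < 2 + sqrt 2 \<and>
    p$2 < 1 + sqrt 2 \<and> p$2 - p$1 < 1 + sqrt 2 \<and> - (sqrt 2 / 2) < p$1 \<and> 0 < p$1 + p$2}"

lemma open_octagon_subset: "open_octagon \<subseteq> octagon"
  by (auto simp: open_octagon_def octagon_eq octagon_ineqs_def)

lemma open_open_octagon: "open open_octagon"
  unfolding open_octagon_def by (intro open_Collect_conj open_Collect_less continuous_intros)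

lemma open_octagon_nonsing: "p \<in> open_octagon \<Longrightarrow> proj p \<noteq> sing"
  using open_octagon_subset by (subst proj_eq_sing) (auto simp: mem_octverts open_octagon_def)

lemma open_octagon_center:
  assumes "p \<in> octagon" "0 < t" "t \<le> 1"
  shows "p + t *\<^sub>R (octagon_center - p) \<in> open_octagon"
proof -
  have *: "(1 - t) * a + t * b < c" if "a \<le> c" "b < c" for a b c :: real
  proof -
    have "(1 - t) * a + t * b < (1 - t) * c + t * c"
      using that assms by (intro add_le_less_mono mult_left_mono mult_strict_left_mono) auto
    then show ?thesis by (simp add: algebra_simps)
  qed
  have s: "0 < sqrt (2::real)" by simp
  note p = assms(1)[unfolded octagon_eq mem_Collect_eq octagon_ineqs_def]
  show ?thesis
    using p *[of "- (p$2)" 0 "- (octagon_center$2)"] *[of "p$1 - p$2" 1 "octagon_center$1 - octagon_center$2"]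
      *[of "p$1" "1 + sqrt 2 / 2" "octagon_center$1"] *[of "p$1 + p$2" "2 + sqrt 2" "octagon_center$1 + octagon_center$2"]
      *[of "p$2" "1 + sqrt 2" "octagon_center$2"] *[of "p$2 - p$1" "1 + sqrt 2" "octagon_center$2 - octagon_center$1"]
      *[of "- (p$1)" "sqrt 2 / 2" "- (octagon_center$1)"] *[of "- (p$1) - p$2" 0 "- (octagon_center$1) - octagon_center$2"] s
    by (simp add: open_octagon_def octagon_center_def) (simp add: algebra_simps add_divide_distrib)
qed

lemma open_octagon_from_center:
  assumes "p \<in> open_octagon" "0 \<le> t" "t \<le> 1"
  shows "octagon_center + t *\<^sub>R (p - octagon_center) \<in> open_octagon"
proof (cases "t = 1")
  case False
  have "p + (1 - t) *\<^sub>R (octagon_center - p) \<in> open_octagon"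
    using assms False open_octagon_subset by (intro open_octagon_center) auto
  then show ?thesis by (simp add: algebra_simps)
qed (use assms in simp)

text \<open>Hence a translation automorphism taking the center to \<open>q\<close> would take an interior point of the
  octagon to the singularity.\<close>

lemma vertex_in_translate:
  assumes "q \<in> octagon" "q \<noteq> octagon_center"
  obtains v where "v \<in> octverts" "octagon_center + (v - q) \<in> open_octagon"
proof -
  define a b where "a = q$1 - 1 / 2" and "b = q$2 - (1 + sqrt 2) / 2"
  have q: "q$1 = a + 1 / 2" "q$2 = b + (1 + sqrt 2) / 2" by (simp_all add: a_def b_def)
  have ne: "\<not> (a = 0 \<and> b = 0)"
    using assms(2) by (auto simp: a_def b_def octagon_center_def vec_eq_iff forall_2)
  note ineqs = assms(1)[unfolded octagon_eq mem_Collect_eq octagon_ineqs_def q]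
  note simps = open_octagon_def octagon_center_def octv_eqs q add_divide_distrib
  \<comment> \<open>The octant containing the displacement of \<open>q\<close> from the center
    selects the vertex whose direction bisects it; shifting that vertex back by the displacement
    moves it into the interior.\<close>
  consider "0 \<le> b" "b \<le> a" | "0 \<le> a" "a \<le> b" | "a \<le> 0" "- a \<le> b" | "0 \<le> b" "b \<le> - a"
    | "b \<le> 0" "- b \<le> - a" | "a \<le> 0" "a \<ge> b" | "0 \<le> a" "a \<le> - b" | "b \<le> 0" "- b \<le> a"
    by linarith
  then have "\<exists>i<8. octagon_center + (octv i - q) \<in> open_octagon"
  proof cases
    case 1
    then show ?thesis using ne ineqs sqrt2_bounds by (intro exI[of _ 3]) (auto simp: simps)
  next
    case 2
    then show ?thesis using ne ineqs sqrt2_bounds by (intro exI[of _ 4]) (auto simp: simps)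
  next
    case 3
    then show ?thesis using ne ineqs sqrt2_bounds by (intro exI[of _ 5]) (auto simp: simps)
  next
    case 4
    then show ?thesis using ne ineqs sqrt2_bounds by (intro exI[of _ 6]) (auto simp: simps)
  next
    case 5
    then show ?thesis using ne ineqs sqrt2_bounds by (intro exI[of _ 7]) (auto simp: simps)
  next
    case 6
    then show ?thesis using ne ineqs sqrt2_bounds by (intro exI[of _ 0]) (auto simp: simps)
  next
    case 7
    then show ?thesis using ne ineqs sqrt2_bounds by (intro exI[of _ 1]) (auto simp: simps)
  next
    case 8
    then show ?thesis using ne ineqs sqrt2_bounds by (intro exI[of _ 2]) (auto simp: simps)
  qed
  then show thesis using that by (auto simp: octverts_def)
qed

lemma translation_on_proj:
  assumes "U \<subseteq> octagon"
  shows "translation_on U proj"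
  unfolding translation_on_def
proof (intro ballI exI[of _ 1] conjI)
  fix z w assume "z \<in> U" "w \<in> U \<inter> ball z 1"
  then show "\<exists>p\<in>octagon. p + (w - z) \<in> octagon \<and> proj p = proj z \<and> proj (p + (w - z)) = proj w"
    using assms by (intro bexI[of _ z]) auto
qed simp

lemma matrix_inv_mat_1: "matrix_inv (mat 1 :: real^'n^'n) = mat 1"
  by (rule matrix_inv_eqI) (simp_all add: matrix_mul_lid)

text \<open>By rigidity along rays from the center, \<open>f\<close> acts on the open octagon as the
  translation taking the center to a representative \<open>q\<close> of its image. If
  \<open>q\<close> were another point, some interior point would go to a vertex, contradicting
  injectivity of \<open>f\<close>, which fixes \<open>sing\<close>. Continuity along segments
  towards the center settles the boundary.\<close>

lemma affine_aut_id:
  assumes f: "affine_aut (mat 1) f"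
  shows "f = id"
proof -
  obtain g where g: "homeomorphism UNIV UNIV f g" using f by (auto simp: affine_aut_def)
  then have inj: "f x = f y \<longleftrightarrow> x = y" for x y
    unfolding homeomorphism_def by (metis UNIV_I)
  have sing: "f sing = sing" using f by (simp add: affine_aut_def)
  let ?F = "\<lambda>z. f (proj z)" and ?c = octagon_center
  have "open open_octagon \<and> translation_on open_octagon proj \<and> sing \<notin> proj ` open_octagon"
    using open_open_octagon translation_on_proj[OF open_octagon_subset] open_octagon_nonsing by (force dest: sym)
  then have tr: "translation_on open_octagon ?F"
    using f unfolding affine_aut_def by (fastforce simp: matrix_inv_mat_1)
  have ns: "?F z \<noteq> sing" if "z \<in> open_octagon" for z
    using inj sing open_octagon_nonsing[OF that] by metis
  have c: "?c \<in> open_octagon"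
    using open_octagon_center[OF octv_in_octagon[of 0], of 1] by simp
  have rigid: "?F (?c + w) = proj (q + w)"
    if "?F ?c = proj q" "q \<in> octagon" "q + w \<in> octagon" "?c + w \<in> open_octagon" for q w
  proof (rule translation_rigid[OF tr _ that(2,3,1)])
    show 1: "?c + t *\<^sub>R w \<in> open_octagon" if "0 \<le> t" "t \<le> 1" for t
      using open_octagon_from_center[OF \<open>?c + w \<in> open_octagon\<close> that] by simp
    show "?F (?c + t *\<^sub>R w) \<noteq> sing" if "0 \<le> t" "t < 1" for t
      using 1 ns that by simp
  qed
  obtain q where q: "q \<in> octagon" "proj q = ?F ?c" using proj_surj by blast
  have "q = ?c"
  proof (rule ccontr)
    assume "q \<noteq> ?c"
    then obtain v where v: "v \<in> octverts" "?c + (v - q) \<in> open_octagon"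
      using vertex_in_translate q(1) by metis
    then have "v \<in> octagon" using octverts_subset by blast
    then have "?F (?c + (v - q)) = proj v"
      using rigid[of q "v - q"] q v by simp
    also have "\<dots> = sing" using v(1) \<open>v \<in> octagon\<close> by (simp add: proj_eq_sing)
    finally show False using ns v(2) by blast
  qed
  have int: "?F z = proj z" if "z \<in> open_octagon" for z
    using rigid[of ?c "z - ?c"] q \<open>q = ?c\<close> that open_octagon_subset by auto
  have "f (proj p) = proj p" if p: "p \<in> octagon" for p
  proof -
    let ?h = "\<lambda>t. p + t *\<^sub>R (?c - p)"
    have h: "?h t \<in> octagon" if "t \<in> {0..1}" for t
      using octagon_segment[OF p, of "?c - p"] that c open_octagon_subset by auto
    have cp: "continuous_on {0..1} (\<lambda>t. proj (?h t))"
      by (rule continuous_on_compose2[OF continuous_on_proj]) (use h in \<open>auto intro!: continuous_intros\<close>)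
    have "continuous_on UNIV f" using g by (simp add: homeomorphism_def)
    then have cf: "continuous_on {0..1} (\<lambda>t. f (proj (?h t)))"
      by (rule continuous_on_compose2[OF _ cp]) auto
    have agree: "f (proj (?h t)) = proj (?h t)" if "t \<in> {0<..1}" for t
      using that by (intro int open_octagon_center p) auto
    have "f (proj (?h 0)) = proj (?h 0)"
      using agree_on_closure[OF cf cp _ _ agree, of "{0<..1}" 0] by fastforce
    then show ?thesis by simp
  qed
  then have "f x = x" for x using proj_surj[of x] by auto
  then show ?thesis by auto
qed

text \<open>Composition with the inverse \<open>g\<close> reduces to derivative
  \<open>mat 1\<close>. Only \<open>affine_aut\<close> is known of \<open>f'\<close>, so its
  condition on parametrizations is applied to those carried over by \<open>g\<close>, which again
  avoid the singularity.\<close>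

lemma affine_aut_unique:
  assumes "affine_aut A f'" "surf_aut A B f g"
  shows "f' = f"
proof -
  note * = assms(2)[unfolded surf_aut_def]
  have g: "surf_aut B A g f" using assms(2) by (rule surf_aut_inverse)
  then have g': "affine_aut B g" by (rule surf_aut_affine_aut)
  have inv: "matrix_inv A = B" "matrix_inv B = A" using assms(2) g surf_aut_matrix_inv by blast+
  obtain k where k: "homeomorphism UNIV UNIV f' k" using assms(1) by (auto simp: affine_aut_def)
  have fg: "f (g x) = x" "g (f x) = x" for x using * by (metis comp_apply id_apply)+
  have "affine_aut (mat 1) (f' \<circ> g)"
    unfolding affine_aut_def
  proof (intro conjI allI impI)
    show "invertible (mat 1 :: real^2^2)" by (metis invertible_def matrix_mul_lid)
    obtain k' where "homeomorphism UNIV UNIV g k'" using g' by (auto simp: affine_aut_def)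
    then show "\<exists>h. homeomorphism UNIV UNIV (f' \<circ> g) h"
      using homeomorphism_compose[OF _ k] by blast
    show "(f' \<circ> g) sing = sing" using assms(1) g' by (simp add: affine_aut_def)
    fix U \<phi> assume U: "open U \<and> translation_on U \<phi> \<and> sing \<notin> \<phi> ` U"
    let ?V = "(\<lambda>z. B *v z) ` U" and ?\<psi> = "\<lambda>w. g (\<phi> (A *v w))"
    have 1: "translation_on ?V ?\<psi>"
      using U g' inv unfolding affine_aut_def by metis
    have AB: "A *v (B *v z) = z" "B *v (A *v z) = z" for z
      using * by (simp_all add: matrix_vector_mul_assoc)
    have "?V = (\<lambda>z. A *v z) -` U"
      using AB by (auto simp: image_iff) metis
    then have 2: "open ?V"
      using U continuous_open_vimage[of U "\<lambda>z. A *v z"] by (simp add: open_vimage matrix_vector_mult_linear_continuous_on)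
    have 3: "sing \<notin> ?\<psi> ` ?V"
    proof
      assume "sing \<in> ?\<psi> ` ?V"
      then obtain z where "z \<in> U" "g (\<phi> z) = sing" using AB by auto
      then have "\<phi> z = sing" using fg(1)[of "\<phi> z"] * by simp
      then show False using U \<open>z \<in> U\<close> by (metis imageI)
    qed
    have "translation_on ((\<lambda>z. A *v z) ` ?V) (\<lambda>w. f' (?\<psi> (B *v w)))"
      using assms(1)[unfolded affine_aut_def inv, THEN conjunct2, THEN conjunct2, THEN conjunct2,
          rule_format, of ?V ?\<psi>] 1 2 3 by blast
    moreover have "(\<lambda>z. A *v z) ` ?V = U" using AB by (auto simp: image_image)
    ultimately show "translation_on ((\<lambda>z. mat 1 *v z) ` U) (\<lambda>w. (f' \<circ> g) (\<phi> (matrix_inv (mat 1) *v w)))"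
      by (simp add: AB matrix_inv_mat_1)
  qed
  then have "f' \<circ> g = id" by (rule affine_aut_id)
  then have "f' x = f x" for x using fg(2)[of x] by (metis comp_apply id_apply)
  then show ?thesis by auto
qed

lemma aut_of_eq:
  assumes "surf_aut A B f g"
  shows "aut_of A = f"
  unfolding aut_of_def
  using surf_aut_affine_aut[OF assms] affine_aut_unique[OF _ assms] by (rule the_equality)

section \<open>Glued quadrilaterals\<close>

text \<open>Turns the angular condition into the sign of a determinant, on which linear maps act by
  a factor; the converse uses polar coordinates relative to \<open>\<theta>\<close>.\<close>

lemma left_of_iff: "left_of \<theta> v \<longleftrightarrow> cross (dir \<theta>) v > 0"
proof
  assume "left_of \<theta> v"
  then obtain r t where *: "r > 0" "\<theta> < t" "t < \<theta> + pi" "v = r *\<^sub>R dir t"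
    by (auto simp: left_of_def)
  have "cross (dir \<theta>) v = r * sin (t - \<theta>)"
    by (simp add: *(4) cross_simps) (simp add: cross_def dir_def sin_diff)
  moreover have "sin (t - \<theta>) > 0" using * by (intro sin_gt_zero) auto
  ultimately show "cross (dir \<theta>) v > 0" using *(1) by simp
next
  assume pos: "cross (dir \<theta>) v > 0"
  define n where "n = sqrt ((v$1)\<^sup>2 + (v$2)\<^sup>2)"
  have "v$1 \<noteq> 0 \<or> v$2 \<noteq> 0" using pos by (auto simp: cross_def)
  then have sq: "(v$1)\<^sup>2 + (v$2)\<^sup>2 > 0" by (auto simp: sum_power2_gt_zero_iff)
  then have n: "n > 0" "n\<^sup>2 = (v$1)\<^sup>2 + (v$2)\<^sup>2" by (simp_all add: n_def)
  \<comment> \<open>Coordinates of \<open>v\<close>, divided by its length \<open>n\<close>, in the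
    orthonormal frame whose first vector is \<open>dir \<theta>\<close>.\<close>
  define x y where "x = (cos \<theta> * v$1 + sin \<theta> * v$2) / n" and "y = cross (dir \<theta>) v / n"
  have "(cos \<theta> * v$1 + sin \<theta> * v$2)\<^sup>2 + (cross (dir \<theta>) v)\<^sup>2 =
      ((sin \<theta>)\<^sup>2 + (cos \<theta>)\<^sup>2) * ((v$1)\<^sup>2 + (v$2)\<^sup>2)"
    unfolding cross_def dir_def by (simp add: power2_eq_square algebra_simps del: sin_cos_squared_add sin_cos_squared_add2 sin_cos_squared_add3)
  moreover have "x\<^sup>2 + y\<^sup>2 = ((cos \<theta> * v$1 + sin \<theta> * v$2)\<^sup>2 + (cross (dir \<theta>) v)\<^sup>2) / n\<^sup>2"
    unfolding x_def y_def power_divide by (rule add_divide_distrib[symmetric])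
  ultimately have "x\<^sup>2 + y\<^sup>2 = n\<^sup>2 / n\<^sup>2" using n(2) by simp
  then have "x\<^sup>2 + y\<^sup>2 = 1" using n(1) by simp
  then obtain t where t: "0 \<le> t" "t < 2 * pi" "x = cos t" "y = sin t"
    using sincos_total_2pi by metis
  have "y > 0" using pos n by (simp add: y_def)
  then have "t < pi" using t sin_le_zero[of t] by force
  moreover have "t > 0" using t \<open>y > 0\<close> by (cases "t = 0") auto
  moreover have "v = n *\<^sub>R dir (\<theta> + t)"
  proof -
    have xy: "n * cos t = cos \<theta> * v$1 + sin \<theta> * v$2" "n * sin t = cos \<theta> * v$2 - sin \<theta> * v$1"
      using t(3,4)[symmetric] n by (simp_all add: x_def y_def cross_def dir_def)
    have "n * cos (\<theta> + t) = cos \<theta> * (n * cos t) - sin \<theta> * (n * sin t)"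
      "n * sin (\<theta> + t) = sin \<theta> * (n * cos t) + cos \<theta> * (n * sin t)"
      by (simp_all add: cos_add sin_add algebra_simps)
    then have "n * cos (\<theta> + t) = ((sin \<theta>)\<^sup>2 + (cos \<theta>)\<^sup>2) * v$1" "n * sin (\<theta> + t) = ((sin \<theta>)\<^sup>2 + (cos \<theta>)\<^sup>2) * v$2"
      unfolding xy by (simp_all add: power2_eq_square algebra_simps del: sin_cos_squared_add sin_cos_squared_add2 sin_cos_squared_add3)
    then show ?thesis by (simp add: vec_eq_iff forall_2 dir_def)
  qed
  ultimately show "left_of \<theta> v"
    using n(1) by (auto simp: left_of_def intro!: exI[of _ n] bexI[of _ "\<theta> + t"])
qed

lemma right_of_iff: "right_of \<theta> v \<longleftrightarrow> cross (dir \<theta>) v < 0"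
proof -
  have "right_of \<theta> v \<longleftrightarrow> left_of (\<theta> - pi) v" by (simp add: right_of_def left_of_def)
  moreover have "dir (\<theta> - pi) = - dir \<theta>" by (simp add: dir_def vec2_arith cos_diff sin_diff)
  ultimately show ?thesis by (simp add: left_of_iff cross_simps)
qed

definition core :: "quad \<Rightarrow> (real^2) set" where
  "core q = half_open_quad (br q) (dg q) (bl q)"

definition convex_cell :: "quad \<Rightarrow> bool" where
  "convex_cell q \<longleftrightarrow> convex_quad (br q) (dg q) (bl q)"

text \<open>A stricter, pointwise form of the gluing of quadrilaterals than \<^const>\<open>perm_left\<close> and
  \<^const>\<open>perm_right\<close>; the last condition expresses the decomposition of the surface without double counting.\<close>

definition glued_quads :: "(nat \<Rightarrow> nat) \<Rightarrow> (nat \<Rightarrow> nat) \<Rightarrow> (nat \<Rightarrow> quad) \<Rightarrow> bool" where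
  "glued_quads pl pr q \<longleftrightarrow> pl permutes {1..3} \<and> pr permutes {1..3} \<and>
     (\<forall>i\<in>{1..3}. convex_cell (q i) \<and> translation_on (region (q i)) (emb (q i)) \<and> emb (q i) 0 = sing \<and>
        dg (q i) = bl (q i) + br (q (pl i)) \<and> dg (q i) = br (q i) + bl (q (pr i)) \<and>
        (\<forall>t. 0 \<le> t \<and> t \<le> 1 \<longrightarrow> emb (q i) (bl (q i) + t *\<^sub>R br (q (pl i))) = emb (q (pl i)) (t *\<^sub>R br (q (pl i)))) \<and>
        (\<forall>t. 0 \<le> t \<and> t \<le> 1 \<longrightarrow> emb (q i) (br (q i) + t *\<^sub>R bl (q (pr i))) = emb (q (pr i)) (t *\<^sub>R bl (q (pr i))))) \<and>
     bij_betw (\<lambda>(i, z). emb (q i) z) (SIGMA i:{1..3}. core (q i)) (UNIV - {sing})"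

lemma glued_quadsD:
  assumes "glued_quads pl pr q" "i \<in> {1..3}"
  shows "convex_cell (q i)" "translation_on (region (q i)) (emb (q i))" "emb (q i) 0 = sing"
    "dg (q i) = bl (q i) + br (q (pl i))" "dg (q i) = br (q i) + bl (q (pr i))"
    "0 \<le> t \<Longrightarrow> t \<le> 1 \<Longrightarrow> emb (q i) (bl (q i) + t *\<^sub>R br (q (pl i))) = emb (q (pl i)) (t *\<^sub>R br (q (pl i)))"
    "0 \<le> t \<Longrightarrow> t \<le> 1 \<Longrightarrow> emb (q i) (br (q i) + t *\<^sub>R bl (q (pr i))) = emb (q (pr i)) (t *\<^sub>R bl (q (pr i)))"
    "pl i \<in> {1..3}" "pr i \<in> {1..3}"
proof -
  have p: "pl permutes {1..3}" "pr permutes {1..3}" using assms(1) by (simp_all add: glued_quads_def)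
  show "pl i \<in> {1..3}" using assms(2) by (subst permutes_in_image[OF p(1)])
  show "pr i \<in> {1..3}" using assms(2) by (subst permutes_in_image[OF p(2)])
qed (insert assms[unfolded glued_quads_def], blast+)

lemma glued_quads_bij:
  "glued_quads pl pr q \<Longrightarrow> bij_betw (\<lambda>(i, z). emb (q i) z) (SIGMA i:{1..3}. core (q i)) (UNIV - {sing})"
  by (simp add: glued_quads_def)

lemma core_inj:
  assumes "glued_quads pl pr q" "i \<in> {1..3}" "j \<in> {1..3}" "z \<in> core (q i)" "w \<in> core (q j)"
    "emb (q i) z = emb (q j) w"
  shows "i = j" "z = w"
proof -
  have "inj_on (\<lambda>(i, z). emb (q i) z) (SIGMA i:{1..3}. core (q i))"
    using glued_quads_bij[OF assms(1)] by (simp add: bij_betw_def)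
  then have "(i, z) = (j, w)"
    by (rule inj_onD) (use assms in auto)
  then show "i = j" "z = w" by auto
qed

lemma core_nonsing:
  assumes "glued_quads pl pr q" "i \<in> {1..3}" "z \<in> core (q i)"
  shows "emb (q i) z \<noteq> sing"
proof -
  have "(\<lambda>(i, z). emb (q i) z) (i, z) \<in> UNIV - {sing}"
    using glued_quads_bij[OF assms(1)] assms(2,3) unfolding bij_betw_def by blast
  then show ?thesis by simp
qed

lemma core_surj:
  assumes "glued_quads pl pr q" "x \<noteq> sing"
  obtains i z where "i \<in> {1..3}" "z \<in> core (q i)" "emb (q i) z = x"
proof -
  have "x \<in> (\<lambda>(i, z). emb (q i) z) ` (SIGMA i:{1..3}. core (q i))"
    using glued_quads_bij[OF assms(1)] assms(2) by (simp add: bij_betw_def)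
  then show thesis using that by auto
qed

lemma region_cell: "convex_cell q \<Longrightarrow> region q = closed_quad (br q) (dg q) (bl q)"
  by (simp add: convex_cell_def region_eq)

lemma interior_cell: "convex_cell q \<Longrightarrow> interior (region q) = open_quad (br q) (dg q) (bl q)"
  by (simp add: region_cell convex_cell_def interior_closed_quad)

lemma core_subset_region: "convex_cell q \<Longrightarrow> core q \<subseteq> region q"
  by (auto simp: region_cell core_def half_open_quad_def closed_quad_def)

lemma interior_subset_core: "convex_cell q \<Longrightarrow> interior (region q) \<subseteq> core q"
  by (auto simp: interior_cell core_def half_open_quad_def open_quad_def cross_simps)

lemma cross_0_collinear:
  assumes "cross a v = 0" "a \<noteq> 0"
  obtains t where "v = t *\<^sub>R a"
proof -
  let ?s = "(a$1)\<^sup>2 + (a$2)\<^sup>2"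
  have s: "?s \<noteq> 0" using assms(2) by (auto simp: vec_eq_iff forall_2 sum_power2_eq_zero_iff)
  have "?s * v$1 = (a$1 * v$1 + a$2 * v$2) * a$1 - a$2 * cross a v"
    "?s * v$2 = (a$1 * v$1 + a$2 * v$2) * a$2 + a$1 * cross a v"
    by (simp_all add: cross_def power2_eq_square algebra_simps)
  then have "v = ((a$1 * v$1 + a$2 * v$2) / ?s) *\<^sub>R a"
    using s assms(1) by (simp add: vec_eq_iff forall_2 nonzero_eq_divide_eq mult.commute)
  then show thesis using that by blast
qed

lemma bottom_sides_half_open:
  assumes "convex_quad b d l" "0 < t" "t < 1"
  shows "t *\<^sub>R b \<in> half_open_quad b d l" "t *\<^sub>R l \<in> half_open_quad b d l"
proof -
  have pos: "cross b d > 0" "cross d l > 0" "cross b l > 0" "cross (d - b) (l - d) > 0"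
    using assms(1) by (auto simp: convex_quad_def)
  have "b \<noteq> 0" "l \<noteq> 0" using pos by (auto simp: cross_simps)
  moreover have "cross (d - b) (t *\<^sub>R b - b) = (1 - t) * cross b d"
    "cross (l - d) (t *\<^sub>R b - d) = (1 - t) * cross d l + t * cross (d - b) (l - d)"
    "cross (d - b) (t *\<^sub>R l - b) = (1 - t) * cross b d + t * cross (d - b) (l - d)"
    "cross (l - d) (t *\<^sub>R l - d) = (1 - t) * cross d l"
    "cross b (t *\<^sub>R b) = 0" "cross (t *\<^sub>R b) l = t * cross b l" "cross b (t *\<^sub>R l) = t * cross b l"
    "cross (t *\<^sub>R l) l = 0"
    by (simp_all add: cross_def algebra_simps)
  ultimately show "t *\<^sub>R b \<in> half_open_quad b d l" "t *\<^sub>R l \<in> half_open_quad b d l"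
    using pos assms(2,3) by (simp_all add: half_open_quad_def add_pos_pos)
qed

lemma closed_quad_cases:
  assumes q: "convex_quad b d l" and z: "z \<in> closed_quad b d l"
  obtains "z \<in> half_open_quad b d l" | "z = 0"
    | t where "0 \<le> t" "t \<le> 1" "z = b + t *\<^sub>R (d - b)" | t where "0 \<le> t" "t \<le> 1" "z = l + t *\<^sub>R (d - l)"
proof -
  have pos: "cross b d > 0" "cross d l > 0" "cross b l > 0" "cross (d - b) (l - d) > 0"
    using q by (auto simp: convex_quad_def)
  have "z \<in> half_open_quad b d l \<or> z = 0 \<or> cross (d - b) (z - b) = 0 \<or> cross (l - d) (z - d) = 0"
    using z by (auto simp: half_open_quad_def closed_quad_def)
  then consider "z \<in> half_open_quad b d l" | "z = 0" | "cross (d - b) (z - b) = 0" | "cross (l - d) (z - d) = 0"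
    by blast
  then show thesis
  proof cases
    case 3
    have "d - b \<noteq> 0" using pos by (auto simp: cross_simps)
    then obtain t where t: "z - b = t *\<^sub>R (d - b)" using 3 cross_0_collinear by metis
    then have zt: "z = b + t *\<^sub>R (d - b)" by (simp add: algebra_simps)
    have "cross b z = t * cross b d" "cross (l - d) (z - d) = (1 - t) * cross (d - b) (l - d)"
      unfolding zt by (simp_all add: cross_def algebra_simps)
    then have "0 \<le> t" "t \<le> 1"
      using z pos by (auto simp: closed_quad_def zero_le_mult_iff)
    then show thesis using that(3) zt by blast
  next
    case 4
    have "l - d \<noteq> 0" using pos by (auto simp: cross_simps)
    then obtain t where t: "z - d = t *\<^sub>R (l - d)" using 4 cross_0_collinear by metis
    then have zt: "z = l + (1 - t) *\<^sub>R (d - l)" by (simp add: algebra_simps)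
    have "cross z l = (1 - t) * cross d l" "cross (d - b) (z - b) = t * cross (d - b) (l - d)"
      unfolding zt by (simp_all add: cross_def algebra_simps)
    then have "0 \<le> 1 - t" "1 - t \<le> 1"
      using z pos by (auto simp: closed_quad_def zero_le_mult_iff)
    then show thesis using that(4) zt by blast
  qed (use that in auto)
qed

lemma glued_vertices:
  assumes "glued_quads pl pr q" "i \<in> {1..3}" "z \<in> {0, br (q i), dg (q i), bl (q i)}"
  shows "emb (q i) z = sing"
proof -
  note D = glued_quadsD[OF assms(1)]
  have bl: "emb (q j) (bl (q j)) = sing" if j: "j \<in> {1..3}" for j
    using D(6)[OF j, of 0] D(3)[OF D(8)[OF j]] by simp
  have br: "emb (q j) (br (q j)) = sing" if j: "j \<in> {1..3}" for j
    using D(7)[OF j, of 0] D(3)[OF D(9)[OF j]] by simp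
  have "emb (q i) (dg (q i)) = sing"
    using D(6)[OF assms(2), of 1] D(4)[OF assms(2)] br[OF D(8)[OF assms(2)]] by simp
  then show ?thesis using assms(3) bl br D(3) assms(2) by auto
qed

text \<open>A point of a closed cell outside its core that is not a vertex lies inside a top side.
  The gluing carries it to a bottom side of a neighbour, where it does belong to the core.\<close>

lemma region_cases:
  assumes g: "glued_quads pl pr q" and i: "i \<in> {1..3}" and z: "z \<in> region (q i)"
  obtains "z \<in> core (q i)" | "z \<in> {0, br (q i), dg (q i), bl (q i)}"
    | t where "0 < t" "t < 1" "z = br (q i) + t *\<^sub>R bl (q (pr i))" "t *\<^sub>R bl (q (pr i)) \<in> core (q (pr i))"
    | t where "0 < t" "t < 1" "z = bl (q i) + t *\<^sub>R br (q (pl i))" "t *\<^sub>R br (q (pl i)) \<in> core (q (pl i))"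
proof -
  note D = glued_quadsD[OF g]
  have q: "convex_quad (br (q j)) (dg (q j)) (bl (q j))" if "j \<in> {1..3}" for j
    using D(1)[OF that] by (simp add: convex_cell_def)
  have "z \<in> closed_quad (br (q i)) (dg (q i)) (bl (q i))"
    using z region_cell[OF D(1)[OF i]] by simp
  with q[OF i] show thesis
  proof (cases rule: closed_quad_cases)
    case 1
    then show thesis using that(1) by (simp add: core_def)
  next
    case 2
    then show thesis using that(2) by simp
  next
    case (3 t)
    have e: "dg (q i) - br (q i) = bl (q (pr i))" using D(5)[OF i] by simp
    show thesis
    proof (cases "t = 0 \<or> t = 1")
      case True
      then show thesis using that(2) 3 by auto
    next
      case False
      then show thesis
        using that(3)[of t] 3 e bottom_sides_half_open(2)[OF q[OF D(9)[OF i]], of t] by (simp add: core_def)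
    qed
  next
    case (4 t)
    have e: "dg (q i) - bl (q i) = br (q (pl i))" using D(4)[OF i] by simp
    show thesis
    proof (cases "t = 0 \<or> t = 1")
      case True
      then show thesis using that(2) 4 by auto
    next
      case False
      then show thesis
        using that(4)[of t] 4 e bottom_sides_half_open(1)[OF q[OF D(8)[OF i]], of t] by (simp add: core_def)
    qed
  qed
qed

lemma region_sing_iff:
  assumes g: "glued_quads pl pr q" and i: "i \<in> {1..3}" and z: "z \<in> region (q i)"
  shows "emb (q i) z = sing \<longleftrightarrow> z \<in> {0, br (q i), dg (q i), bl (q i)}"
proof
  assume s: "emb (q i) z = sing"
  note D = glued_quadsD[OF g]
  from g i z show "z \<in> {0, br (q i), dg (q i), bl (q i)}"
  proof (cases rule: region_cases)
    case 1
    then show ?thesis using core_nonsing[OF g i] s by simp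
  next
    case (3 t)
    then show ?thesis using D(7)[OF i, of t] core_nonsing[OF g D(9)[OF i]] s by simp
  next
    case (4 t)
    then show ?thesis using D(6)[OF i, of t] core_nonsing[OF g D(8)[OF i]] s by simp
  qed simp
qed (rule glued_vertices[OF g i])

text \<open>In glued quadrilaterals every top side is a translate of a base side of a neighbour, so
  these conditions on the base sides give admissibility.\<close>

definition straddles :: "real \<Rightarrow> (nat \<Rightarrow> quad) \<Rightarrow> bool" where
  "straddles \<theta> q \<longleftrightarrow> (\<forall>i\<in>{1..3}. left_of \<theta> (bl (q i)) \<and> right_of \<theta> (br (q i)))"

lemma glued_labelled:
  assumes g: "glued_quads pl pr q" and s: "straddles \<theta> q"
  shows "labelled_quadrangulation \<theta> q"
  unfolding labelled_quadrangulation_def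
proof (intro conjI ballI)
  note D = glued_quadsD[OF g]
  fix i assume i: "i \<in> {1..3::nat}"
  have q: "convex_quad (br (q i)) (dg (q i)) (bl (q i))" using D(1)[OF i] by (simp add: convex_cell_def)
  have "inj_on (emb (q i)) (interior (region (q i)))"
    using core_inj(2)[OF g i i] interior_subset_core[OF D(1)[OF i]] by (auto simp: inj_on_def)
  then have "embedded_quad (q i)"
    using q D(2)[OF i] region_sing_iff[OF g i]
    by (auto simp: embedded_quad_def det_vector_cross convex_quad_def)
  moreover have "dg (q i) - bl (q i) = br (q (pl i))"
    unfolding D(4)[OF i] by simp
  moreover have "dg (q i) - br (q i) = bl (q (pr i))"
    unfolding D(5)[OF i] by simp
  ultimately show "admissible \<theta> (q i)"
    using s i D(8,9)[OF i] by (auto simp: admissible_def straddles_def simp del: atLeastAtMost_iff)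
next
  show "disjoint_family_on (\<lambda>i. open_cell (q i)) {1..3}"
    unfolding disjoint_family_on_def
  proof (intro ballI impI)
    fix i j assume ij: "i \<in> {1..3::nat}" "j \<in> {1..3::nat}" "i \<noteq> j"
    show "open_cell (q i) \<inter> open_cell (q j) = {}"
      using core_inj(1)[OF g ij(1,2)] ij(3) interior_subset_core[OF glued_quadsD(1)[OF g ij(1)]]
        interior_subset_core[OF glued_quadsD(1)[OF g ij(2)]]
      by (fastforce simp: open_cell_def)
  qed
next
  show "(\<Union>i\<in>{1..3}. closed_cell (q i)) = UNIV"
  proof (intro equalityI subsetI UNIV_I)
    fix x
    show "x \<in> (\<Union>i\<in>{1..3}. closed_cell (q i))"
    proof (cases "x = sing")
      case True
      have "0 \<in> region (q 1)" unfolding region_def by (auto intro: hull_inc)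
      then show ?thesis
        using True glued_quadsD(3)[OF g, of 1] by (force simp: closed_cell_def intro!: bexI[of _ "1::nat"])
    next
      case False
      then obtain i z where "i \<in> {1..3}" "z \<in> core (q i)" "emb (q i) z = x"
        by (rule core_surj[OF g])
      then show ?thesis
        using core_subset_region[OF glued_quadsD(1)[OF g]] by (force simp: closed_cell_def)
    qed
  qed
qed

section \<open>Images of quadrilaterals under affine automorphisms\<close>

text \<open>A reflection reverses the cyclic order of the vertices; exchanging the left and right
  sides restores the counterclockwise order.\<close>

definition push :: "real^2^2 \<Rightarrow> real^2^2 \<Rightarrow> (octsurf \<Rightarrow> octsurf) \<Rightarrow> quad \<Rightarrow> quad" where
  "push A B f q = \<lparr>bl = A *v (if det A > 0 then bl q else br q), br = A *v (if det A > 0 then br q else bl q),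
     dg = A *v dg q, emb = (\<lambda>z. f (emb q (B *v z)))\<rparr>"

lemma cross_matrix: "cross (A *v a) (A *v b) = det A * cross a b"
  by (simp add: cross_def det_2 matrix_vector_mult_def sum_2 algebra_simps)

lemma surf_autD:
  assumes "surf_aut A B f g"
  shows "A *v (B *v z) = z" "B *v (A *v z) = z" "f (g x) = x" "g (f x) = x" "f sing = sing"
    "locally_affine A f" "det A \<noteq> 0"
proof -
  note * = assms[unfolded surf_aut_def]
  show "A *v (B *v z) = z" "B *v (A *v z) = z" using * by (simp_all add: matrix_vector_mul_assoc)
  show "f (g x) = x" "g (f x) = x" using * by (metis comp_apply id_apply)+
  have "det A * det B = 1" using * by (metis det_I det_mul)
  then show "det A \<noteq> 0" by auto
qed (use assms in \<open>auto simp: surf_aut_def\<close>)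

lemma linear_image_mem:
  assumes "surf_aut A B f g"
  shows "z \<in> (\<lambda>z. A *v z) ` S \<longleftrightarrow> B *v z \<in> S"
proof
  assume "z \<in> (\<lambda>z. A *v z) ` S"
  then show "B *v z \<in> S" using surf_autD(2)[OF assms] by auto
next
  assume "B *v z \<in> S"
  then show "z \<in> (\<lambda>z. A *v z) ` S" by (intro image_eqI[of _ _ "B *v z"]) (simp_all add: surf_autD(1)[OF assms])
qed

lemma region_push:
  assumes "surf_aut A B f g"
  shows "region (push A B f q) = (\<lambda>z. A *v z) ` region q"
proof -
  have lin: "linear (\<lambda>z. A *v z)" by (rule matrix_vector_mul_linear)
  have h: "convex hull {0, A *v a, A *v b} = (\<lambda>z. A *v z) ` (convex hull {0, a, b})" for a b
    using convex_hull_linear_image[OF lin, of "{0, a, b}"] by simp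
  show ?thesis
    by (simp add: region_def push_def h image_Un) (metis Un_commute insert_commute)
qed

lemma interior_push:
  assumes "surf_aut A B f g"
  shows "interior (region (push A B f q)) = (\<lambda>z. A *v z) ` interior (region q)"
proof -
  have "inj (\<lambda>z. A *v z)" using surf_autD(2)[OF assms] by (metis injI)
  then show ?thesis
    unfolding region_push[OF assms] by (intro interior_injective_linear_image matrix_vector_mul_linear)
qed

lemma push_images:
  assumes "surf_aut A B f g"
  shows "emb (push A B f q) ` ((\<lambda>z. A *v z) ` S) = f ` (emb q ` S)"
  using surf_autD(2)[OF assms] by (simp add: push_def image_image)

lemma push_segment:
  assumes "surf_aut A B f g"
  shows "emb (push A B f q) ` closed_segment (A *v a) (A *v b) = f ` (emb q ` closed_segment a b)"
  using push_images[OF assms, of q "closed_segment a b"] closed_segment_linear_image[OF matrix_vector_mul_linear, of A a b]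
  by simp

lemma open_cell_push:
  assumes "surf_aut A B f g"
  shows "open_cell (push A B f q) = f ` open_cell q"
  unfolding open_cell_def interior_push[OF assms] by (rule push_images[OF assms])

lemma closed_cell_push:
  assumes "surf_aut A B f g"
  shows "closed_cell (push A B f q) = f ` closed_cell q"
  unfolding closed_cell_def region_push[OF assms] by (rule push_images[OF assms])

lemma sides_push:
  assumes "surf_aut A B f g"
  shows "bottom_left (push A B f q) = f ` (if det A > 0 then bottom_left q else bottom_right q)"
    "bottom_right (push A B f q) = f ` (if det A > 0 then bottom_right q else bottom_left q)"
    "top_left (push A B f q) = f ` (if det A > 0 then top_left q else top_right q)"
    "top_right (push A B f q) = f ` (if det A > 0 then top_right q else top_left q)"
    "diagonal (push A B f q) = f ` diagonal q"
  using push_segment[OF assms, of q] push_segment[OF assms, of q 0]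
  unfolding bottom_left_def bottom_right_def top_left_def top_right_def diagonal_def
  by (auto simp: push_def)

lemma cells_push:
  assumes "surf_aut A B f g"
  shows "cells (\<lambda>i. push A B f (q i)) = act A (cells q)"
  unfolding cells_def act_def aut_of_eq[OF assms] open_cell_push[OF assms] by (simp add: image_image)

lemma translation_on_push:
  assumes "surf_aut A B f g" "translation_on (region q) (emb q)"
  shows "translation_on (region (push A B f q)) (emb (push A B f q))"
proof -
  have "translation_on ((\<lambda>z. A *v z) ` region q) (\<lambda>w. f (emb q (B *v w)))"
    using assms by (intro translation_on_locally_affine) (auto simp: surf_aut_def)
  then show ?thesis unfolding region_push[OF assms(1)] by (simp add: push_def)
qed

lemma side_push:
  assumes "surf_aut A B f g" "A *v dir \<theta>' = r *\<^sub>R dir \<theta>" "r > 0"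
  shows "left_of \<theta> (A *v v) \<longleftrightarrow> (if det A > 0 then left_of \<theta>' v else right_of \<theta>' v)"
    "right_of \<theta> (A *v v) \<longleftrightarrow> (if det A > 0 then right_of \<theta>' v else left_of \<theta>' v)"
proof -
  have "r * cross (dir \<theta>) (A *v v) = det A * cross (dir \<theta>') v"
    using cross_matrix[of A "dir \<theta>'" v] by (simp add: assms(2) cross_simps)
  moreover have "0 < x \<longleftrightarrow> 0 < r * x" "x < 0 \<longleftrightarrow> r * x < 0" for x
    using assms(3) by (simp_all add: zero_less_mult_iff mult_less_0_iff)
  ultimately have "cross (dir \<theta>) (A *v v) > 0 \<longleftrightarrow> det A * cross (dir \<theta>') v > 0"
    "cross (dir \<theta>) (A *v v) < 0 \<longleftrightarrow> det A * cross (dir \<theta>') v < 0"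
    by metis+
  then show "left_of \<theta> (A *v v) \<longleftrightarrow> (if det A > 0 then left_of \<theta>' v else right_of \<theta>' v)"
    "right_of \<theta> (A *v v) \<longleftrightarrow> (if det A > 0 then right_of \<theta>' v else left_of \<theta>' v)"
    using surf_autD(7)[OF assms(1)]
    by (auto simp: left_of_iff right_of_iff zero_less_mult_iff mult_less_0_iff)
qed

lemma labelled_push:
  assumes a: "surf_aut A B f g" and dir: "A *v dir \<theta>' = r *\<^sub>R dir \<theta>" "r > 0"
    and q: "labelled_quadrangulation \<theta>' q"
  shows "labelled_quadrangulation \<theta> (\<lambda>i. push A B f (q i))"
proof -
  note D = surf_autD[OF a]
  have inj: "inj f" using D(4) by (metis injI)
  have adm: "admissible \<theta> (push A B f (q i))" if "i \<in> {1..3}" for i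
  proof -
    have *: "admissible \<theta>' (q i)" using q that by (auto simp: labelled_quadrangulation_def)
    have e: "embedded_quad (q i)" using * by (simp add: admissible_def)
    have "inj_on (emb (push A B f (q i))) (interior (region (push A B f (q i))))"
      unfolding interior_push[OF a] using e D(2) inj_eq[OF inj]
      by (auto simp: embedded_quad_def inj_on_def push_def)
    moreover have "emb (push A B f (q i)) z = sing \<longleftrightarrow>
        z \<in> {0, br (push A B f (q i)), dg (push A B f (q i)), bl (push A B f (q i))}"
      if z: "z \<in> region (push A B f (q i))" for z
    proof -
      have "f x = sing \<longleftrightarrow> x = sing" for x using D(5) inj_eq[OF inj] by metis
      moreover have "B *v z = v \<longleftrightarrow> z = A *v v" for v using D(1,2) by metis
      moreover have "B *v z \<in> region (q i)" using z linear_image_mem[OF a] by (simp add: region_push[OF a])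
      ultimately show ?thesis using e by (auto simp: embedded_quad_def push_def)
    qed
    moreover have "det (vector [br (push A B f (q i)), dg (push A B f (q i))] :: real^2^2) > 0"
      "det (vector [dg (push A B f (q i)), bl (push A B f (q i))] :: real^2^2) > 0"
      using e D(7) cross_swap[of "dg (q i)" "br (q i)"] cross_swap[of "bl (q i)" "dg (q i)"]
      by (auto simp: embedded_quad_def det_vector_cross push_def cross_matrix zero_less_mult_iff mult_less_0_iff)
    ultimately have "embedded_quad (push A B f (q i))"
      using e translation_on_push[OF a, of "q i"] by (simp add: embedded_quad_def)
    moreover have "A *v v - A *v w = A *v (v - w)" for v w by (simp add: matrix_vector_mult_diff_distrib)
    ultimately show ?thesis
      using * by (auto simp: admissible_def push_def side_push[OF a dir])
  qed
  have "disjoint_family_on (\<lambda>i. open_cell (push A B f (q i))) {1..3}"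
    using q inj unfolding labelled_quadrangulation_def disjoint_family_on_def open_cell_push[OF a]
    by (simp add: image_Int[symmetric])
  moreover have "(\<Union>i\<in>{1..3}. closed_cell (push A B f (q i))) = UNIV"
  proof -
    have "(\<Union>i\<in>{1..3}. closed_cell (push A B f (q i))) = f ` (\<Union>i\<in>{1..3}. closed_cell (q i))"
      unfolding closed_cell_push[OF a] by auto
    also have "\<dots> = UNIV" using q D(3) by (simp add: labelled_quadrangulation_def) (metis surjI)
    finally show ?thesis .
  qed
  ultimately show ?thesis using adm by (simp add: labelled_quadrangulation_def)
qed

text \<open>For negative determinant the left and right permutations change places, as do left and
  right of the direction, so a right staircase move becomes a left one.\<close>

lemma diagonal_change_push:
  assumes a: "surf_aut A B f g" and dir: "A *v dir \<theta>' = r *\<^sub>R dir \<theta>" "r > 0"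
    and d: "diagonal_change \<theta>' Q Q'"
  shows "diagonal_change \<theta> (act A Q) (act A Q')"
proof -
  let ?P = "push A B f"
  obtain q q' c where *: "labelled_quadrangulation \<theta>' q" "Q = cells q" "labelled_quadrangulation \<theta>' q'" "Q' = cells q'"
    "right_staircase_move \<theta>' q c q' \<or> left_staircase_move \<theta>' q c q'"
    using d unfolding diagonal_change_def by blast
  have "right_staircase_move \<theta> (\<lambda>i. ?P (q i)) c (\<lambda>i. ?P (q' i)) \<or>
      left_staircase_move \<theta> (\<lambda>i. ?P (q i)) c (\<lambda>i. ?P (q' i))"
  proof (cases "det A > 0")
    case True
    have "perm_right (\<lambda>i. ?P (q i)) \<pi>" if "perm_right q \<pi>" for \<pi>
      using that True by (simp add: perm_right_def sides_push[OF a])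
    moreover have "perm_left (\<lambda>i. ?P (q i)) \<pi>" if "perm_left q \<pi>" for \<pi>
      using that True by (simp add: perm_left_def sides_push[OF a])
    moreover have "dg (?P x) = A *v dg x" for x by (simp add: push_def)
    moreover have "wedge (?P x) = (f ` fst (wedge x), f ` snd (wedge x))" for x
      using True by (simp add: wedge_def sides_push[OF a])
    ultimately show ?thesis
      using *(5) True unfolding right_staircase_move_def left_staircase_move_def
      by (auto simp: side_push[OF a dir] sides_push[OF a])
  next
    case False
    have "perm_left (\<lambda>i. ?P (q i)) \<pi>" if "perm_right q \<pi>" for \<pi>
      using that False by (simp add: perm_left_def perm_right_def sides_push[OF a])
    moreover have "perm_right (\<lambda>i. ?P (q i)) \<pi>" if "perm_left q \<pi>" for \<pi>
      using that False by (simp add: perm_left_def perm_right_def sides_push[OF a])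
    moreover have "dg (?P x) = A *v dg x" for x by (simp add: push_def)
    moreover have "wedge (?P x) = (f ` snd (wedge x), f ` fst (wedge x))" for x
      using False by (simp add: wedge_def sides_push[OF a])
    ultimately show ?thesis
      using *(5) False unfolding right_staircase_move_def left_staircase_move_def
      by (auto simp: side_push[OF a dir] sides_push[OF a])
  qed
  then show ?thesis
    unfolding diagonal_change_def *(2,4) cells_push[OF a, symmetric]
    using labelled_push[OF a dir *(1)] labelled_push[OF a dir *(3)] by blast
qed

lemma core_push:
  assumes a: "surf_aut A B f g"
  shows "core (push A B f q) = (\<lambda>z. A *v z) ` core q"
proof (rule set_eqI)
  fix z
  obtain y where z: "z = A *v y" using surf_autD(1)[OF a] by metis
  have m: "A *v v - A *v w = A *v (v - w)" for v w by (simp add: matrix_vector_mult_diff_distrib)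
  have ne: "A *v y = 0 \<longleftrightarrow> y = 0" using surf_autD(2)[OF a] by (metis matrix_vector_mult_0_right)
  have s: "cross (dg q - bl q) (y - bl q) = - cross (bl q - dg q) (y - dg q)"
    "cross (br q - dg q) (y - dg q) = - cross (dg q - br q) (y - br q)"
    "cross (bl q) y = - cross y (bl q)" "cross y (br q) = - cross (br q) y"
    by (simp_all add: cross_def algebra_simps)
  have "A *v y \<in> core (push A B f q) \<longleftrightarrow> y \<in> core q"
  proof (cases "det A > 0")
    case True
    then show ?thesis
      by (simp add: core_def half_open_quad_def push_def m cross_matrix ne zero_less_mult_iff zero_le_mult_iff)
  next
    case False
    then have "det A < 0" using surf_autD(7)[OF a] by simp
    then have "0 \<le> det A * x \<longleftrightarrow> x \<le> 0" "0 < det A * x \<longleftrightarrow> x < 0"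
      "det A * x \<le> 0 \<longleftrightarrow> 0 \<le> x" "det A * x < 0 \<longleftrightarrow> 0 < x" for x
      by (auto simp: zero_le_mult_iff zero_less_mult_iff mult_le_0_iff mult_less_0_iff)
    then show ?thesis
      using False by (auto simp: core_def half_open_quad_def push_def m cross_matrix ne s)
  qed
  then show "z \<in> core (push A B f q) \<longleftrightarrow> z \<in> (\<lambda>z. A *v z) ` core q"
    unfolding z linear_image_mem[OF a] surf_autD(2)[OF a] .
qed

lemma convex_cell_push:
  assumes "surf_aut A B f g" "convex_cell q"
  shows "convex_cell (push A B f q)"
proof -
  have m: "A *v v - A *v w = A *v (v - w)" for v w by (simp add: matrix_vector_mult_diff_distrib)
  have s: "cross (dg q - bl q) (br q - dg q) = - cross (dg q - br q) (bl q - dg q)"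
    "cross (bl q) (br q) = - cross (br q) (bl q)" "cross (bl q) (dg q) = - cross (dg q) (bl q)"
    "cross (dg q) (br q) = - cross (br q) (dg q)"
    by (simp_all add: cross_def algebra_simps)
  show ?thesis
    using assms(2) surf_autD(7)[OF assms(1)]
    by (auto simp: convex_cell_def convex_quad_def push_def m cross_matrix zero_less_mult_iff s)
qed

lemma glued_push:
  assumes a: "surf_aut A B f g" and g: "glued_quads pl pr q"
  shows "glued_quads (if det A > 0 then pl else pr) (if det A > 0 then pr else pl) (\<lambda>i. push A B f (q i))"
proof -
  note D = surf_autD[OF a]
  let ?q = "\<lambda>i. push A B f (q i)"
  have inj: "inj f" using D(4) by (metis injI)
  have "bij_betw (\<lambda>(i, z). (i, B *v z)) (SIGMA i:{1..3::nat}. core (?q i)) (SIGMA i:{1..3}. core (q i))"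
    unfolding core_push[OF a]
    by (rule bij_betw_byWitness[where f' = "\<lambda>(i, z). (i, A *v z)"]) (auto simp: D(1,2))
  from bij_betw_trans[OF this glued_quads_bij[OF g]]
  have "bij_betw ((\<lambda>(i, z). emb (q i) z) \<circ> (\<lambda>(i, z). (i, B *v z))) (SIGMA i:{1..3::nat}. core (?q i)) (UNIV - {sing})" .
  moreover have "bij_betw f (UNIV - {sing}) (UNIV - {sing})"
  proof -
    have "f x = sing \<longleftrightarrow> x = sing" "g x = sing \<longleftrightarrow> x = sing" for x
      using D(3)[of x] D(4)[of x] D(4)[of sing] D(5) by auto
    then show ?thesis by (intro bij_betw_byWitness[where f' = g]) (auto simp: D(3,4))
  qed
  ultimately have "bij_betw (f \<circ> ((\<lambda>(i, z). emb (q i) z) \<circ> (\<lambda>(i, z). (i, B *v z)))) (SIGMA i:{1..3::nat}. core (?q i)) (UNIV - {sing})"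
    by (rule bij_betw_trans)
  moreover have "f \<circ> ((\<lambda>(i, z). emb (q i) z) \<circ> (\<lambda>(i, z). (i, B *v z))) = (\<lambda>(i, z). emb (?q i) z)"
    by (auto simp: push_def)
  ultimately have bij: "bij_betw (\<lambda>(i, z). emb (?q i) z) (SIGMA i:{1..3::nat}. core (?q i)) (UNIV - {sing})"
    by simp
  define pl' pr' where "pl' = (if det A > 0 then pl else pr)" and "pr' = (if det A > 0 then pr else pl)"
  have p: "pl' permutes {1..3}" "pr' permutes {1..3}" using g by (simp_all add: glued_quads_def pl'_def pr'_def)
  have BA: "B *v (A *v v + t *\<^sub>R (A *v w)) = v + t *\<^sub>R w" "B *v (t *\<^sub>R (A *v w)) = t *\<^sub>R w" for v w t
    by (simp_all add: matrix_vector_right_distrib matrix_vector_mult_scaleR D(2))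
  have 1: "convex_cell (?q i) \<and> translation_on (region (?q i)) (emb (?q i)) \<and> emb (?q i) 0 = sing"
    if i: "i \<in> {1..3}" for i
    using convex_cell_push[OF a glued_quadsD(1)[OF g i]] translation_on_push[OF a glued_quadsD(2)[OF g i]]
      glued_quadsD(3)[OF g i] D(5) by (simp add: push_def)
  have 2: "dg (?q i) = bl (?q i) + br (?q (pl' i)) \<and> dg (?q i) = br (?q i) + bl (?q (pr' i))" if i: "i \<in> {1..3}" for i
    using glued_quadsD(4,5)[OF g i] by (auto simp: push_def pl'_def pr'_def matrix_vector_right_distrib[symmetric])
  have 3: "emb (?q i) (bl (?q i) + t *\<^sub>R br (?q (pl' i))) = emb (?q (pl' i)) (t *\<^sub>R br (?q (pl' i)))"
      "emb (?q i) (br (?q i) + t *\<^sub>R bl (?q (pr' i))) = emb (?q (pr' i)) (t *\<^sub>R bl (?q (pr' i)))"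
    if i: "i \<in> {1..3}" and t: "0 \<le> t" "t \<le> 1" for i t
    using glued_quadsD(6,7)[OF g i t] by (auto simp: push_def pl'_def pr'_def BA)
  have "glued_quads pl' pr' ?q"
    unfolding glued_quads_def using bij p 1 2 3 by blast
  then show ?thesis by (simp add: pl'_def pr'_def)
qed

lemma straddles_push:
  assumes "surf_aut A B f g" "A *v dir \<theta>' = r *\<^sub>R dir \<theta>" "r > 0" "straddles \<theta>' q"
  shows "straddles \<theta> (\<lambda>i. push A B f (q i))"
  using assms(4) by (auto simp: straddles_def push_def side_push[OF assms(1-3)])

section \<open>Staircase moves\<close>

lemma translation_on_subset:
  assumes "translation_on S \<phi>" "T \<subseteq> S"
  shows "translation_on T \<phi>"
  unfolding translation_on_def
proof
  fix z assume "z \<in> T"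
  then obtain e where "e > 0" "\<forall>w\<in>S \<inter> ball z e.
      \<exists>p\<in>octagon. p + (w - z) \<in> octagon \<and> proj p = \<phi> z \<and> proj (p + (w - z)) = \<phi> w"
    using assms unfolding translation_on_def by (metis subsetD)
  then show "\<exists>e>0. \<forall>w\<in>T \<inter> ball z e.
      \<exists>p\<in>octagon. p + (w - z) \<in> octagon \<and> proj p = \<phi> z \<and> proj (p + (w - z)) = \<phi> w"
    using assms(2) by (intro exI[of _ e]) auto
qed

lemma translation_on_cong:
  assumes "translation_on S \<phi>" "\<And>z. z \<in> S \<Longrightarrow> \<psi> z = \<phi> z"
  shows "translation_on S \<psi>"
  unfolding translation_on_def
proof
  fix z assume z: "z \<in> S"
  then obtain e where e: "e > 0" "\<And>w. w \<in> S \<inter> ball z e \<Longrightarrow>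
      \<exists>p\<in>octagon. p + (w - z) \<in> octagon \<and> proj p = \<phi> z \<and> proj (p + (w - z)) = \<phi> w"
    using assms(1) unfolding translation_on_def by meson
  have "\<exists>p\<in>octagon. p + (w - z) \<in> octagon \<and> proj p = \<psi> z \<and> proj (p + (w - z)) = \<psi> w"
    if "w \<in> S \<inter> ball z e" for w
    using e(2)[OF that] assms(2)[OF z] assms(2)[of w] that by simp
  then show "\<exists>e>0. \<forall>w\<in>S \<inter> ball z e. \<exists>p\<in>octagon. p + (w - z) \<in> octagon \<and> proj p = \<psi> z \<and> proj (p + (w - z)) = \<psi> w"
    using e(1) by blast
qed

text \<open>In \<open>translation_on\<close> the representative may depend on \<open>w\<close>, so
  the two pieces can be treated separately, with the smaller radius. A point outside one of the
  closed sets has a neighbourhood missing it.\<close>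

lemma translation_on_Un:
  assumes "translation_on S \<phi>" "translation_on T \<phi>" "closed S" "closed T"
  shows "translation_on (S \<union> T) \<phi>"
  unfolding translation_on_def
proof
  fix z
  have *: "\<exists>e>0. \<forall>w\<in>S \<inter> ball z e. \<exists>p\<in>octagon. p + (w - z) \<in> octagon \<and> proj p = \<phi> z \<and> proj (p + (w - z)) = \<phi> w"
    if S: "translation_on S \<phi>" "closed S" for S
  proof (cases "z \<in> S")
    case True
    then show ?thesis using S unfolding translation_on_def by blast
  next
    case False
    then obtain e where "e > 0" "ball z e \<subseteq> - S"
      using S(2) by (metis ComplI open_contains_ball closed_def)
    then show ?thesis by (intro exI[of _ e]) blast
  qed
  obtain e1 e2 where "e1 > 0" "e2 > 0"
    "\<forall>w\<in>S \<inter> ball z e1. \<exists>p\<in>octagon. p + (w - z) \<in> octagon \<and> proj p = \<phi> z \<and> proj (p + (w - z)) = \<phi> w"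
    "\<forall>w\<in>T \<inter> ball z e2. \<exists>p\<in>octagon. p + (w - z) \<in> octagon \<and> proj p = \<phi> z \<and> proj (p + (w - z)) = \<phi> w"
    using *[OF assms(1,3)] *[OF assms(2,4)] by blast
  then show "\<exists>e>0. \<forall>w\<in>(S \<union> T) \<inter> ball z e. \<exists>p\<in>octagon. p + (w - z) \<in> octagon \<and> proj p = \<phi> z \<and> proj (p + (w - z)) = \<phi> w"
    by (intro exI[of _ "min e1 e2"]) auto
qed

lemma translation_on_shift:
  assumes "translation_on S \<phi>"
  shows "translation_on ((\<lambda>z. b + z) ` S) (\<lambda>z. \<phi> (z - b))"
  unfolding translation_on_def
proof
  fix z' assume "z' \<in> (\<lambda>z. b + z) ` S"
  then obtain z where z: "z \<in> S" "z' = b + z" by blast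
  then obtain e where e: "e > 0" "\<And>w. w \<in> S \<inter> ball z e \<Longrightarrow>
      \<exists>p\<in>octagon. p + (w - z) \<in> octagon \<and> proj p = \<phi> z \<and> proj (p + (w - z)) = \<phi> w"
    using assms(1) unfolding translation_on_def by meson
  show "\<exists>e>0. \<forall>w\<in>(\<lambda>z. b + z) ` S \<inter> ball z' e. \<exists>p\<in>octagon. p + (w - z') \<in> octagon \<and>
      proj p = \<phi> (z' - b) \<and> proj (p + (w - z')) = \<phi> (w - b)"
  proof (intro exI[of _ e] conjI ballI e(1))
    fix w' assume "w' \<in> (\<lambda>z. b + z) ` S \<inter> ball z' e"
    then obtain w where w: "w \<in> S" "w' = b + w" "w' \<in> ball z' e" by blast
    have "w' - z' = w - z" "z' - b = z" "w' - b = w" using w z by simp_all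
    moreover have "w \<in> S \<inter> ball z e" using w z by (simp add: dist_norm)
    ultimately show "\<exists>p\<in>octagon. p + (w' - z') \<in> octagon \<and> proj p = \<phi> (z' - b) \<and> proj (p + (w' - z')) = \<phi> (w' - b)"
      using e(2) by simp
  qed
qed

lemma closed_closed_tri: "closed (closed_tri a b)"
  unfolding closed_tri_def cross_def by (intro closed_Collect_conj closed_Collect_le continuous_intros)

text \<open>The two diagonals of the new quadrilateral cross because all its sides are transversal to the
  direction \<open>u\<close>.\<close>

lemma flip_convex:
  assumes "cross u b < 0" "cross u l > 0" "cross u d > 0" "cross u (b + l) > 0" "cross u (d - l) < 0"
    "cross b (b + l) > 0" "cross d l > 0"
  shows "convex_quad b (b + d) (b + l)"
proof -
  \<comment> \<open>The three-term Pluecker relation for \<open>u\<close>, \<open>l\<close>,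
    \<open>b\<close>, \<open>d\<close>; it expresses the unknown sign through known ones. The second
    identity below is the same relation, expanded.\<close>
  have "cross u l * cross b d = - (cross u b * cross d l) + cross u d * cross b l"
    by (simp add: cross_def algebra_simps)
  moreover have "cross u b * cross d l < 0" "cross u d * cross b l > 0"
    using assms by (auto simp: mult_less_0_iff cross_simps)
  ultimately have "cross u l * cross b d > 0" by simp
  then have bd: "cross b d > 0" using assms(2) by (simp add: zero_less_mult_iff)
  have "cross u l * cross (b + d) (b + l) = - (cross u (d - l) * cross b l) + cross u (b + l) * cross d l"
    by (simp add: cross_def algebra_simps)
  moreover have "cross u (d - l) * cross b l < 0" "cross u (b + l) * cross d l > 0"
    using assms by (auto simp: mult_less_0_iff cross_simps)
  ultimately have "cross u l * cross (b + d) (b + l) > 0" by linarith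
  then have "cross (b + d) (b + l) > 0" using assms(2) by (simp add: zero_less_mult_iff)
  then show ?thesis
    using bd assms(6,7) by (simp add: convex_quad_def cross_simps)
qed

lemma tri_sides:
  assumes "cross a b > 0" "0 \<le> t" "t \<le> 1"
  shows "t *\<^sub>R a \<in> closed_tri a b" "t *\<^sub>R b \<in> closed_tri a b" "a + t *\<^sub>R (b - a) \<in> closed_tri a b"
    "b + t *\<^sub>R (a - b) \<in> closed_tri a b"
proof -
  have "cross (b - a) (t *\<^sub>R a - a) = (1 - t) * cross a b" "cross (b - a) (t *\<^sub>R b - a) = (1 - t) * cross a b"
    "cross a (a + t *\<^sub>R (b - a)) = t * cross a b" "cross (a + t *\<^sub>R (b - a)) b = (1 - t) * cross a b"
    "cross (b - a) (a + t *\<^sub>R (b - a) - a) = 0" 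
    "cross a (b + t *\<^sub>R (a - b)) = (1 - t) * cross a b" "cross (b + t *\<^sub>R (a - b)) b = t * cross a b"
    "cross (b - a) (b + t *\<^sub>R (a - b) - a) = 0"
    "cross a (t *\<^sub>R a) = 0" "cross (t *\<^sub>R a) b = t * cross a b" "cross a (t *\<^sub>R b) = t * cross a b"
    "cross (t *\<^sub>R b) b = 0"
    by (simp_all add: cross_def algebra_simps)
  then show "t *\<^sub>R a \<in> closed_tri a b" "t *\<^sub>R b \<in> closed_tri a b" "a + t *\<^sub>R (b - a) \<in> closed_tri a b"
    "b + t *\<^sub>R (a - b) \<in> closed_tri a b"
    using assms by (simp_all only: closed_tri_def mem_Collect_eq) simp_all
qed

lemma segment_0: "closed_segment 0 a = (\<lambda>t. t *\<^sub>R a) ` {0..1}" for a :: "real^2"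
  by (auto simp: closed_segment_def)

lemma segment_shift: "closed_segment a (a + b) = (\<lambda>t. a + t *\<^sub>R b) ` {0..1}" for a :: "real^2"
  by (auto simp: closed_segment_def image_iff algebra_simps)

lemma glued_perms:
  assumes g: "glued_quads pl pr q"
  shows "perm_left q pl" "perm_right q pr"
proof -
  note D = glued_quadsD[OF g]
  have "top_left (q i) = bottom_right (q (pl i))" if i: "i \<in> {1..3}" for i
    unfolding top_left_def bottom_right_def D(4)[OF i] segment_shift segment_0 image_image
    using D(6)[OF i] by (intro image_cong) auto
  then show "perm_left q pl" using g by (simp add: perm_left_def glued_quads_def)
  have "top_right (q i) = bottom_left (q (pr i))" if i: "i \<in> {1..3}" for i
    unfolding top_right_def bottom_left_def D(5)[OF i] segment_shift segment_0 image_image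
    using D(7)[OF i] by (intro image_cong) auto
  then show "perm_right q pr" using g by (simp add: perm_right_def glued_quads_def)
qed

text \<open>The new cell consists of the lower triangle of \<open>q i\<close> and the upper triangle
  of its right neighbour, pasted along the side they share; that side becomes the diagonal of the
  new cell from \<open>br\<close> to \<open>bl\<close>.\<close>

definition flip_quads :: "(nat \<Rightarrow> quad) \<Rightarrow> (nat \<Rightarrow> nat) \<Rightarrow> nat set \<Rightarrow> nat \<Rightarrow> quad" where
  "flip_quads q pr c i = (if i \<in> c then
     \<lparr>bl = dg (q i), br = br (q i), dg = br (q i) + dg (q (pr i)),
      emb = (\<lambda>z. if z \<in> closed_tri (br (q i)) (dg (q i)) then emb (q i) z
                 else emb (q (pr i)) (z - br (q i)))\<rparr>
     else q i)"

lemma flip_cell: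
  assumes g: "glued_quads pl pr q" and s: "straddles \<theta> q" and i: "i \<in> {1..3}" "i \<in> c"
    and left: "left_of \<theta> (dg (q i))" "left_of \<theta> (dg (q (pr i)))"
  shows "convex_cell (flip_quads q pr c i)"
    "\<And>z. z \<in> closed_tri (br (q i)) (dg (q i)) \<Longrightarrow> emb (flip_quads q pr c i) z = emb (q i) z"
    "\<And>y. y \<in> closed_tri (dg (q (pr i))) (bl (q (pr i))) \<Longrightarrow>
       emb (flip_quads q pr c i) (br (q i) + y) = emb (q (pr i)) y"
    "region (flip_quads q pr c i) = closed_tri (br (q i)) (dg (q i)) \<union>
       (\<lambda>z. br (q i) + z) ` closed_tri (dg (q (pr i))) (bl (q (pr i)))"
    "translation_on (region (flip_quads q pr c i)) (emb (flip_quads q pr c i))"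
    "core (flip_quads q pr c i) = lower_tri (br (q i)) (dg (q i)) \<union>
       (\<lambda>z. br (q i) + z) ` upper_tri (dg (q (pr i))) (bl (q (pr i)))"
    "lower_tri (br (q i)) (dg (q i)) \<inter> (\<lambda>z. br (q i) + z) ` upper_tri (dg (q (pr i))) (bl (q (pr i))) = {}"
proof -
  note D = glued_quadsD[OF g]
  define j where "j = pr i"
  have j: "j \<in> {1..3}" using D(9)[OF i(1)] by (simp add: j_def)
  let ?b = "br (q i)" and ?l = "bl (q j)" and ?d = "dg (q j)" and ?q = "flip_quads q pr c i"
  have dgi: "dg (q i) = ?b + ?l" using D(5)[OF i(1)] by (simp add: j_def)
  have ci: "convex_quad ?b (dg (q i)) (bl (q i))" and cj: "convex_quad (br (q j)) ?d ?l"
    using D(1) i(1) j by (simp_all add: convex_cell_def)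
  have sides: "bl ?q = ?b + ?l" "br ?q = ?b" "dg ?q = ?b + ?d"
    using i(2) dgi by (simp_all add: flip_quads_def j_def)
  have pj: "pl j \<in> {1..3}" using D(8)[OF j] .
  have "?d - ?l = br (q (pl j))" using D(4)[OF j] by simp
  then have "right_of \<theta> (?d - ?l)" using s pj by (simp add: straddles_def)
  then have conv: "convex_quad ?b (?b + ?d) (?b + ?l)"
    using s i(1) j left ci cj dgi
    by (intro flip_convex[of "dir \<theta>"]) (auto simp: straddles_def left_of_iff right_of_iff convex_quad_def j_def)
  then show "convex_cell ?q" by (simp add: convex_cell_def sides)
  show E1: "emb ?q z = emb (q i) z" if "z \<in> closed_tri ?b (dg (q i))" for z
    using that i(2) by (simp add: flip_quads_def)
  have E2: "emb ?q (?b + y) = emb (q j) y" if y: "y \<in> closed_tri ?d ?l" for y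
  proof (cases "?b + y \<in> closed_tri ?b (dg (q i))")
    case True
    \<comment> \<open>The two triangles overlap only in the common side, and there the two branches
      of \<open>emb\<close> agree because the old cells are glued along it.\<close>
    then have "cross ?l y \<ge> 0" by (simp add: closed_tri_def dgi)
    moreover have "cross ?l y \<le> 0" using y cross_swap[of ?l y] by (simp add: closed_tri_def)
    ultimately have 0: "cross ?l y = 0" by simp
    have dl: "cross ?d ?l > 0" using cj by (simp add: convex_quad_def)
    then have "?l \<noteq> 0" by (auto simp: cross_simps)
    then obtain t where t: "y = t *\<^sub>R ?l" using 0 cross_0_collinear by metis
    have "cross ?d y = t * cross ?d ?l" "cross (?l - ?d) (y - ?d) = (1 - t) * cross ?d ?l"
      unfolding t by (simp_all add: cross_def algebra_simps)
    then have "0 \<le> t" "t \<le> 1" using y dl by (auto simp: closed_tri_def zero_le_mult_iff)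
    then have "emb (q i) (?b + y) = emb (q j) y"
      using D(7)[OF i(1), of t] by (simp add: t j_def)
    then show ?thesis using E1[OF True] by simp
  next
    case False
    then show ?thesis using i(2) by (simp add: flip_quads_def j_def)
  qed
  then show "\<And>y. y \<in> closed_tri (dg (q (pr i))) (bl (q (pr i))) \<Longrightarrow> emb ?q (?b + y) = emb (q (pr i)) y"
    by (simp add: j_def)
  have reg: "region ?q = closed_tri ?b (dg (q i)) \<union> (\<lambda>z. ?b + z) ` closed_tri ?d ?l"
    using closed_quad_split'[OF conv] region_cell[OF \<open>convex_cell ?q\<close>] by (simp add: sides dgi)
  then show "region ?q = closed_tri ?b (dg (q i)) \<union> (\<lambda>z. ?b + z) ` closed_tri (dg (q (pr i))) (bl (q (pr i)))"
    by (simp add: j_def)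
  have sub: "closed_tri ?b (dg (q i)) \<subseteq> region (q i)" "closed_tri ?d ?l \<subseteq> region (q j)"
    using tri_subset_quad(1)[OF ci] tri_subset_quad(2)[OF cj] region_cell D(1) i(1) j by auto
  have "translation_on (closed_tri ?b (dg (q i))) (emb ?q)"
    using translation_on_subset[OF D(2)[OF i(1)] sub(1)] by (rule translation_on_cong) (rule E1)
  moreover have "translation_on ((\<lambda>z. ?b + z) ` closed_tri ?d ?l) (emb ?q)"
    using translation_on_shift[OF translation_on_subset[OF D(2)[OF j] sub(2)], of ?b]
    by (rule translation_on_cong) (auto simp: E2)
  ultimately show "translation_on (region ?q) (emb ?q)"
    unfolding reg by (intro translation_on_Un closed_translation closed_closed_tri)
  show "core ?q = lower_tri ?b (dg (q i)) \<union> (\<lambda>z. ?b + z) ` upper_tri (dg (q (pr i))) (bl (q (pr i)))"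
    "lower_tri ?b (dg (q i)) \<inter> (\<lambda>z. ?b + z) ` upper_tri (dg (q (pr i))) (bl (q (pr i))) = {}"
    using half_open_quad_split'[OF conv] by (simp_all add: core_def sides dgi j_def)
qed

lemma permutes_restrict:
  assumes "p permutes S" "finite S" "p ` c = c" "c \<subseteq> S"
  shows "(\<lambda>i. if i \<in> c then p i else i) permutes S"
proof -
  have inj: "inj p" using assms(1) by (rule permutes_inj)
  have c: "p i \<in> c \<longleftrightarrow> i \<in> c" for i
    using assms(3) inj by (metis inj_image_mem_iff)
  show ?thesis
  proof (rule bij_imp_permutes)
    show "bij_betw (\<lambda>i. if i \<in> c then p i else i) S S"
    proof (rule bij_betwI')
      show "((if i \<in> c then p i else i) = (if j \<in> c then p j else j)) = (i = j)" for i j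
        using c inj by (auto simp: inj_eq)
      show "(if i \<in> c then p i else i) \<in> S" if "i \<in> S" for i
        using that assms by auto
      show "\<exists>i\<in>S. j = (if i \<in> c then p i else i)" if "j \<in> S" for j
        using that assms(3,4) by (cases "j \<in> c") (force simp: image_iff)+
    qed
  qed (use assms in auto)
qed

text \<open>Lower triangles keep their label, while the upper triangle of \<open>pr i\<close> passes
  to label \<open>i\<close>. As \<open>c\<close> is invariant under \<open>pr\<close>, this
  regrouping is a bijection between the disjoint unions of old and new cores that respects the maps
  to the surface.\<close>

lemma flip_glued:
  assumes g: "glued_quads pl pr q" and s: "straddles \<theta> q" and c: "c \<subseteq> {1..3}" "pr ` c = c"
    and left: "\<And>i. i \<in> c \<Longrightarrow> left_of \<theta> (dg (q i))"
  shows "glued_quads (\<lambda>i. if i \<in> c then pl (pr i) else pl i) pr (flip_quads q pr c)"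
proof -
  note D = glued_quadsD[OF g]
  let ?q = "flip_quads q pr c" and ?pl = "\<lambda>i. if i \<in> c then pl (pr i) else pl i"
  have perms: "pl permutes {1..3}" "pr permutes {1..3}" using g by (simp_all add: glued_quads_def)
  have prc: "pr i \<in> c \<longleftrightarrow> i \<in> c" for i
    using c(2) permutes_inj[OF perms(2)] by (metis inj_image_mem_iff)
  have cI: "i \<in> {1..3}" "left_of \<theta> (dg (q (pr i)))" if "i \<in> c" for i
    using that c(1) prc left by blast+
  note cell = flip_cell[OF g s cI(1) _ left cI(2)]
  have flip: "convex_cell (?q i)"
    "z \<in> closed_tri (br (q i)) (dg (q i)) \<Longrightarrow> emb (?q i) z = emb (q i) z"
    "y \<in> closed_tri (dg (q (pr i))) (bl (q (pr i))) \<Longrightarrow> emb (?q i) (br (q i) + y) = emb (q (pr i)) y"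
    "translation_on (region (?q i)) (emb (?q i))"
    "core (?q i) = lower_tri (br (q i)) (dg (q i)) \<union> (\<lambda>z. br (q i) + z) ` upper_tri (dg (q (pr i))) (bl (q (pr i)))"
    "lower_tri (br (q i)) (dg (q i)) \<inter> (\<lambda>z. br (q i) + z) ` upper_tri (dg (q (pr i))) (bl (q (pr i))) = {}"
    if "i \<in> c" for i z y
    by (rule cell(1) cell(2) cell(3) cell(5) cell(6) cell(7); (rule that)?; assumption?)+
  have noflip: "?q i = q i" if "i \<notin> c" for i using that by (simp add: flip_quads_def)
  have sides: "br (?q i) = br (q i)" "bl (?q i) = (if i \<in> c then dg (q i) else bl (q i))"
    "dg (?q i) = (if i \<in> c then br (q i) + dg (q (pr i)) else dg (q i))" for i
    by (simp_all add: flip_quads_def)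
  have tri: "cross (br (q i)) (dg (q i)) > 0" "cross (dg (q i)) (bl (q i)) > 0" if "i \<in> {1..3}" for i
    using D(1)[OF that] by (auto simp: convex_cell_def convex_quad_def)
  have emb_br: "emb (?q k) (t *\<^sub>R br (q k)) = emb (q k) (t *\<^sub>R br (q k))"
    if "k \<in> {1..3}" "0 \<le> t" "t \<le> 1" for k t
    using that flip(2)[of k] tri_sides(1)[OF tri(1)] noflip[of k] by (cases "k \<in> c") auto
  have pl_perm: "?pl permutes {1..3}"
  proof -
    \<comment> \<open>The top left side of a flipped cell is that of its right neighbour; hence the
      permutation is modified by \<open>pr\<close> restricted to \<open>c\<close>.\<close>
    have "?pl = pl \<circ> (\<lambda>i. if i \<in> c then pr i else i)" by auto
    then show ?thesis using permutes_compose[OF permutes_restrict[OF perms(2) _ c(2,1)] perms(1)] by simp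
  qed
  have 1: "convex_cell (?q i) \<and> translation_on (region (?q i)) (emb (?q i)) \<and> emb (?q i) 0 = sing"
    if i: "i \<in> {1..3}" for i
    using flip(1,4)[of i] D(1,2,3)[OF i] noflip[of i] emb_br[OF i, of 0] by (cases "i \<in> c") auto
  have 2: "dg (?q i) = bl (?q i) + br (?q (?pl i)) \<and> dg (?q i) = br (?q i) + bl (?q (pr i))" if i: "i \<in> {1..3}" for i
  proof (cases "i \<in> c")
    case True
    have "br (q i) + dg (q (pr i)) = dg (q i) + br (q (pl (pr i)))"
      unfolding D(4)[OF D(9)[OF i]] D(5)[OF i] by simp
    then show ?thesis using True prc by (simp add: sides)
  next
    case False
    then show ?thesis using D(4,5)[OF i] prc by (simp add: sides)
  qed
  have 3: "emb (?q i) (bl (?q i) + t *\<^sub>R br (?q (?pl i))) = emb (?q (?pl i)) (t *\<^sub>R br (?q (?pl i)))"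
    if i: "i \<in> {1..3}" and t: "0 \<le> t" "t \<le> 1" for i t
  proof (cases "i \<in> c")
    case True
    let ?j = "pr i"
    have j: "?j \<in> {1..3}" using D(9)[OF i] .
    have e: "br (q (pl ?j)) = dg (q ?j) - bl (q ?j)" unfolding D(4)[OF j] by simp
    have "bl (q ?j) + t *\<^sub>R br (q (pl ?j)) \<in> closed_tri (dg (q ?j)) (bl (q ?j))"
      unfolding e by (rule tri_sides(4)[OF tri(2)[OF j] t])
    then have "emb (?q i) (br (q i) + (bl (q ?j) + t *\<^sub>R br (q (pl ?j)))) = emb (q ?j) (bl (q ?j) + t *\<^sub>R br (q (pl ?j)))"
      by (rule flip(3)[OF True])
    also have "\<dots> = emb (?q (pl ?j)) (t *\<^sub>R br (q (pl ?j)))"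
      using D(6)[OF j t] emb_br[OF D(8)[OF j] t] by simp
    finally show ?thesis using True D(5)[OF i] by (simp add: sides add.assoc)
  next
    case False
    then show ?thesis using D(6)[OF i t] emb_br[OF D(8)[OF i] t] by (simp add: sides noflip)
  qed
  have 4: "emb (?q i) (br (?q i) + t *\<^sub>R bl (?q (pr i))) = emb (?q (pr i)) (t *\<^sub>R bl (?q (pr i)))"
    if i: "i \<in> {1..3}" and t: "0 \<le> t" "t \<le> 1" for i t
  proof (cases "i \<in> c")
    case True
    let ?j = "pr i"
    have j: "?j \<in> {1..3}" using D(9)[OF i] .
    have "emb (?q i) (br (q i) + t *\<^sub>R dg (q ?j)) = emb (q ?j) (t *\<^sub>R dg (q ?j))"
      by (rule flip(3)[OF True tri_sides(1)[OF tri(2)[OF j] t]])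
    also have "\<dots> = emb (?q ?j) (t *\<^sub>R dg (q ?j))"
      using flip(2)[OF _ tri_sides(2)[OF tri(1)[OF j] t]] True prc by simp
    finally show ?thesis using True prc by (simp add: sides)
  next
    case False
    then show ?thesis using D(7)[OF i t] prc by (simp add: noflip)
  qed
  have core_split: "core (q j) = lower_tri (br (q j)) (dg (q j)) \<union> upper_tri (dg (q j)) (bl (q j))"
    "lower_tri (br (q j)) (dg (q j)) \<inter> upper_tri (dg (q j)) (bl (q j)) = {}" if "j \<in> {1..3}" for j
    using D(1)[OF that] half_open_quad_split by (auto simp: core_def convex_cell_def)
  have closed: "lower_tri a b \<subseteq> closed_tri a b" "upper_tri a b \<subseteq> closed_tri a b" for a b
    by (auto simp: lower_tri_def upper_tri_def closed_tri_def)
  let ?S = "SIGMA i:{1..3}. core (?q i)" and ?T = "SIGMA i:{1..3}. core (q i)"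
  \<comment> \<open>Sends a point of a new core to the old core containing the same point of the
    surface; leaving the lower triangle means entering the right neighbour, whose origin is at
    \<open>br (q i)\<close>.\<close>
  define \<Phi> where "\<Phi> = (\<lambda>(i, z). if i \<in> c \<and> z \<notin> lower_tri (br (q i)) (dg (q i)) then (pr i, z - br (q i)) else (i, z))"
  have \<Phi>: "\<Phi> (i, z) \<in> ?T" "(\<lambda>(i, z). emb (q i) z) (\<Phi> (i, z)) = emb (?q i) z"
    if "(i, z) \<in> ?S" for i z
  proof -
    have i: "i \<in> {1..3}" and z: "z \<in> core (?q i)" using that by auto
    have "\<Phi> (i, z) \<in> ?T \<and> (\<lambda>(i, z). emb (q i) z) (\<Phi> (i, z)) = emb (?q i) z"
    proof (cases "i \<in> c \<and> z \<notin> lower_tri (br (q i)) (dg (q i))")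
      case True
      then obtain y where y: "y \<in> upper_tri (dg (q (pr i))) (bl (q (pr i)))" "z = br (q i) + y"
        using z flip(5)[of i] by auto
      then have "emb (?q i) z = emb (q (pr i)) y" using flip(3)[of i y] subsetD[OF closed(2)] True by blast
      moreover have "y \<in> core (q (pr i))" using y core_split D(9)[OF i] by auto
      ultimately show ?thesis using True y D(9)[OF i] by (simp add: \<Phi>_def)
    next
      case False
      have "z \<in> core (q i)" "emb (?q i) z = emb (q i) z"
        using False z core_split[OF i] flip(2)[of i z] subsetD[OF closed(1)] noflip[of i] by (cases "i \<in> c"; auto)+
      then show ?thesis using False i by (auto simp: \<Phi>_def)
    qed
    then show "\<Phi> (i, z) \<in> ?T" "(\<lambda>(i, z). emb (q i) z) (\<Phi> (i, z)) = emb (?q i) z" by blast+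
  qed
  have "bij_betw \<Phi> ?S ?T"
  proof (rule bij_betw_byWitness[where f' =
        "\<lambda>(j, y). if j \<in> c \<and> y \<in> upper_tri (dg (q j)) (bl (q j)) then (inv pr j, br (q (inv pr j)) + y) else (j, y)"])
    let ?\<Psi> = "\<lambda>(j, y). if j \<in> c \<and> y \<in> upper_tri (dg (q j)) (bl (q j)) then (inv pr j, br (q (inv pr j)) + y) else (j, y)"
    have inv: "inv pr (pr i) = i" "pr (inv pr i) = i" for i
      using permutes_inverses[OF perms(2)] by simp_all
    have invc: "inv pr i \<in> c \<longleftrightarrow> i \<in> c" for i using prc[of "inv pr i"] inv by simp
    have invI: "inv pr i \<in> {1..3}" if "i \<in> c" for i using invc that c(1) by blast
    show "\<forall>a\<in>?S. ?\<Psi> (\<Phi> a) = a"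
    proof
      fix a assume "a \<in> ?S"
      then obtain i z where a: "a = (i, z)" "i \<in> {1..3}" "z \<in> core (?q i)" by auto
      show "?\<Psi> (\<Phi> a) = a"
      proof (cases "i \<in> c \<and> z \<notin> lower_tri (br (q i)) (dg (q i))")
        case True
        then obtain y where "y \<in> upper_tri (dg (q (pr i))) (bl (q (pr i)))" "z = br (q i) + y"
          using a flip(5)[of i] by auto
        then show ?thesis using True a prc by (simp add: \<Phi>_def inv)
      next
        case False
        then show ?thesis using a core_split(2)[OF a(2)] by (auto simp: \<Phi>_def)
      qed
    qed
    show "\<forall>a\<in>?T. \<Phi> (?\<Psi> a) = a"
    proof
      fix a assume "a \<in> ?T"
      then obtain j y where a: "a = (j, y)" "j \<in> {1..3}" "y \<in> core (q j)" by auto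
      show "\<Phi> (?\<Psi> a) = a"
      proof (cases "j \<in> c \<and> y \<in> upper_tri (dg (q j)) (bl (q j))")
        case True
        then have "br (q (inv pr j)) + y \<notin> lower_tri (br (q (inv pr j))) (dg (q (inv pr j)))"
          using flip(6)[of "inv pr j"] invc by (auto simp: inv)
        then show ?thesis using True a invc by (simp add: \<Phi>_def inv)
      next
        case False
        then show ?thesis using a core_split(1)[OF a(2)] by (auto simp: \<Phi>_def)
      qed
    qed
    show "\<Phi> ` ?S \<subseteq> ?T" using \<Phi>(1) by blast
    show "?\<Psi> ` ?T \<subseteq> ?S"
    proof
      fix b assume "b \<in> ?\<Psi> ` ?T"
      then obtain j y where b: "j \<in> {1..3}" "y \<in> core (q j)" "b = ?\<Psi> (j, y)" by auto
      show "b \<in> ?S"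
      proof (cases "j \<in> c \<and> y \<in> upper_tri (dg (q j)) (bl (q j))")
        case True
        then have "br (q (inv pr j)) + y \<in> core (?q (inv pr j))"
          using flip(5)[of "inv pr j"] invc by (auto simp: inv)
        then show ?thesis using True b invI by simp
      next
        case False
        then have "y \<in> core (?q j)"
          using b core_split(1)[OF b(1)] flip(5)[of j] noflip[of j] by (cases "j \<in> c") auto
        then show ?thesis using False b by auto
      qed
    qed
  qed
  from bij_betw_trans[OF this glued_quads_bij[OF g]]
  have "bij_betw ((\<lambda>(i, z). emb (q i) z) \<circ> \<Phi>) ?S (UNIV - {sing})" .
  moreover have "((\<lambda>(i, z). emb (q i) z) \<circ> \<Phi>) a = (\<lambda>(i, z). emb (?q i) z) a" if "a \<in> ?S" for a
    using \<Phi>(2) that by (cases a) simp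
  ultimately have "bij_betw (\<lambda>(i, z). emb (?q i) z) ?S (UNIV - {sing})"
    using bij_betw_cong by blast
  then show ?thesis
    unfolding glued_quads_def using pl_perm perms(2) 1 2 3 4 by blast
qed

text \<open>Later computations use only the base sides and the permutations of the new cells. Their
  embeddings stay behind the existential quantifier.\<close>

lemma right_move:
  assumes g: "glued_quads pl pr q" and s: "straddles \<theta> q" and c: "c \<subseteq> {1..3}" "cyclic_on pr c"
    and left: "\<And>i. i \<in> c \<Longrightarrow> left_of \<theta> (dg (q i))"
  shows "\<exists>q'. glued_quads (\<lambda>i. if i \<in> c then pl (pr i) else pl i) pr q' \<and> straddles \<theta> q' \<and>
     diagonal_change \<theta> (cells q) (cells q') \<and>
     (\<forall>i. br (q' i) = br (q i) \<and> bl (q' i) = (if i \<in> c then dg (q i) else bl (q i)))"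
proof (intro exI[of _ "flip_quads q pr c"] conjI)
  let ?q = "flip_quads q pr c"
  have perm: "pr permutes {1..3}" using g by (simp add: glued_quads_def)
  have fin: "finite c" using c(1) finite_subset by blast
  have "pr ` c \<subseteq> c" using cyclic_on_inI[OF c(2)] by blast
  then have prc: "pr ` c = c"
    using fin permutes_inj[OF perm] by (metis card_image card_subset_eq inj_on_subset subset_UNIV)
  show G: "glued_quads (\<lambda>i. if i \<in> c then pl (pr i) else pl i) pr ?q"
    using flip_glued[OF g s c(1) prc left] .
  show S: "straddles \<theta> ?q"
    using s left by (simp add: straddles_def flip_quads_def)
  have "wedge (?q i) = (if i \<in> c then (diagonal (q i), bottom_right (q i)) else wedge (q i))" if i: "i \<in> {1..3}" for i
  proof (cases "i \<in> c")
    case True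
    have tri: "cross (br (q i)) (dg (q i)) > 0"
      using glued_quadsD(1)[OF g i] by (auto simp: convex_cell_def convex_quad_def)
    have "emb (?q i) z = emb (q i) z" if "z \<in> closed_tri (br (q i)) (dg (q i))" for z
      using that True by (simp add: flip_quads_def)
    then have "emb (?q i) ` closed_segment 0 (dg (q i)) = emb (q i) ` closed_segment 0 (dg (q i))"
      "emb (?q i) ` closed_segment 0 (br (q i)) = emb (q i) ` closed_segment 0 (br (q i))"
      using tri_sides(1,2)[OF tri] unfolding segment_0 image_image by (auto intro!: image_cong)
    then show ?thesis using True
      by (simp add: wedge_def bottom_left_def bottom_right_def diagonal_def) (simp add: flip_quads_def)
  next
    case False
    then show ?thesis by (simp add: flip_quads_def)
  qed
  then have "right_staircase_move \<theta> q c ?q"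
    unfolding right_staircase_move_def using glued_perms(2)[OF g] c left by blast
  then show "diagonal_change \<theta> (cells q) (cells ?q)"
    unfolding diagonal_change_def using glued_labelled[OF g s] glued_labelled[OF G S] by blast
  show "\<forall>i. br (?q i) = br (q i) \<and> bl (?q i) = (if i \<in> c then dg (q i) else bl (q i))"
    by (simp add: flip_quads_def)
qed

section \<open>Symmetries of the octagon\<close>

text \<open>An affine involution of the plane that preserves the octagon and its vertices, with
  linear part preserving the glue vectors, respects the identifications and so descends to the
  surface, as its own inverse.\<close>

lemma symmetry_aut:
  fixes t :: "real^2"
  assumes A: "A ** A = mat 1" and t: "A *v t + t = 0"
    and oct: "\<And>p. p \<in> octagon \<Longrightarrow> A *v p + t \<in> octagon"
    and verts: "\<And>p. p \<in> octverts \<Longrightarrow> A *v p + t \<in> octverts"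
    and glue: "\<And>w. w \<in> glue_vectors \<Longrightarrow> A *v w \<in> glue_vectors"
  shows "\<exists>f. surf_aut A A f f \<and> (\<forall>p\<in>octagon. f (proj p) = proj (A *v p + t))"
proof -
  let ?\<rho> = "\<lambda>p. A *v p + t"
  have AA: "A *v (A *v p) = p" for p using A by (simp add: matrix_vector_mul_assoc)
  have \<rho>: "?\<rho> (?\<rho> p) = p" for p
    using t by (simp add: matrix_vector_right_distrib AA add.assoc)
  define f where "f x = proj (?\<rho> (SOME p. p \<in> octagon \<and> proj p = x))" for x
  have f: "f (proj p) = proj (?\<rho> p)" if p: "p \<in> octagon" for p
  proof -
    define q where "q = (SOME q. q \<in> octagon \<and> proj q = proj p)"
    have q: "q \<in> octagon" "proj q = proj p"
      using someI[of "\<lambda>q. q \<in> octagon \<and> proj q = proj p" p] p by (auto simp: q_def)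
    have "?\<rho> p - ?\<rho> q = A *v (p - q)" by (simp add: matrix_vector_mult_diff_distrib)
    then have "proj (?\<rho> q) = proj (?\<rho> p)"
      using q(2) glue verts unfolding proj_eq_iff[OF q(1) p] proj_eq_iff[OF oct[OF q(1)] oct[OF p]] by auto
    then show ?thesis by (simp add: f_def q_def)
  qed
  have "f (f x) = x" for x
  proof -
    obtain p where "p \<in> octagon" "proj p = x" using proj_surj by blast
    then show ?thesis using f oct \<rho> by metis
  qed
  then have ff: "f \<circ> f = id" by auto
  have "f sing = sing"
    using f[OF octv_in_octagon[of 0]] verts[OF zero_in_octverts] oct[OF octv_in_octagon[of 0]]
    by (simp add: sing_def[symmetric] proj_eq_sing)
  moreover have "locally_affine A f"
    unfolding locally_affine_def
  proof (intro allI exI[of _ 1] conjI impI)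
    fix x p v assume *: "p \<in> octagon \<and> proj p = x \<and> norm v < 1 \<and> p + v \<in> octagon"
    have "?\<rho> p + A *v v = ?\<rho> (p + v)" by (simp add: matrix_vector_right_distrib)
    then have "?\<rho> p + A *v v \<in> octagon" "proj (?\<rho> p + A *v v) = f (proj (p + v))"
      using * f oct by presburger+
    moreover have "?\<rho> p \<in> octagon" "proj (?\<rho> p) = f x" using * f oct by auto
    ultimately show "\<exists>p'\<in>octagon. proj p' = f x \<and> p' + A *v v \<in> octagon \<and> proj (p' + A *v v) = f (proj (p + v))"
      by (intro bexI[of _ "?\<rho> p"] conjI)
  qed simp
  ultimately show ?thesis using A ff f by (auto simp: surf_aut_def)
qed

section \<open>The automorphisms with derivatives \<open>nu j\<close>\<close>

lemma mat2_mult: "mat2 a b c d ** mat2 a' b' c' d' =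
    mat2 (a * a' + b * c') (a * b' + b * d') (c * a' + d * c') (c * b' + d * d')"
  by (simp add: matrix_matrix_mult_def sum_2 vec_eq_iff forall_2)

lemma mat2_vec: "mat2 a b c d *v v = vec2 (a * v$1 + b * v$2) (c * v$1 + d * v$2)"
  by (simp add: matrix_vector_mult_def sum_2 vec_eq_iff forall_2)

lemma mat2_1: "(mat 1 :: real^2^2) = mat2 1 0 0 1"
  by (simp add: mat_def vec_eq_iff forall_2)

lemma mat2_scale: "x *\<^sub>R mat2 a b c d = mat2 (x * a) (x * b) (x * c) (x * d)"
  by (simp add: vec_eq_iff forall_2)

lemma mat2_det: "det (mat2 a b c d) = a * d - b * c"
  by (simp add: det_2)

lemma inverse_sqrt2: "1 / sqrt 2 = sqrt 2 / 2"
  by (simp add: real_div_sqrt field_simps)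

lemma nu_eqs:
  "nu 0 = mat2 1 0 0 1"
  "nu 1 = mat2 (sqrt 2 / 2) (sqrt 2 / 2) (sqrt 2 / 2) (- (sqrt 2 / 2))"
  "nu (Suc 0) = mat2 (sqrt 2 / 2) (sqrt 2 / 2) (sqrt 2 / 2) (- (sqrt 2 / 2))"
  "nu 2 = mat2 (sqrt 2 / 2) (sqrt 2 / 2) (- (sqrt 2 / 2)) (sqrt 2 / 2)"
  "nu 3 = mat2 0 1 1 0"
  "nu 4 = mat2 0 1 (-1) 0"
  "nu 5 = mat2 (- (sqrt 2 / 2)) (sqrt 2 / 2) (sqrt 2 / 2) (sqrt 2 / 2)"
  "nu 6 = mat2 (- (sqrt 2 / 2)) (sqrt 2 / 2) (- (sqrt 2 / 2)) (- (sqrt 2 / 2))"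
  "nu 7 = mat2 (-1) 0 0 1"
  by (simp_all add: nu_def mat2_scale inverse_sqrt2)

lemma mem_glue_vectors:
  "p \<in> glue_vectors \<longleftrightarrow> p$1 = 0 \<and> p$2 = 1 + sqrt 2 \<or> p$1 = - (sqrt 2 / 2) - 1 \<and> p$2 = 1 + sqrt 2 / 2 \<or>
     p$1 = - 1 - sqrt 2 \<and> p$2 = 0 \<or> p$1 = - 1 - sqrt 2 / 2 \<and> p$2 = - 1 - sqrt 2 / 2 \<or>
     p$1 = 0 \<and> p$2 = - 1 - sqrt 2 \<or> p$1 = 1 + sqrt 2 / 2 \<and> p$2 = - 1 - sqrt 2 / 2 \<or>
     p$1 = 1 + sqrt 2 \<and> p$2 = 0 \<or> p$1 = 1 + sqrt 2 / 2 \<and> p$2 = 1 + sqrt 2 / 2"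
  by (simp add: glue_vectors_eq vec_eq_iff forall_2 algebra_simps)

text \<open>The shift \<open>vec2 1 0\<close> is due to the octagon having its vertical axis of
  symmetry at abscissa 1/2.\<close>

lemma nu_7_aut: "\<exists>f. surf_aut (nu 7) (nu 7) f f"
proof -
  have "\<exists>f. surf_aut (nu 7) (nu 7) f f \<and> (\<forall>p\<in>octagon. f (proj p) = proj (nu 7 *v p + vec2 1 0))"
  proof (rule symmetry_aut)
    show "nu 7 ** nu 7 = mat 1" by (simp add: nu_eqs mat2_mult mat2_1)
    show "nu 7 *v vec2 1 0 + vec2 1 0 = 0" by (simp add: nu_eqs mat2_vec vec2_arith)
    fix p :: "real^2"
    show "nu 7 *v p + vec2 1 0 \<in> octagon" if "p \<in> octagon"
      using that by (simp add: nu_eqs mat2_vec octagon_eq octagon_ineqs_def vec2_arith)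
    show "nu 7 *v p + vec2 1 0 \<in> octverts" if "p \<in> octverts"
      using that unfolding mem_octverts
      by (elim disjE conjE; simp add: nu_eqs mat2_vec)
    show "nu 7 *v p \<in> glue_vectors" if "p \<in> glue_vectors"
      using that unfolding mem_glue_vectors
      by (elim disjE conjE; simp add: nu_eqs mat2_vec)
  qed
  then show ?thesis by blast
qed

lemma nu_1_aut: "\<exists>f. surf_aut (nu 1) (nu 1) f f"
proof -
  \<comment> \<open>The shift with which the reflection \<open>nu 1\<close> fixes the center of the
    octagon.\<close>
  let ?t = "vec2 (- (sqrt 2 / 2)) (1 + sqrt 2 / 2)"
  have "\<exists>f. surf_aut (nu 1) (nu 1) f f \<and> (\<forall>p\<in>octagon. f (proj p) = proj (nu 1 *v p + ?t))"
  proof (rule symmetry_aut)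
    show "nu 1 ** nu 1 = mat 1" by (simp add: nu_eqs mat2_mult mat2_1)
    show "nu 1 *v ?t + ?t = 0" by (simp add: nu_eqs mat2_vec vec2_arith field_simps)
    fix p :: "real^2"
    show "nu 1 *v p + ?t \<in> octagon" if "p \<in> octagon"
    proof -
      note p = that[unfolded octagon_eq mem_Collect_eq octagon_ineqs_def]
      have m: "0 \<le> sqrt 2 * b - sqrt 2 * a" if "a \<le> b" for a b :: real
        using mult_left_mono[OF that, of "sqrt 2"] by simp
      have r: "sqrt 2 * sqrt 2 = (2::real)" by simp
      \<comment> \<open>With the products by \<open>sqrt 2\<close> as new variables, the eight
        inequalities of the image become linear.\<close>
      define X Y where "X = sqrt 2 * p$1" and "Y = sqrt 2 * p$2"
      have "0 \<le> Y" "X \<le> sqrt 2 + Y" "X \<le> sqrt 2 + 1" "X + Y \<le> 2 * sqrt 2 + 2" "Y \<le> sqrt 2 + 2"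
        "Y \<le> sqrt 2 + 2 + X" "- 1 \<le> X" "0 \<le> X + Y"
        using m[of 0 "p$2"] m[of "p$1 - p$2" 1] m[of "p$1" "1 + sqrt 2 / 2"] m[of "p$1 + p$2" "2 + sqrt 2"]
          m[of "p$2" "1 + sqrt 2"] m[of "p$2 - p$1" "1 + sqrt 2"] m[of "- (sqrt 2 / 2)" "p$1"] m[of 0 "p$1 + p$2"] p
        unfolding X_def Y_def by (simp_all add: algebra_simps)
      moreover have "(nu 1 *v p + ?t)$1 = X / 2 + Y / 2 - sqrt 2 / 2" "(nu 1 *v p + ?t)$2 = X / 2 - Y / 2 + 1 + sqrt 2 / 2"
        by (simp_all add: nu_eqs mat2_vec X_def Y_def)
      ultimately show ?thesis
        using p unfolding octagon_eq mem_Collect_eq octagon_ineqs_def by (intro conjI; linarith)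
    qed
    show "nu 1 *v p + ?t \<in> octverts" if "p \<in> octverts"
      using that unfolding mem_octverts
      by (elim disjE conjE; simp only: nu_eqs mat2_vec vector_2 vector_add_component; simp add: algebra_simps add_divide_distrib)
    show "nu 1 *v p \<in> glue_vectors" if "p \<in> glue_vectors"
      using that unfolding mem_glue_vectors
      by (elim disjE conjE; simp only: nu_eqs mat2_vec vector_2; simp add: algebra_simps add_divide_distrib diff_divide_distrib)
  qed
  then show ?thesis by blast
qed

lemma surf_aut_id: "surf_aut (mat 1) (mat 1) id id"
  unfolding surf_aut_def locally_affine_def by (auto intro!: exI[of _ 1])

text \<open>The reflections \<open>nu 1\<close> and \<open>nu 7\<close> generate the dihedral group
  of the octagon. Their product \<open>nu 6\<close> is the rotation by - 3 pi / 4, whose cube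
  \<open>nu 2\<close> is the rotation by - pi / 4; the remaining matrices are products of
  these.\<close>

lemma nu_aut:
  assumes "j < 8"
  shows "\<exists>B f g. surf_aut (nu j) B f g"
proof -
  let ?P = "\<lambda>A. \<exists>B f g. surf_aut A B f g"
  have mult: "?P (A ** A')" if "?P A" "?P A'" for A A'
    using that surf_aut_compose by blast
  have 1: "?P (nu 1)" "?P (nu 7)" using nu_1_aut nu_7_aut by blast+
  have prods: "nu 6 = nu 1 ** nu 7" "nu 2 = nu 6 ** (nu 6 ** nu 6)" "nu 4 = nu 2 ** nu 2" "nu 3 = nu 1 ** nu 2"
      "nu 5 = nu 1 ** nu 4" "nu 0 = mat 1"
    by (simp_all add: nu_eqs mat2_mult mat2_1 add_divide_distrib)
  have 6: "?P (nu 6)" unfolding prods(1) by (intro mult 1)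
  have 2: "?P (nu 2)" unfolding prods(2) by (intro mult 6)
  have 4: "?P (nu 4)" unfolding prods(3) by (intro mult 2)
  have 3: "?P (nu 3)" unfolding prods(4) by (intro mult 1 2)
  have 5: "?P (nu 5)" unfolding prods(5) by (intro mult 1 4)
  have 0: "?P (nu 0)" unfolding prods(6) using surf_aut_id by blast
  show ?thesis
    using assms 0 1 2 3 4 5 6 unfolding less_8_cases by (elim disjE) simp_all
qed

section \<open>Saddle connections and the sides of quadrilaterals\<close>

text \<open>The first premise says that every line from a vertex into the octagon in direction \<open>e\<close> is one of the
  chords in \<open>C\<close>; by rigidity a segment that starts at the singularity cannot leave such a chord.\<close>

lemma saddle_connection_chord:
  assumes chord: "\<And>v s. v \<in> octverts \<Longrightarrow> s > 0 \<Longrightarrow> v + s *\<^sub>R e \<in> octagon \<Longrightarrow>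
      \<exists>L. L \<ge> s \<and> v + L *\<^sub>R e \<in> octverts \<and> (v, v + L *\<^sub>R e) \<in> C \<and> (\<forall>t. 0 < t \<and> t < L \<longrightarrow> v + t *\<^sub>R e \<notin> octverts)"
    and tr: "translation_on S \<phi>" and S: "\<And>t. 0 \<le> t \<Longrightarrow> t \<le> 1 \<Longrightarrow> t *\<^sub>R w \<in> S"
    and sing: "\<phi> 0 = sing" "\<phi> w = sing" and ns: "\<And>t. 0 < t \<Longrightarrow> t < 1 \<Longrightarrow> \<phi> (t *\<^sub>R w) \<noteq> sing"
    and w: "w = l *\<^sub>R e" "l > 0"
  shows "\<exists>(v, v')\<in>C. \<phi> ` closed_segment 0 w = proj ` closed_segment v v'"
proof -
  have "0 \<in> S" using S[of 0] by simp
  then obtain \<epsilon> where \<epsilon>: "\<epsilon> > 0" "\<And>y. y \<in> S \<inter> ball 0 \<epsilon> \<Longrightarrow>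
      \<exists>p\<in>octagon. p + y \<in> octagon \<and> proj p = sing \<and> proj (p + y) = \<phi> y"
    using tr sing(1) unfolding translation_on_def by force
  \<comment> \<open>Rigidity cannot start at the singularity itself. A point of the segment close to
    it has a representative that picks out the vertex \<open>v\<close> from which the segment enters
    the octagon.\<close>
  define t0 where "t0 = min (1 / 2) (\<epsilon> / (2 * (1 + norm w)))"
  have nw: "1 + norm w > 0" using norm_ge_zero[of w] by linarith
  have t0: "0 < t0" "t0 < 1" using \<epsilon>(1) nw by (auto simp: t0_def)
  have "t0 * norm w \<le> \<epsilon> / (2 * (1 + norm w)) * (1 + norm w)"
    using \<epsilon>(1) nw by (intro mult_mono) (auto simp: t0_def)
  also have "\<dots> = \<epsilon> / 2" using nw by (simp add: field_simps)
  also have "\<dots> < \<epsilon>" using \<epsilon>(1) by simp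
  finally have "t0 *\<^sub>R w \<in> S \<inter> ball 0 \<epsilon>" using S[of t0] t0 by simp
  then obtain v where v: "v \<in> octagon" "v + t0 *\<^sub>R w \<in> octagon" "proj v = sing" "proj (v + t0 *\<^sub>R w) = \<phi> (t0 *\<^sub>R w)"
    using \<epsilon>(2) by blast
  have vv: "v \<in> octverts" using v(1,3) by (simp add: proj_eq_sing)
  have "v + (t0 * l) *\<^sub>R e \<in> octagon" "t0 * l > 0" using v(2) t0 w by auto
  then obtain L where L: "L \<ge> t0 * l" "v + L *\<^sub>R e \<in> octverts" "(v, v + L *\<^sub>R e) \<in> C"
    "\<And>t. 0 < t \<Longrightarrow> t < L \<Longrightarrow> v + t *\<^sub>R e \<notin> octverts"
    using chord[OF vv] by blast
  have Lpos: "L > 0" using L(1) \<open>t0 * l > 0\<close> by linarith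
  have vL: "v + L *\<^sub>R e \<in> octagon" using L(2) octverts_subset by blast
  have inO: "v + t *\<^sub>R w \<in> octagon" if "0 \<le> t" "t * l \<le> L" for t
  proof -
    have "v + (t * l / L) *\<^sub>R (L *\<^sub>R e) \<in> octagon"
      using that Lpos w by (intro octagon_segment[OF v(1) vL]) auto
    then show ?thesis using Lpos w by simp
  qed
  have rigid: "\<phi> (t *\<^sub>R w) = proj (v + t *\<^sub>R w)" if t: "0 < t" "t \<le> 1" "t * l \<le> L" for t
  proof -
    have e: "t0 *\<^sub>R w + s *\<^sub>R ((t - t0) *\<^sub>R w) = ((1 - s) * t0 + s * t) *\<^sub>R w" for s
      by (simp add: algebra_simps)
    have b: "0 < (1 - s) * t0 + s * t" "(1 - s) * t0 + s * t \<le> 1" if "0 \<le> s" "s \<le> 1" for s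
    proof -
      show "0 < (1 - s) * t0 + s * t"
        using that t t0 by (cases "s = 0") (auto intro!: add_nonneg_pos)
      have "(1 - s) * t0 + s * t \<le> (1 - s) * 1 + s * 1"
        using that t t0 by (intro add_mono mult_left_mono) auto
      then show "(1 - s) * t0 + s * t \<le> 1" by simp
    qed
    have b': "(1 - s) * t0 + s * t < 1" if "0 \<le> s" "s < 1" for s
    proof -
      have "(1 - s) * t0 + s * t < (1 - s) * 1 + s * 1"
        using that t t0 by (intro add_less_le_mono mult_left_mono mult_strict_left_mono) auto
      then show ?thesis by simp
    qed
    have "\<phi> (t0 *\<^sub>R w + (t - t0) *\<^sub>R w) = proj (v + t0 *\<^sub>R w + (t - t0) *\<^sub>R w)"
    proof (rule translation_rigid[OF tr _ v(2)])
      show "v + t0 *\<^sub>R w + (t - t0) *\<^sub>R w \<in> octagon"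
        using inO[of t] t by (simp add: algebra_simps)
      show "\<phi> (t0 *\<^sub>R w) = proj (v + t0 *\<^sub>R w)" using v(4) by simp
      show "t0 *\<^sub>R w + s *\<^sub>R ((t - t0) *\<^sub>R w) \<in> S" if "0 \<le> s" "s \<le> 1" for s
        unfolding e using b[OF that] S by simp
      show "\<phi> (t0 *\<^sub>R w + s *\<^sub>R ((t - t0) *\<^sub>R w)) \<noteq> sing" if "0 \<le> s" "s < 1" for s
        unfolding e using b[of s] b'[of s] that by (intro ns) auto
    qed
    then show ?thesis by (simp add: algebra_simps)
  qed
  \<comment> \<open>A shorter chord would make the segment meet the singularity too early; a longer
    one would contain a vertex in its interior, namely \<open>v + w\<close>.\<close>
  have "L = l"
  proof (rule ccontr)
    assume "L \<noteq> l"
    then consider "L < l" | "l < L" by linarith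
    then show False
    proof cases
      case 1
      then have "\<phi> ((L / l) *\<^sub>R w) = proj (v + (L / l) *\<^sub>R w)" using w Lpos by (intro rigid) auto
      also have "v + (L / l) *\<^sub>R w = v + L *\<^sub>R e" using w by simp
      also have "proj \<dots> = sing" using L(2) vL by (simp add: proj_eq_sing)
      finally show False using ns[of "L / l"] 1 Lpos w by simp
    next
      case 2
      then have "proj (v + w) = sing" using rigid[of 1] sing(2) by simp
      then have "v + w \<in> octverts" using inO[of 1] 2 by (simp add: proj_eq_sing)
      then show False using L(4)[of l] 2 w by simp
    qed
  qed
  then have v': "v + L *\<^sub>R e = v + w" using w by simp
  have "\<phi> (t *\<^sub>R w) = proj (v + t *\<^sub>R w)" if "0 \<le> t" "t \<le> 1" for t
    using rigid[of t] that \<open>L = l\<close> w sing(1) v(3) by (cases "t = 0") auto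
  then have "\<phi> ` closed_segment 0 w = proj ` closed_segment v (v + w)"
    unfolding segment_0 segment_shift image_image by (intro image_cong) auto
  then show ?thesis using L(3) v' by (intro bexI[of _ "(v, v + w)"]) auto
qed

section \<open>The saddle connections in the directions 0 and pi / 8\<close>

lemma chords_0:
  assumes "v \<in> octverts" "s > 0" "v + s *\<^sub>R vec2 1 0 \<in> octagon"
  shows "\<exists>L. L \<ge> s \<and> v + L *\<^sub>R vec2 1 0 \<in> octverts \<and>
      (v, v + L *\<^sub>R vec2 1 0) \<in> {(octv 0, octv 1), (octv 5, octv 4), (octv 7, octv 2), (octv 6, octv 3)} \<and>
      (\<forall>t. 0 < t \<and> t < L \<longrightarrow> v + t *\<^sub>R vec2 1 0 \<notin> octverts)"
    (is "\<exists>L. ?P v L")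
proof -
  note s2 = sqrt2_bounds(1)
  note simps = octagon_eq octagon_ineqs_def octv_eqs mem_octverts
  from assms(1) consider "v = octv 0 \<or> v = octv 5" | "v = octv 7 \<or> v = octv 6"
    | "v = octv 1 \<or> v = octv 2 \<or> v = octv 3 \<or> v = octv 4"
    unfolding octverts_eq by auto
  then show ?thesis
  proof cases
    case 1
    have "s \<le> 1" using 1 assms(2,3) s2 by (elim disjE; hypsubst) (auto simp: simps)
    moreover have "v + 1 *\<^sub>R vec2 1 0 = (if v = octv 0 then octv 1 else octv 4)"
      using 1 by (elim disjE; hypsubst) (auto simp: octv_eqs vec_eq_iff forall_2)
    moreover have "v + x *\<^sub>R vec2 1 0 \<notin> octverts" if "0 < x" "x < 1" for x
      using 1 that s2 by (elim disjE; hypsubst) (auto simp: simps)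
    ultimately have "?P v 1" using 1 by (auto simp: octverts_eq)
    then show ?thesis by blast
  next
    case 2
    have "s \<le> 1 + sqrt 2" using 2 assms(2,3) s2 by (elim disjE; hypsubst) (auto simp: simps)
    moreover have "v + (1 + sqrt 2) *\<^sub>R vec2 1 0 = (if v = octv 7 then octv 2 else octv 3)"
      using 2 by (elim disjE; hypsubst) (auto simp: octv_eqs vec_eq_iff forall_2)
    moreover have "v + x *\<^sub>R vec2 1 0 \<notin> octverts" if "0 < x" "x < 1 + sqrt 2" for x
      using 2 that s2 by (elim disjE; hypsubst) (auto simp: simps)
    ultimately have "?P v (1 + sqrt 2)" using 2 by (auto simp: octverts_eq)
    then show ?thesis by blast
  next
    case 3
    then show ?thesis using assms(2,3) by (elim disjE; hypsubst) (auto simp: simps)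
  qed
qed

lemma chords_1:
  assumes "v \<in> octverts" "s > 0" "v + s *\<^sub>R vec2 (1 + sqrt 2) 1 \<in> octagon"
  shows "\<exists>L. L \<ge> s \<and> v + L *\<^sub>R vec2 (1 + sqrt 2) 1 \<in> octverts \<and>
      (v, v + L *\<^sub>R vec2 (1 + sqrt 2) 1) \<in> {(octv 0, octv 2), (octv 6, octv 4), (octv 7, octv 3)} \<and>
      (\<forall>t. 0 < t \<and> t < L \<longrightarrow> v + t *\<^sub>R vec2 (1 + sqrt 2) 1 \<notin> octverts)"
    (is "\<exists>L. ?P v L")
proof -
  note s2 = sqrt2_bounds(1)
  note simps = octagon_eq octagon_ineqs_def octv_eqs mem_octverts
  have m: "s * (1 + sqrt 2) > 0" "s * sqrt 2 > 0" using assms(2) by (auto intro!: mult_pos_pos add_pos_pos)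
  have t: "t < L \<Longrightarrow> t * (1 + sqrt 2) < L * (1 + sqrt 2)" "t > 0 \<Longrightarrow> t * sqrt 2 > 0" for t L :: real
    by (auto intro!: mult_strict_right_mono add_pos_pos)
  from assms(1) consider "v = octv 0 \<or> v = octv 6" | "v = octv 7"
    | "v = octv 1 \<or> v = octv 2 \<or> v = octv 3 \<or> v = octv 4 \<or> v = octv 5"
    unfolding octverts_eq by auto
  then show ?thesis
  proof cases
    case 1
    \<comment> \<open>The direction vector is the long diagonal itself; the two short diagonals are
      \<open>sqrt 2 / 2\<close> times as long.\<close>
    have sL: "s \<le> sqrt 2 / 2"
    proof (rule ccontr)
      assume "\<not> s \<le> sqrt 2 / 2"
      then have "sqrt 2 / 2 * (1 + sqrt 2) < s * (1 + sqrt 2)" by (intro t) simp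
      then show False using 1 assms(3) \<open>\<not> s \<le> sqrt 2 / 2\<close>
        by (elim disjE; hypsubst) (auto simp: simps algebra_simps add_divide_distrib)
    qed
    moreover have "v + (sqrt 2 / 2) *\<^sub>R vec2 (1 + sqrt 2) 1 = (if v = octv 0 then octv 2 else octv 4)"
      using 1 by (elim disjE; hypsubst) (auto simp: octv_eqs vec2_arith algebra_simps add_divide_distrib vec_eq_iff forall_2)
    moreover have "v + x *\<^sub>R vec2 (1 + sqrt 2) 1 \<notin> octverts" if "0 < x" "x < sqrt 2 / 2" for x
      using 1 that t(1)[OF that(2)] t(2)[OF that(1)] s2
      by (elim disjE; hypsubst) (auto simp: simps algebra_simps add_divide_distrib)
    ultimately have "?P v (sqrt 2 / 2)" using 1 by (auto simp: octverts_eq)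
    then show ?thesis by blast
  next
    case 2
    have sL: "s \<le> 1"
    proof (rule ccontr)
      assume "\<not> s \<le> 1"
      then have "1 * (1 + sqrt 2) < s * (1 + sqrt 2)" by (intro t) simp
      then show False using 2 assms(3) by (simp add: simps algebra_simps add_divide_distrib)
    qed
    moreover have "v + 1 *\<^sub>R vec2 (1 + sqrt 2) 1 = octv 3"
      using 2 by (simp add: octv_eqs vec_eq_iff forall_2)
    moreover have "v + x *\<^sub>R vec2 (1 + sqrt 2) 1 \<notin> octverts" if "0 < x" "x < 1" for x
      using 2 that t(1)[OF that(2)] t(2)[OF that(1)] s2
      by (auto simp: simps algebra_simps add_divide_distrib)
    ultimately have "?P v 1" using 2 by (auto simp: octverts_eq)
    then show ?thesis by blast
  next
    case 3
    then show ?thesis using assms(2,3) m s2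
      by (elim disjE; hypsubst) (auto simp: simps algebra_simps add_divide_distrib)
  qed
qed

lemma bottom_side_core:
  assumes g: "glued_quads pl pr q" and i: "i \<in> {1..3}" and t: "0 < t" "t < 1"
  shows "t *\<^sub>R bl (q i) \<in> core (q i)" "t *\<^sub>R br (q i) \<in> core (q i)"
  using bottom_sides_half_open[of "br (q i)" "dg (q i)" "bl (q i)" t] glued_quadsD(1)[OF g i] t
  by (simp_all add: core_def convex_cell_def)

lemma bottom_in_region:
  assumes g: "glued_quads pl pr q" and i: "i \<in> {1..3}" and t: "0 \<le> t" "t \<le> 1"
  shows "t *\<^sub>R bl (q i) \<in> region (q i)" "t *\<^sub>R br (q i) \<in> region (q i)"
proof -
  have c: "convex_quad (br (q i)) (dg (q i)) (bl (q i))" "convex_cell (q i)"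
    using glued_quadsD(1)[OF g i] by (simp_all add: convex_cell_def)
  then have "cross (br (q i)) (bl (q i)) > 0" by (simp add: convex_quad_def)
  then show "t *\<^sub>R bl (q i) \<in> region (q i)" "t *\<^sub>R br (q i) \<in> region (q i)"
    using tri_sides(1,2)[OF _ t] tri_subset_quad(3)[OF c(1)] region_cell[OF c(2)] by blast+
qed

text \<open>The midpoint of a bottom side lies in the core of its cell. If two such sides coincided
  on the surface, injectivity on the cores would identify their labels.\<close>

lemma bottom_sides_distinct:
  assumes g: "glued_quads pl pr q"
  shows "inj_on (\<lambda>i. bottom_left (q i)) {1..3}" "inj_on (\<lambda>i. bottom_right (q i)) {1..3}"
proof -
  have *: "i = j" if ij: "i \<in> {1..3}" "j \<in> {1..3}"
    and core: "\<And>i t. i \<in> {1..3} \<Longrightarrow> 0 < t \<Longrightarrow> t < 1 \<Longrightarrow> t *\<^sub>R b i \<in> core (q i)"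
    and v: "\<And>i. i \<in> {1..3} \<Longrightarrow> emb (q i) (b i) = sing"
    and eq: "emb (q i) ` closed_segment 0 (b i) = emb (q j) ` closed_segment 0 (b j)" for i j b
  proof -
    have "(1 / 2) *\<^sub>R b i \<in> closed_segment 0 (b i)" unfolding segment_0 by (intro imageI) simp
    then have "emb (q i) ((1 / 2) *\<^sub>R b i) \<in> emb (q j) ` closed_segment 0 (b j)" using eq by blast
    then obtain t where t: "0 \<le> t" "t \<le> 1" "emb (q i) ((1 / 2) *\<^sub>R b i) = emb (q j) (t *\<^sub>R b j)"
      unfolding segment_0 by auto
    have c: "(1 / 2) *\<^sub>R b i \<in> core (q i)" using core[OF ij(1)] by simp
    then have "emb (q j) (t *\<^sub>R b j) \<noteq> sing" using core_nonsing[OF g ij(1)] t(3) by metis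
    then have "t \<noteq> 0" "t \<noteq> 1" using v[OF ij(2)] glued_quadsD(3)[OF g ij(2)] by auto
    then show "i = j" using core_inj(1)[OF g ij c _ t(3)] core[OF ij(2), of t] t by auto
  qed
  show "inj_on (\<lambda>i. bottom_left (q i)) {1..3}" "inj_on (\<lambda>i. bottom_right (q i)) {1..3}"
    unfolding bottom_left_def bottom_right_def
    using *[where b = "\<lambda>i. bl (q i)"] *[where b = "\<lambda>i. br (q i)"] bottom_side_core[OF g] glued_vertices[OF g]
    by (auto intro!: inj_onI simp del: atLeastAtMost_iff)
qed

text \<open>A counting argument: three distinct sides among three candidates exhaust the candidates.
  It is never determined which cell has which saddle connection as a side.\<close>

lemma three_sets:
  assumes "inj_on f {1..3::nat}" "\<And>i. i \<in> {1..3} \<Longrightarrow> f i \<in> {a, b, c}"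
  shows "(\<Union>i\<in>{1..3}. f i) = a \<union> b \<union> c"
proof -
  have "card (f ` {1..3}) = 3" using card_image[OF assms(1)] by simp
  then have c: "card {a, b, c} \<le> card (f ` {1..3})" by (simp add: card_insert_if)
  have "f ` {1..3} \<subseteq> {a, b, c}" using assms(2) by blast
  then have "f ` {1..3} = {a, b, c}" using c by (intro card_seteq) simp_all
  then have "\<Union> (f ` {1..3}) = \<Union> {a, b, c}" by simp
  then show ?thesis by (simp add: Un_assoc)
qed

definition side_union :: "(nat \<Rightarrow> quad) \<Rightarrow> octsurf set" where
  "side_union q = (\<Union>i\<in>{1..3}. bottom_left (q i)) \<union> (\<Union>i\<in>{1..3}. bottom_right (q i))"

lemma side_union_cuts:
  assumes g: "glued_quads pl pr q"
    and bl: "\<And>i. i \<in> {1..3} \<Longrightarrow> \<exists>l>0. bl (q i) = l *\<^sub>R vec2 (1 + sqrt 2) 1"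
    and br: "\<And>i. i \<in> {1..3} \<Longrightarrow> \<exists>l>0. br (q i) = l *\<^sub>R vec2 1 0"
  shows "side_union q = cuts"
proof -
  \<comment> \<open>The top side of the octagon is glued to the bottom one, so the four chords in
    direction 0 are only three saddle connections.\<close>
  have seg: "proj ` closed_segment (octv 5) (octv 4) = proj ` closed_segment (octv 0) (octv 1)"
  proof -
    have e: "octv 1 = octv 0 + vec2 1 0" "octv 4 = octv 5 + vec2 1 0" by (simp_all add: octv_eqs vec2_arith)
    have "proj (octv 5 + t *\<^sub>R vec2 1 0) = proj (octv 0 + t *\<^sub>R vec2 1 0)" if "t \<in> {0..1}" for t
    proof -
      have "octv 5 + t *\<^sub>R vec2 1 0 \<in> octagon" "octv 0 + t *\<^sub>R vec2 1 0 \<in> octagon"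
        using that octv_in_octagon[of 4] octv_in_octagon[of 1] unfolding e
        by (auto intro!: octagon_segment octv_in_octagon)
      moreover have "octv 0 + t *\<^sub>R vec2 1 0 - (octv 5 + t *\<^sub>R vec2 1 0) \<in> glue_vectors"
        by (simp add: octv_eqs glue_vectors_eq vec2_arith)
      ultimately show ?thesis by (simp add: proj_eq_iff)
    qed
    then show ?thesis unfolding e segment_shift image_image by (rule image_cong[OF refl])
  qed
  have "bottom_left (q i) \<in> {proj ` closed_segment (octv 0) (octv 2), proj ` closed_segment (octv 6) (octv 4),
      proj ` closed_segment (octv 7) (octv 3)}" if i: "i \<in> {1..3}" for i
  proof -
    obtain l where l: "l > 0" "bl (q i) = l *\<^sub>R vec2 (1 + sqrt 2) 1" using bl[OF i] by blast
    have "\<exists>(v, v')\<in>{(octv 0, octv 2), (octv 6, octv 4), (octv 7, octv 3)}.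
        emb (q i) ` closed_segment 0 (bl (q i)) = proj ` closed_segment v v'"
      by (rule saddle_connection_chord[OF chords_1 glued_quadsD(2)[OF g i] bottom_in_region(1)[OF g i]
          glued_quadsD(3)[OF g i] _ _ l(2,1)])
        (use glued_vertices[OF g i] core_nonsing[OF g i] bottom_side_core(1)[OF g i] in auto)
    then show ?thesis unfolding bottom_left_def by auto
  qed
  then have 1: "(\<Union>i\<in>{1..3}. bottom_left (q i)) = proj ` closed_segment (octv 0) (octv 2) \<union>
      proj ` closed_segment (octv 6) (octv 4) \<union> proj ` closed_segment (octv 7) (octv 3)"
    by (rule three_sets[OF bottom_sides_distinct(1)[OF g]])
  have "bottom_right (q i) \<in> {proj ` closed_segment (octv 0) (octv 1), proj ` closed_segment (octv 7) (octv 2),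
      proj ` closed_segment (octv 6) (octv 3)}" if i: "i \<in> {1..3}" for i
  proof -
    obtain l where l: "l > 0" "br (q i) = l *\<^sub>R vec2 1 0" using br[OF i] by blast
    have "\<exists>(v, v')\<in>{(octv 0, octv 1), (octv 5, octv 4), (octv 7, octv 2), (octv 6, octv 3)}.
        emb (q i) ` closed_segment 0 (br (q i)) = proj ` closed_segment v v'"
      by (rule saddle_connection_chord[OF chords_0 glued_quadsD(2)[OF g i] bottom_in_region(2)[OF g i]
          glued_quadsD(3)[OF g i] _ _ l(2,1)])
        (use glued_vertices[OF g i] core_nonsing[OF g i] bottom_side_core(2)[OF g i] in auto)
    then show ?thesis unfolding bottom_right_def using seg by auto
  qed
  then have 2: "(\<Union>i\<in>{1..3}. bottom_right (q i)) = proj ` closed_segment (octv 0) (octv 1) \<union>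
      proj ` closed_segment (octv 7) (octv 2) \<union> proj ` closed_segment (octv 6) (octv 3)"
    by (rule three_sets[OF bottom_sides_distinct(2)[OF g]])
  show ?thesis unfolding side_union_def 1 2 cuts_def image_Un by blast
qed

section \<open>Cells as connected components\<close>

text \<open>The complement of one piece is a finite union of relatively closed pieces, so every
  piece is clopen and a connected set cannot meet two of them.\<close>

lemma components_of_disjoint_clopen:
  fixes W :: "'a::topological_space set"
  assumes W: "W = (\<Union>i\<in>I. C i)" and fin: "finite I" and disj: "disjoint_family_on C I"
    and conn: "\<And>i. i \<in> I \<Longrightarrow> connected (C i)" and ne: "\<And>i. i \<in> I \<Longrightarrow> C i \<noteq> {}"
    and cl: "\<And>i. i \<in> I \<Longrightarrow> closedin (top_of_set W) (C i)"
  shows "components W = C ` I"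
proof -
  have sub: "D \<subseteq> C i" if i: "i \<in> I" and D: "connected D" "D \<subseteq> W" "D \<inter> C i \<noteq> {}" for i D
  proof -
    have W': "W - C i = (\<Union>j\<in>I - {i}. C j)"
      using i disj unfolding W disjoint_family_on_def by blast
    have "closedin (top_of_set W) (W - C i)"
      unfolding W' using fin cl by (intro closedin_Union) auto
    then have "openin (top_of_set W) (C i)"
      using cl[OF i] closedin_def by (metis Diff_Diff_Int closedin_subset inf.absorb_iff2 openin_closedin_eq topspace_euclidean_subtopology)
    then obtain T where T: "open T" "C i = W \<inter> T" unfolding openin_open by blast
    obtain K where K: "closed K" "C i = W \<inter> K" using cl[OF i] unfolding closedin_closed by blast
    have "D \<inter> C i = D \<inter> T" "D \<inter> C i = D \<inter> K" using T(2) K(2) D(2) by blast+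
    then have "openin (top_of_set D) (D \<inter> C i)" "closedin (top_of_set D) (D \<inter> C i)"
      using T(1) K(1) by (metis openin_open_Int, metis closedin_closed_Int)
    then have "D \<inter> C i = {} \<or> D \<inter> C i = D" using D(1) unfolding connected_clopen by blast
    then show ?thesis using D(3) by blast
  qed
  have comp: "C i \<in> components W" if i: "i \<in> I" for i
    unfolding in_components_maximal
  proof (intro conjI allI impI)
    fix D assume "D \<noteq> {} \<and> C i \<subseteq> D \<and> D \<subseteq> W \<and> connected D"
    then show "D = C i" using sub[OF i, of D] ne[OF i] by blast
  qed (use i W conn ne in auto)
  show ?thesis
  proof (intro equalityI subsetI)
    fix D assume D: "D \<in> components W"
    then have D': "D \<noteq> {}" "D \<subseteq> W" by (auto simp: in_components_maximal)
    then obtain i where i: "i \<in> I" "D \<inter> C i \<noteq> {}" using W by blast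
    then have "D = C i" using components_nonoverlap[OF D comp[OF i(1)]] by blast
    then show "D \<in> C ` I" using i by blast
  qed (use comp in auto)
qed

lemma core_boundary:
  assumes "convex_cell q" "z \<in> core q" "z \<notin> interior (region q)"
  shows "\<exists>t. 0 < t \<and> t < 1 \<and> (z = t *\<^sub>R bl q \<or> z = t *\<^sub>R br q)"
proof -
  have c: "convex_quad (br q) (dg q) (bl q)" using assms(1) by (simp add: convex_cell_def)
  then have pos: "cross (br q) (dg q) > 0" "cross (dg q) (bl q) > 0" "cross (br q) (bl q) > 0"
    by (auto simp: convex_quad_def)
  have ne: "br q \<noteq> 0" "bl q \<noteq> 0" using pos by (auto simp: cross_simps)
  note z = assms(2)[unfolded core_def half_open_quad_def mem_Collect_eq]
  have "cross (br q) z = 0 \<or> cross (bl q) z = 0"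
    using z assms(3) cross_swap[of "bl q" z] unfolding interior_cell[OF assms(1)] open_quad_def by auto
  then show ?thesis
  proof
    assume "cross (br q) z = 0"
    then obtain t where t: "z = t *\<^sub>R br q" using cross_0_collinear ne by metis
    have "cross z (bl q) = t * cross (br q) (bl q)" "cross (dg q - br q) (z - br q) = (1 - t) * cross (br q) (dg q)"
      unfolding t by (simp_all add: cross_def algebra_simps)
    then have "0 \<le> t" "t < 1" using z pos by (auto simp: zero_le_mult_iff zero_less_mult_iff)
    moreover have "t \<noteq> 0" using z t by auto
    ultimately show ?thesis using t by (intro exI[of _ t]) auto
  next
    assume "cross (bl q) z = 0"
    then obtain t where t: "z = t *\<^sub>R bl q" using cross_0_collinear ne by metis
    have "cross (br q) z = t * cross (br q) (bl q)" "cross (bl q - dg q) (z - dg q) = (1 - t) * cross (dg q) (bl q)"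
      unfolding t by (simp_all add: cross_def algebra_simps)
    then have "0 \<le> t" "t < 1" using z pos by (auto simp: zero_le_mult_iff zero_less_mult_iff)
    moreover have "t \<noteq> 0" using z t by auto
    ultimately show ?thesis using t by (intro exI[of _ t]) auto
  qed
qed

lemma bottom_sides_not_interior:
  assumes "convex_cell q"
  shows "t *\<^sub>R bl q \<notin> interior (region q)" "t *\<^sub>R br q \<notin> interior (region q)"
  by (simp_all add: interior_cell[OF assms] open_quad_def cross_simps)

text \<open>By injectivity on the cores, a point of one core can lie on a side of another cell only
  if both the cells and the points are equal; membership is thus decided inside a single
  cell.\<close>

lemma side_union_iff:
  assumes g: "glued_quads pl pr q" and i: "i \<in> {1..3}" and z: "z \<in> core (q i)"
  shows "emb (q i) z \<in> side_union q \<longleftrightarrow> z \<notin> interior (region (q i))"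
proof
  assume "z \<notin> interior (region (q i))"
  then obtain t where "0 < t" "t < 1" "z = t *\<^sub>R bl (q i) \<or> z = t *\<^sub>R br (q i)"
    using core_boundary[OF glued_quadsD(1)[OF g i] z] by blast
  then have "z \<in> (\<lambda>t. t *\<^sub>R bl (q i)) ` {0..1} \<or> z \<in> (\<lambda>t. t *\<^sub>R br (q i)) ` {0..1}" by auto
  then have "emb (q i) z \<in> bottom_left (q i) \<union> bottom_right (q i)"
    unfolding bottom_left_def bottom_right_def segment_0 by blast
  then show "emb (q i) z \<in> side_union q" using i unfolding side_union_def by blast
next
  assume "emb (q i) z \<in> side_union q"
  then obtain j t where j: "j \<in> {1..3}" "0 \<le> t" "t \<le> 1"
    "emb (q i) z = emb (q j) (t *\<^sub>R bl (q j)) \<or> emb (q i) z = emb (q j) (t *\<^sub>R br (q j))"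
    unfolding side_union_def bottom_left_def bottom_right_def segment_0 by fastforce
  have ns: "emb (q i) z \<noteq> sing" by (rule core_nonsing[OF g i z])
  then have "t \<noteq> 0" "t \<noteq> 1" using glued_vertices[OF g j(1)] j(4) by auto
  then have t: "0 < t" "t < 1" using j by auto
  from j(4) show "z \<notin> interior (region (q i))"
    using core_inj[OF g i j(1) z bottom_side_core(1)[OF g j(1) t]]
      core_inj[OF g i j(1) z bottom_side_core(2)[OF g j(1) t]]
      bottom_sides_not_interior[OF glued_quadsD(1)[OF g i]] by metis
qed

lemma sing_in_side_union:
  assumes g: "glued_quads pl pr q"
  shows "sing \<in> side_union q"
proof -
  have "emb (q 1) 0 \<in> bottom_left (q 1)" unfolding bottom_left_def by (intro imageI) simp
  then show ?thesis using glued_quadsD(3)[OF g, of 1] unfolding side_union_def by fastforce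
qed

lemma closed_cell_diff:
  assumes g: "glued_quads pl pr q" and i: "i \<in> {1..3}"
  shows "closed_cell (q i) - side_union q = open_cell (q i)"
proof (intro equalityI subsetI)
  note D = glued_quadsD[OF g]
  fix x assume x: "x \<in> closed_cell (q i) - side_union q"
  then obtain z where z: "z \<in> region (q i)" "x = emb (q i) z" by (auto simp: closed_cell_def)
  from g i z(1) show "x \<in> open_cell (q i)"
  proof (cases rule: region_cases)
    case 1
    then show ?thesis using x z side_union_iff[OF g i] by (auto simp: open_cell_def)
  next
    case 2
    then show ?thesis using glued_vertices[OF g i] sing_in_side_union[OF g] x z by auto
  next
    case (3 t)
    have "x = emb (q (pr i)) (t *\<^sub>R bl (q (pr i)))" using D(7)[OF i, of t] 3 z by simp
    then have "x \<in> side_union q"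
      using side_union_iff[OF g D(9)[OF i] 3(4)] bottom_sides_not_interior(1)[OF D(1)[OF D(9)[OF i]]] by auto
    then show ?thesis using x by simp
  next
    case (4 t)
    have "x = emb (q (pl i)) (t *\<^sub>R br (q (pl i)))" using D(6)[OF i, of t] 4 z by simp
    then have "x \<in> side_union q"
      using side_union_iff[OF g D(8)[OF i] 4(4)] bottom_sides_not_interior(2)[OF D(1)[OF D(8)[OF i]]] by auto
    then show ?thesis using x by simp
  qed
next
  fix x assume "x \<in> open_cell (q i)"
  then obtain z where z: "z \<in> interior (region (q i))" "x = emb (q i) z" by (auto simp: open_cell_def)
  then have "z \<in> core (q i)" using interior_subset_core[OF glued_quadsD(1)[OF g i]] by blast
  then show "x \<in> closed_cell (q i) - side_union q"
    using z side_union_iff[OF g i] interior_subset[of "region (q i)"] by (auto simp: closed_cell_def)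
qed

lemma compact_region: "compact (region q)"
  unfolding region_def by (intro compact_Un finite_imp_compact_convex_hull) auto

text \<open>A closed cell is compact, hence closed in the Hausdorff surface, and removing the sides
  from it leaves exactly the open cell; so open cells are relatively closed. They are connected as
  images of interiors of convex sets.\<close>

lemma components_cells:
  assumes g: "glued_quads pl pr q"
  shows "components (UNIV - side_union q) = cells q"
  unfolding cells_def
proof (rule components_of_disjoint_clopen)
  note D = glued_quadsD[OF g]
  show "UNIV - side_union q = (\<Union>i\<in>{1..3}. open_cell (q i))"
  proof (intro equalityI subsetI)
    fix x assume x: "x \<in> UNIV - side_union q"
    then have "x \<noteq> sing" using sing_in_side_union[OF g] by auto
    then obtain i z where "i \<in> {1..3}" "z \<in> core (q i)" "emb (q i) z = x" by (rule core_surj[OF g])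
    then show "x \<in> (\<Union>i\<in>{1..3}. open_cell (q i))"
      using x side_union_iff[OF g] by (force simp: open_cell_def)
  next
    fix x assume "x \<in> (\<Union>i\<in>{1..3}. open_cell (q i))"
    then show "x \<in> UNIV - side_union q" using closed_cell_diff[OF g] by blast
  qed
  show "disjoint_family_on (\<lambda>i. open_cell (q i)) {1..3}"
    unfolding disjoint_family_on_def
  proof (intro ballI impI)
    fix i j assume ij: "i \<in> {1..3::nat}" "j \<in> {1..3::nat}" "i \<noteq> j"
    show "open_cell (q i) \<inter> open_cell (q j) = {}"
      using core_inj(1)[OF g ij(1,2)] ij(3) interior_subset_core[OF D(1)[OF ij(1)]]
        interior_subset_core[OF D(1)[OF ij(2)]]
      by (fastforce simp: open_cell_def)
  qed
  fix i assume i: "i \<in> {1..3::nat}"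
  have c: "convex_quad (br (q i)) (dg (q i)) (bl (q i))" using D(1)[OF i] by (simp add: convex_cell_def)
  have cont: "continuous_on (region (q i)) (emb (q i))"
    by (rule translation_on_continuous[OF D(2)[OF i]])
  have "convex (closed_quad (br (q i)) (dg (q i)) (bl (q i)))"
  proof -
    have "closed_quad (br (q i)) (dg (q i)) (bl (q i)) =
        {z. inner (vec2 (- br (q i)$2) (br (q i)$1)) z \<ge> 0} \<inter> {z. inner (vec2 (bl (q i)$2) (- bl (q i)$1)) z \<ge> 0} \<inter>
        {z. inner (vec2 (- (dg (q i) - br (q i))$2) ((dg (q i) - br (q i))$1)) z \<ge> cross (dg (q i) - br (q i)) (br (q i))} \<inter>
        {z. inner (vec2 (- (bl (q i) - dg (q i))$2) ((bl (q i) - dg (q i))$1)) z \<ge> cross (bl (q i) - dg (q i)) (dg (q i))}"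
      by (auto simp: closed_quad_def inner_vec_def sum_2 cross_def algebra_simps)
    then show ?thesis by (simp only:) (intro convex_Int convex_halfspace_ge)
  qed
  then have "convex (region (q i))" using region_cell[OF D(1)[OF i]] by simp
  then have "connected (interior (region (q i)))" by (intro convex_connected convex_interior)
  then show "connected (open_cell (q i))"
    unfolding open_cell_def
    by (rule connected_continuous_image[OF continuous_on_subset[OF cont interior_subset]])
  have "(1 / 2) *\<^sub>R (dg (q i)) \<in> open_quad (br (q i)) (dg (q i)) (bl (q i))"
  proof -
    have "cross (dg (q i) - br (q i)) ((1 / 2) *\<^sub>R dg (q i) - br (q i)) = cross (br (q i)) (dg (q i)) / 2"
      "cross (bl (q i) - dg (q i)) ((1 / 2) *\<^sub>R dg (q i) - dg (q i)) = cross (dg (q i)) (bl (q i)) / 2"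
      by (simp_all add: cross_def algebra_simps diff_divide_distrib)
    then show ?thesis using c by (simp add: open_quad_def convex_quad_def cross_simps(5,6))
  qed
  then show "open_cell (q i) \<noteq> {}"
    unfolding open_cell_def interior_cell[OF D(1)[OF i]] by blast
  have "closed (closed_cell (q i))"
    unfolding closed_cell_def by (intro compact_imp_closed compact_continuous_image cont compact_region)
  then have "closedin (top_of_set (UNIV - side_union q)) ((UNIV - side_union q) \<inter> closed_cell (q i))"
    by (rule closedin_closed_Int)
  moreover have "(UNIV - side_union q) \<inter> closed_cell (q i) = open_cell (q i)"
    using closed_cell_diff[OF g i] by blast
  ultimately show "closedin (top_of_set (UNIV - side_union q)) (open_cell (q i))" by simp
qed simp

lemma cells_eq_Q0:
  assumes g: "glued_quads pl pr q"
    and bl: "\<And>i. i \<in> {1..3} \<Longrightarrow> \<exists>l>0. bl (q i) = l *\<^sub>R vec2 (1 + sqrt 2) 1"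
    and br: "\<And>i. i \<in> {1..3} \<Longrightarrow> \<exists>l>0. br (q i) = l *\<^sub>R vec2 1 0"
  shows "cells q = Q0"
  using components_cells[OF g] side_union_cuts[OF assms] by (simp add: Q0_def)

lemma act_act:
  assumes "surf_aut A B f g"
  shows "act A (act B Q) = Q" "act B (act A Q) = Q"
proof -
  have "aut_of A = f" "aut_of B = g" using assms aut_of_eq surf_aut_inverse by blast+
  then show "act A (act B Q) = Q" "act B (act A Q) = Q"
    unfolding act_def using surf_autD(3,4)[OF assms] by (auto simp: image_image)
qed

text \<open>The moves in cycles of \<open>pl\<close> are the mirror images of those in cycles of \<open>pr\<close>.\<close>

lemma left_move:
  assumes g: "glued_quads pl pr q" and s: "straddles \<theta> q" and c: "c \<subseteq> {1..3}" "cyclic_on pl c"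
    and right: "\<And>i. i \<in> c \<Longrightarrow> right_of \<theta> (dg (q i))"
  shows "\<exists>q'. glued_quads pl (\<lambda>i. if i \<in> c then pr (pl i) else pr i) q' \<and> straddles \<theta> q' \<and>
     diagonal_change \<theta> (cells q) (cells q') \<and>
     (\<forall>i. bl (q' i) = bl (q i) \<and> br (q' i) = (if i \<in> c then dg (q i) else br (q i)))"
proof -
  \<comment> \<open>The reflection \<open>nu 7\<close> exchanges the two permutations and turns
    \<open>\<theta>\<close> into \<open>pi - \<theta>\<close>; as an involution it also carries the
    result back.\<close>
  obtain f where f: "surf_aut (nu 7) (nu 7) f f" using nu_7_aut by blast
  have det: "\<not> det (nu 7) > 0" by (simp add: nu_eqs mat2_det)
  have d1: "nu 7 *v dir \<theta> = 1 *\<^sub>R dir (pi - \<theta>)" and d2: "nu 7 *v dir (pi - \<theta>) = 1 *\<^sub>R dir \<theta>"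
    by (simp_all add: nu_eqs mat2_vec dir_def)
  let ?P = "push (nu 7) (nu 7) f"
  note D = surf_autD[OF f]
  have g1: "glued_quads pr pl (\<lambda>i. ?P (q i))"
    using glued_push[OF f g] det by simp
  have s1: "straddles (pi - \<theta>) (\<lambda>i. ?P (q i))"
    by (rule straddles_push[OF f d1 _ s]) simp
  have l1: "left_of (pi - \<theta>) (dg (?P (q i)))" if "i \<in> c" for i
    using right[OF that] det side_push(1)[OF f d1, of "dg (q i)"] by (simp add: push_def)
  obtain q2 where q2: "glued_quads (\<lambda>i. if i \<in> c then pr (pl i) else pr i) pl q2" "straddles (pi - \<theta>) q2"
    "diagonal_change (pi - \<theta>) (cells (\<lambda>i. ?P (q i))) (cells q2)"
    "\<And>i. br (q2 i) = br (?P (q i)) \<and> bl (q2 i) = (if i \<in> c then dg (?P (q i)) else bl (?P (q i)))"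
    using right_move[OF g1 s1 c l1] by blast
  show ?thesis
  proof (intro exI[of _ "\<lambda>i. ?P (q2 i)"] conjI allI)
    show "glued_quads pl (\<lambda>i. if i \<in> c then pr (pl i) else pr i) (\<lambda>i. ?P (q2 i))"
      using glued_push[OF f q2(1)] det by simp
    show "straddles \<theta> (\<lambda>i. ?P (q2 i))"
      by (rule straddles_push[OF f d2 _ q2(2)]) simp
    show "diagonal_change \<theta> (cells q) (cells (\<lambda>i. ?P (q2 i)))"
      using diagonal_change_push[OF f d2 _ q2(3)] act_act(1)[OF f] by (simp add: cells_push[OF f])
    fix i
    show "bl (?P (q2 i)) = bl (q i)" "br (?P (q2 i)) = (if i \<in> c then dg (q i) else br (q i))"
      using q2(4)[of i] det D(1) by (simp_all add: push_def)
  qed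
qed

section \<open>Affine automorphisms from matching decompositions\<close>

text \<open>The vector \<open>w - v\<close> is a difference of two point shifts. There are finitely
  many of these, so the nonzero ones have a positive minimal length. Hence, near a given point, the
  target determines the displacement, even at the singularity.\<close>

lemma small_shifts_eq:
  obtains e where "e > 0" "\<And>p p' v w. p \<in> octagon \<Longrightarrow> p' \<in> octagon \<Longrightarrow> p + v \<in> octagon \<Longrightarrow> p' + w \<in> octagon \<Longrightarrow>
     proj p = proj p' \<Longrightarrow> proj (p + v) = proj (p' + w) \<Longrightarrow> norm v < e \<Longrightarrow> norm w < e \<Longrightarrow> v = w"
proof -
  let ?D = "(\<lambda>(a, b). a - b) ` (point_shifts \<times> point_shifts)"
  have "\<exists>e>0. \<forall>d\<in>?D - {0}. 2 * e \<le> norm d"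
  proof (rule finite_common_radius)
    show "finite (?D - {0})" using finite_point_shifts by blast
    show "\<exists>e>0. 2 * e \<le> norm d" if "d \<in> ?D - {0}" for d
      using that by (intro exI[of _ "norm d / 2"]) auto
  qed auto
  then obtain e where e: "e > 0" "\<And>d. d \<in> ?D \<Longrightarrow> d \<noteq> 0 \<Longrightarrow> 2 * e \<le> norm d" by blast
  have "v = w" if *: "p \<in> octagon" "p' \<in> octagon" "p + v \<in> octagon" "p' + w \<in> octagon"
     "proj p = proj p'" "proj (p + v) = proj (p' + w)" "norm v < e" "norm w < e" for p p' v w
  proof (rule ccontr)
    assume "v \<noteq> w"
    have "p' + w - (p + v) \<in> point_shifts" "p' - p \<in> point_shifts"
      using proj_eq_shift * by blast+
    then have "(p' + w - (p + v)) - (p' - p) \<in> ?D" by (intro image_eqI[of _ _ "(p' + w - (p + v), p' - p)"]) auto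
    then have "w - v \<in> ?D" by simp
    then have "2 * e \<le> norm (w - v)" using e(2) \<open>v \<noteq> w\<close> by simp
    also have "\<dots> \<le> norm w + norm v" by (rule norm_triangle_ineq4)
    finally show False using * by simp
  qed
  then show thesis using that e(1) by blast
qed

text \<open>A map is locally affine if it is affine on each piece of a finite closed cover: a point near \<open>x\<close> that lies
  in a piece is near one of the points over \<open>x\<close> in that piece, by compactness.\<close>

lemma locally_affineI:
  assumes fin: "finite I" and cpt: "\<And>i. i \<in> I \<Longrightarrow> compact (R i)"
    and tr: "\<And>i. i \<in> I \<Longrightarrow> translation_on (R i) (\<phi> i)"
    and tr': "\<And>i. i \<in> I \<Longrightarrow> translation_on ((\<lambda>z. A *v z) ` R i) (\<psi> i)"
    and cover: "\<And>x. \<exists>i\<in>I. \<exists>z\<in>R i. \<phi> i z = x"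
    and f: "\<And>i z. i \<in> I \<Longrightarrow> z \<in> R i \<Longrightarrow> f (\<phi> i z) = \<psi> i (A *v z)"
  shows "locally_affine A f"
  unfolding locally_affine_def
proof
  fix x
  obtain d where d: "d > 0" "\<And>p p' v w. p \<in> octagon \<Longrightarrow> p' \<in> octagon \<Longrightarrow> p + v \<in> octagon \<Longrightarrow> p' + w \<in> octagon \<Longrightarrow>
     proj p = proj p' \<Longrightarrow> proj (p + v) = proj (p' + w) \<Longrightarrow> norm v < d \<Longrightarrow> norm w < d \<Longrightarrow> v = w"
    using small_shifts_eq by blast
  let ?goal = "\<lambda>p v. \<exists>p'\<in>octagon. proj p' = f x \<and> p' + A *v v \<in> octagon \<and> proj (p' + A *v v) = f (proj (p + v))"
  let ?P = "\<lambda>i e. \<forall>p v. p \<in> octagon \<and> proj p = x \<and> norm v < e \<and> p + v \<in> octagon \<and> (\<exists>z\<in>R i. \<phi> i z = proj (p + v)) \<longrightarrow> ?goal p v"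
  have "\<exists>e>0. \<forall>i\<in>I. ?P i e"
  proof (rule finite_common_radius[OF fin])
    fix i assume i: "i \<in> I"
    have "\<exists>e>0. e \<le> d \<and> (\<forall>z'\<in>R i \<inter> ball z e. (\<exists>p\<in>octagon. p + (z' - z) \<in> octagon \<and> proj p = x \<and> proj (p + (z' - z)) = \<phi> i z') \<and>
        (\<exists>p'\<in>octagon. p' + A *v (z' - z) \<in> octagon \<and> proj p' = f x \<and> proj (p' + A *v (z' - z)) = f (\<phi> i z')))"
      if z: "z \<in> R i" "\<phi> i z = x" for z
    proof -
      obtain e1 where e1: "e1 > 0" "\<And>w. w \<in> R i \<inter> ball z e1 \<Longrightarrow>
          \<exists>p\<in>octagon. p + (w - z) \<in> octagon \<and> proj p = \<phi> i z \<and> proj (p + (w - z)) = \<phi> i w"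
        using tr[OF i] z(1) unfolding translation_on_def by meson
      have "A *v z \<in> (\<lambda>z. A *v z) ` R i" using z(1) by blast
      then obtain e2 where e2: "e2 > 0" "\<And>w. w \<in> (\<lambda>z. A *v z) ` R i \<inter> ball (A *v z) e2 \<Longrightarrow>
          \<exists>p\<in>octagon. p + (w - A *v z) \<in> octagon \<and> proj p = \<psi> i (A *v z) \<and> proj (p + (w - A *v z)) = \<psi> i w"
        using tr'[OF i] unfolding translation_on_def by meson
      obtain e3 where e3: "e3 > 0" "\<And>v. norm v < e3 \<Longrightarrow> norm (A *v v) < e2"
        using matrix_vector_small[OF e2(1)] by metis
      have m: "A *v v - A *v w = A *v (v - w)" for v w by (simp add: matrix_vector_mult_diff_distrib)
      show ?thesis
      proof (intro exI[of _ "min (min e1 e3) d"] conjI ballI)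
        fix z' assume z': "z' \<in> R i \<inter> ball z (min (min e1 e3) d)"
        then show "\<exists>p\<in>octagon. p + (z' - z) \<in> octagon \<and> proj p = x \<and> proj (p + (z' - z)) = \<phi> i z'"
          using e1(2)[of z'] z(2) by auto
        have "norm (z - z') < e3" using z' by (simp add: dist_norm)
        then have "norm (A *v (z - z')) < e2" by (rule e3(2))
        then have "A *v z' \<in> (\<lambda>z. A *v z) ` R i \<inter> ball (A *v z) e2"
          using z' by (simp add: dist_norm m)
        from e2(2)[OF this] show "\<exists>p'\<in>octagon. p' + A *v (z' - z) \<in> octagon \<and> proj p' = f x \<and>
            proj (p' + A *v (z' - z)) = f (\<phi> i z')"
          using f[OF i] z z' by (simp add: m) metis
      qed (use e1(1) e3(1) d(1) in auto)
    qed
    then obtain r where r: "\<And>z. z \<in> R i \<Longrightarrow> \<phi> i z = x \<Longrightarrow> r z > 0 \<and> r z \<le> d"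
      "\<And>z z'. z \<in> R i \<Longrightarrow> \<phi> i z = x \<Longrightarrow> z' \<in> R i \<inter> ball z (r z) \<Longrightarrow>
        (\<exists>p\<in>octagon. p + (z' - z) \<in> octagon \<and> proj p = x \<and> proj (p + (z' - z)) = \<phi> i z') \<and>
        (\<exists>p'\<in>octagon. p' + A *v (z' - z) \<in> octagon \<and> proj p' = f x \<and> proj (p' + A *v (z' - z)) = f (\<phi> i z'))"
      by metis
    define U where "U = (\<Union>z\<in>{z \<in> R i. \<phi> i z = x}. ball z (r z))"
    have "open U" by (auto simp: U_def)
    then have "compact (R i - U)" using cpt[OF i] by (simp add: compact_diff)
    then have "compact (\<phi> i ` (R i - U))"
      by (intro compact_continuous_image continuous_on_subset[OF translation_on_continuous[OF tr[OF i]]]) auto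
    then have "open (- \<phi> i ` (R i - U))" by (intro open_Compl compact_imp_closed)
    moreover have "x \<notin> \<phi> i ` (R i - U)"
    proof
      assume "x \<in> \<phi> i ` (R i - U)"
      then obtain z where "z \<in> R i" "z \<notin> U" "\<phi> i z = x" by auto
      then show False using r(1)[of z] by (auto simp: U_def)
    qed
    ultimately obtain e where e: "e > 0" "\<And>p v. p \<in> octagon \<Longrightarrow> proj p = x \<Longrightarrow> norm v < e \<Longrightarrow> p + v \<in> octagon \<Longrightarrow>
        proj (p + v) \<in> - \<phi> i ` (R i - U)"
      using surf_nhd[of "- \<phi> i ` (R i - U)" x] by (metis ComplI)
    have "?goal p v" if p: "p \<in> octagon" "proj p = x" "norm v < min e d" "p + v \<in> octagon" "z' \<in> R i" "\<phi> i z' = proj (p + v)" for p v z'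
    proof -
      have "proj (p + v) \<notin> \<phi> i ` (R i - U)" using e(2)[OF p(1,2) _ p(4)] p(3) by auto
      then have "z' \<in> U" using p(5) p(6)[symmetric] by blast
      then obtain z where z: "z \<in> R i" "\<phi> i z = x" "z' \<in> ball z (r z)" by (auto simp: U_def)
      have z': "z' \<in> R i \<inter> ball z (r z)" using z(3) p(5) by blast
      obtain p2 where p2: "p2 \<in> octagon" "p2 + (z' - z) \<in> octagon" "proj p2 = x" "proj (p2 + (z' - z)) = \<phi> i z'"
        using r(2)[OF z(1,2) z'] by blast
      have "norm (z' - z) < d" using z(3) r(1)[OF z(1,2)] by (simp add: dist_norm norm_minus_commute)
      \<comment> \<open>The displacement seen in the octagon and the one seen in the piece lead from
        \<open>x\<close> to the same point, so they coincide.\<close>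
      then have "v = z' - z" using d(2)[OF p(1) p2(1) p(4) p2(2)] p(2,3,6) p2(3,4) by simp
      then show ?thesis using r(2)[OF z(1,2) z'] p(6) by auto
    qed
    then have "?P i (min e d)" by blast
    then show "\<exists>e>0. ?P i e" using e(1) d(1) by (intro exI[of _ "min e d"]) simp
  next
    fix i :: 'a and e e' :: real assume "?P i e" "0 < e'" "e' \<le> e"
    show "?P i e'"
    proof (intro allI impI)
      fix p v assume *: "p \<in> octagon \<and> proj p = x \<and> norm v < e' \<and> p + v \<in> octagon \<and> (\<exists>z\<in>R i. \<phi> i z = proj (p + v))"
      then have "norm v < e" using \<open>e' \<le> e\<close> by simp
      then show "?goal p v" using \<open>?P i e\<close> * by blast
    qed
  qed
  then obtain e where e: "e > 0" "\<And>i. i \<in> I \<Longrightarrow> ?P i e" by blast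
  show "\<exists>e>0. \<forall>p v. p \<in> octagon \<and> proj p = x \<and> norm v < e \<and> p + v \<in> octagon \<longrightarrow> ?goal p v"
  proof (intro exI[of _ e] conjI allI impI e(1))
    fix p v assume *: "p \<in> octagon \<and> proj p = x \<and> norm v < e \<and> p + v \<in> octagon"
    obtain i where "i \<in> I" "\<exists>z\<in>R i. \<phi> i z = proj (p + v)" using cover by blast
    then show "?goal p v" using e(2) * by blast
  qed
qed

text \<open>This yields the automorphism with derivative \<^const>\<open>gam\<close>: it preserves each parallelogram of
  \<^const>\<open>Q0\<close> and reverses its horizontal sides.\<close>

lemma parallelogram_reflection:
  assumes g: "glued_quads pl pr q" and AA: "A ** A = mat 1" and det: "det A = - 1"
    and bl: "\<And>i. i \<in> {1..3} \<Longrightarrow> A *v bl (q i) = bl (q i)" and br: "\<And>i. i \<in> {1..3} \<Longrightarrow> A *v br (q i) = - br (q i)"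
    and par: "\<And>i. i \<in> {1..3} \<Longrightarrow> br (q (pl i)) = br (q i)" "\<And>i. i \<in> {1..3} \<Longrightarrow> bl (q (pr i)) = bl (q i)"
    and invol: "\<And>i. i \<in> {1..3} \<Longrightarrow> pr (pr i) = i"
  shows "\<exists>f. surf_aut A A f f \<and> act A (cells q) = cells q"
proof -
  note D = glued_quadsD[OF g]
  \<comment> \<open>\<open>A\<close> fixes the left side and reverses the right one; the shift by
    \<open>br (q i)\<close> brings the image back onto the parallelogram.\<close>
  let ?\<rho> = "\<lambda>i z. A *v z + br (q i)"
  have A2: "A *v (A *v z) = z" for z using AA by (simp add: matrix_vector_mul_assoc)
  have \<rho>\<rho>: "?\<rho> i (?\<rho> i z) = z" if "i \<in> {1..3}" for i z
    by (simp add: matrix_vector_right_distrib A2 br[OF that])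
  have dg: "dg (q i) = bl (q i) + br (q i)" if "i \<in> {1..3}" for i
    using D(4)[OF that] par(1)[OF that] by simp
  have crossA: "cross (A *v a) (A *v b) = - cross a b" for a b
    by (simp add: cross_matrix det)
  have cr: "cross (br (q i)) (?\<rho> i z) = cross (br (q i)) z"
    "cross (?\<rho> i z) (bl (q i)) = cross (bl (q i)) (z - br (q i))"
    "cross (bl (q i)) (?\<rho> i z - br (q i)) = cross z (bl (q i))"
    "cross (- br (q i)) (?\<rho> i z - dg (q i)) = cross (- br (q i)) (z - dg (q i))" if i: "i \<in> {1..3}" for i z
  proof -
    have 1: "cross (br (q i)) (A *v z) = cross (br (q i)) z"
      using crossA[of "br (q i)" z] by (simp add: br[OF i] cross_simps)
    have 2: "cross (A *v z) (bl (q i)) = cross (bl (q i)) z" "cross (bl (q i)) (A *v z) = - cross (bl (q i)) z"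
      using crossA[of z "bl (q i)"] crossA[of "bl (q i)" z] cross_swap[of z] by (simp_all add: bl[OF i])
    show "cross (br (q i)) (?\<rho> i z) = cross (br (q i)) z"
      "cross (?\<rho> i z) (bl (q i)) = cross (bl (q i)) (z - br (q i))"
      "cross (bl (q i)) (?\<rho> i z - br (q i)) = cross z (bl (q i))"
      "cross (- br (q i)) (?\<rho> i z - dg (q i)) = cross (- br (q i)) (z - dg (q i))"
      using 1 2 cross_swap[of "br (q i)" "bl (q i)"] cross_swap[of z "bl (q i)"]
      by (simp_all add: cross_simps dg[OF i])
  qed
  have db: "dg (q i) - br (q i) = bl (q i)" "bl (q i) - dg (q i) = - br (q i)" if "i \<in> {1..3}" for i
    by (simp_all add: dg[OF that])
  have reg: "?\<rho> i z \<in> region (q i)" if i: "i \<in> {1..3}" and z: "z \<in> region (q i)" for i z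
    using z unfolding region_cell[OF D(1)[OF i]] closed_quad_def db[OF i] mem_Collect_eq cr[OF i] by blast
  have int: "?\<rho> i z \<in> interior (region (q i))" if i: "i \<in> {1..3}" and z: "z \<in> interior (region (q i))" for i z
    using z unfolding interior_cell[OF D(1)[OF i]] open_quad_def db[OF i] mem_Collect_eq cr[OF i] by blast
  \<comment> \<open>A nonsingular point lies in exactly one core, so the description is
    well-defined. The formula for points on the top sides is a matter of compatibility with the
    gluing, shown in \<open>f_emb\<close>.\<close>
  define f where "f x = (if x = sing then sing else
     (THE y. \<exists>i\<in>{1..3}. \<exists>z\<in>core (q i). emb (q i) z = x \<and> y = emb (q i) (?\<rho> i z)))" for x
  have f_core: "f (emb (q i) z) = emb (q i) (?\<rho> i z)" if i: "i \<in> {1..3}" and z: "z \<in> core (q i)" for i z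
  proof -
    have "(THE y. \<exists>j\<in>{1..3}. \<exists>w\<in>core (q j). emb (q j) w = emb (q i) z \<and> y = emb (q j) (?\<rho> j w)) = emb (q i) (?\<rho> i z)"
    proof (rule the_equality)
      fix y assume "\<exists>j\<in>{1..3}. \<exists>w\<in>core (q j). emb (q j) w = emb (q i) z \<and> y = emb (q j) (?\<rho> j w)"
      then show "y = emb (q i) (?\<rho> i z)" using core_inj[OF g _ i _ z] by blast
    qed (use i z in blast)
    then show ?thesis using core_nonsing[OF g i z] by (simp add: f_def)
  qed
  have f_sing: "f sing = sing" by (simp add: f_def)
  have f_emb: "f (emb (q i) z) = emb (q i) (?\<rho> i z)" if i: "i \<in> {1..3}" and z: "z \<in> region (q i)" for i z
    using g i z
  proof (cases rule: region_cases)
    case 1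
    then show ?thesis using f_core[OF i] by blast
  next
    case 2
    then have "?\<rho> i z \<in> {0, br (q i), dg (q i), bl (q i)}"
      using bl[OF i] br[OF i] dg[OF i] by (auto simp: matrix_vector_right_distrib)
    then show ?thesis using glued_vertices[OF g i] 2 f_sing by metis
  next
    case (3 t)
    \<comment> \<open>The reflection in the neighbour takes its bottom left side to its top right
      side, which is glued to the bottom left side of cell \<open>pr (pr i) = i\<close>. This is
      where the involution enters.\<close>
    let ?j = "pr i"
    have j: "?j \<in> {1..3}" using D(9)[OF i] .
    have "emb (q i) z = emb (q ?j) (t *\<^sub>R bl (q ?j))" using D(7)[OF i, of t] 3 by simp
    then have "f (emb (q i) z) = emb (q ?j) (br (q ?j) + t *\<^sub>R bl (q ?j))"
      using f_core[OF j 3(4)] by (simp add: matrix_vector_mult_scaleR bl[OF j] add.commute)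
    also have "\<dots> = emb (q i) (t *\<^sub>R bl (q i))"
      using D(7)[OF j, of t] 3(1,2) par(2)[OF j] par(2)[OF i] invol[OF i] by simp
    also have "t *\<^sub>R bl (q i) = ?\<rho> i z"
      using 3(3) par(2)[OF i] by (simp add: matrix_vector_right_distrib matrix_vector_mult_scaleR bl[OF i] br[OF i])
    finally show ?thesis .
  next
    case (4 t)
    let ?j = "pl i"
    have j: "?j \<in> {1..3}" using D(8)[OF i] .
    have "emb (q i) z = emb (q ?j) (t *\<^sub>R br (q ?j))" using D(6)[OF i, of t] 4 by simp
    then have "f (emb (q i) z) = emb (q ?j) ((1 - t) *\<^sub>R br (q ?j))"
      using f_core[OF j 4(4)] by (simp add: matrix_vector_mult_scaleR br[OF j] algebra_simps)
    also have "\<dots> = emb (q i) (bl (q i) + (1 - t) *\<^sub>R br (q ?j))"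
      using D(6)[OF i, of "1 - t"] 4(1,2) by simp
    also have "bl (q i) + (1 - t) *\<^sub>R br (q ?j) = ?\<rho> i z"
      using 4(3) par(1)[OF i]
      by (simp add: matrix_vector_right_distrib matrix_vector_mult_scaleR bl[OF i] br[OF i] algebra_simps)
    finally show ?thesis .
  qed
  have cover: "\<exists>i\<in>{1..3}. \<exists>z\<in>region (q i). emb (q i) z = x" for x
  proof (cases "x = sing")
    case True
    have "0 \<in> region (q 1)" unfolding region_def by (auto intro: hull_inc)
    then show ?thesis using True D(3)[of 1] by (intro bexI[of _ 1] bexI[of _ 0]) auto
  next
    case False
    then obtain i z where "i \<in> {1..3}" "z \<in> core (q i)" "emb (q i) z = x" by (rule core_surj[OF g])
    then show ?thesis using core_subset_region[OF D(1)] by blast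
  qed
  have "f (f x) = x" for x
  proof -
    obtain i z where iz: "i \<in> {1..3}" "z \<in> region (q i)" "emb (q i) z = x" using cover by blast
    have "f (f x) = emb (q i) (?\<rho> i (?\<rho> i z))"
      using f_emb[OF iz(1,2)] f_emb[OF iz(1) reg[OF iz(1,2)]] iz(3) by simp
    then show ?thesis unfolding \<rho>\<rho>[OF iz(1)] using iz(3) by simp
  qed
  then have ff: "f \<circ> f = id" by auto
  have "locally_affine A f"
  \<comment> \<open>\<open>A\<close> takes each region to its translate by
    \<open>- br (q i)\<close>, so shifted embeddings parametrize the images.\<close>
  proof (rule locally_affineI[where I = "{1..3}" and R = "\<lambda>i. region (q i)" and \<phi> = "\<lambda>i. emb (q i)"
        and \<psi> = "\<lambda>i w. emb (q i) (w - (- br (q i)))"])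
    fix i assume i: "i \<in> {1..3::nat}"
    have "(\<lambda>z. A *v z) ` region (q i) = (\<lambda>z. - br (q i) + z) ` region (q i)"
    proof (intro equalityI subsetI)
      fix w assume "w \<in> (\<lambda>z. A *v z) ` region (q i)"
      then obtain z where z: "z \<in> region (q i)" "w = A *v z" by auto
      then have "w = - br (q i) + ?\<rho> i z" by simp
      then show "w \<in> (\<lambda>z. - br (q i) + z) ` region (q i)" using reg[OF i z(1)] by blast
    next
      fix w assume "w \<in> (\<lambda>z. - br (q i) + z) ` region (q i)"
      then obtain z where z: "z \<in> region (q i)" "w = - br (q i) + z" by auto
      then have "w = A *v ?\<rho> i z" by (simp add: matrix_vector_right_distrib A2 br[OF i])
      then show "w \<in> (\<lambda>z. A *v z) ` region (q i)" using reg[OF i z(1)] by blast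
    qed
    then show "translation_on ((\<lambda>z. A *v z) ` region (q i)) (\<lambda>w. emb (q i) (w - (- br (q i))))"
      using translation_on_shift[OF D(2)[OF i], of "- br (q i)"] by simp
    show "f (emb (q i) z) = emb (q i) (A *v z - (- br (q i)))" if "z \<in> region (q i)" for z
      using f_emb[OF i that] by simp
  qed (use compact_region D(2) cover in auto)
  then have aut: "surf_aut A A f f" using AA ff f_sing by (simp add: surf_aut_def)
  have "f ` open_cell (q i) = open_cell (q i)" if i: "i \<in> {1..3}" for i
  proof -
    have *: "f x \<in> open_cell (q i)" if x: "x \<in> open_cell (q i)" for x
    proof -
      obtain z where z: "z \<in> interior (region (q i))" "x = emb (q i) z" using x by (auto simp: open_cell_def)
      then show ?thesis
        using f_emb[OF i] int[OF i z(1)] interior_subset[of "region (q i)"] by (auto simp: open_cell_def)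
    qed
    show ?thesis
    proof (intro equalityI subsetI)
      fix x assume "x \<in> open_cell (q i)"
      then have "f x \<in> open_cell (q i)" "f (f x) = x" using * \<open>\<And>x. f (f x) = x\<close> by blast+
      then show "x \<in> f ` open_cell (q i)" by (metis imageI)
    qed (use * in auto)
  qed
  then have "act A (cells q) = cells q"
    unfolding act_def cells_def aut_of_eq[OF aut] image_image by (intro image_cong) auto
  then show ?thesis using aut by blast
qed

section \<open>The octagon cut along its horizontal diagonals\<close>

text \<open>These pieces lie in the octagon, so their embeddings are translates of
  \<open>proj\<close>. The bottom vertices are chosen with all left sides in direction pi and the
  right sides in directions pi / 4, pi / 2 and 3 pi / 4, to be admissible for directions in sector
  6.\<close>

definition init_quads :: "nat \<Rightarrow> quad" where
  "init_quads i =
    (if i = 1 then \<lparr>bl = octv 0 - octv 1, br = octv 2 - octv 1, dg = octv 7 - octv 1, emb = (\<lambda>z. proj (octv 1 + z))\<rparr>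
     else if i = 2 then \<lparr>bl = octv 6 - octv 3, br = octv 4 - octv 3, dg = octv 5 - octv 3, emb = (\<lambda>z. proj (octv 3 + z))\<rparr>
     else \<lparr>bl = octv 7 - octv 2, br = octv 3 - octv 2, dg = octv 6 - octv 2, emb = (\<lambda>z. proj (octv 2 + z))\<rparr>)"

definition init_corner :: "nat \<Rightarrow> real^2" where
  "init_corner i = (if i = 1 then octv 1 else if i = 2 then octv 3 else octv 2)"

lemma emb_init: "emb (init_quads i) z = proj (init_corner i + z)"
  by (simp add: init_quads_def init_corner_def)

lemma one_to_three: "{1..3::nat} = {1, 2, 3}"
  by auto

lemma ball_one_to_three: "(\<forall>i\<in>{1..3::nat}. P i) \<longleftrightarrow> P 1 \<and> P 2 \<and> P 3"
  unfolding one_to_three by simp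

lemma convex_init: "i \<in> {1..3} \<Longrightarrow> convex_cell (init_quads i)"
  using sqrt2_bounds(1) unfolding one_to_three
  by (auto simp: init_quads_def convex_cell_def convex_quad_def octv_eqs vec2_arith cross_def algebra_simps
      add_divide_distrib diff_divide_distrib)

lemma init_region_octagon:
  assumes "i \<in> {1..3}" "z \<in> region (init_quads i)"
  shows "init_corner i + z \<in> octagon"
proof -
  have "convex_quad (br (init_quads i)) (dg (init_quads i)) (bl (init_quads i))"
    using convex_init[OF assms(1)] by (simp add: convex_cell_def)
  then have "(\<lambda>z. init_corner i + z) ` closed_quad (br (init_quads i)) (dg (init_quads i)) (bl (init_quads i)) \<subseteq> octagon"
    by (rule closed_quad_subset_octagon) (auto simp: init_quads_def init_corner_def octv_in_octagon)
  then show ?thesis using assms region_cell[OF convex_init] by blast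
qed

text \<open>A fundamental domain for the nonsingular points: from each pair of opposite sides only
  the one with index below 4 is kept. Up to the choice of origins, the three cores partition
  it.\<close>

definition half_open_octagon :: "(real^2) set" where
  "half_open_octagon = {p \<in> octagon. p \<notin> octverts \<and> (\<forall>k\<in>{4, 5, 6, 7}. \<not> on_side k p)}"

lemma half_open_octagon_inj:
  assumes "p \<in> half_open_octagon" "q \<in> half_open_octagon" "proj p = proj q"
  shows "p = q"
proof (rule ccontr)
  assume ne: "p \<noteq> q"
  have O: "p \<in> octagon" "q \<in> octagon" using assms(1,2) by (auto simp: half_open_octagon_def)
  have "q - p \<in> glue_vectors"
    using assms ne proj_eq_iff[OF O] by (auto simp: half_open_octagon_def)
  then obtain i where i: "i < 8" "on_side i p" "on_side ((i + 4) mod 8) q"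
    using glue_vector_sides[OF O] by metis
  have "i \<in> {4, 5, 6, 7} \<or> (i + 4) mod 8 \<in> {4, 5, 6, 7}"
    using i(1) unfolding less_8_cases by auto
  then show False using assms(1,2) i(2,3) unfolding half_open_octagon_def by blast
qed

lemma half_open_octagon_surj:
  assumes "x \<noteq> sing"
  obtains p where "p \<in> half_open_octagon" "proj p = x"
proof -
  obtain p where p: "p \<in> octagon" "proj p = x" using proj_surj by blast
  have pv: "p \<notin> octverts" using assms p proj_eq_sing by auto
  show thesis
  proof (cases "p \<in> half_open_octagon")
    case True
    then show thesis using that p by blast
  next
    case False
    then obtain k where k: "k \<in> {4, 5, 6, 7}" "on_side k p"
      using p pv by (auto simp: half_open_octagon_def)
    then have k8: "k < 8" by auto
    define q where "q = p + (octv (k + 5) - octv k)"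
    have gl: "glue p q"
      using on_side_segment[OF p(1) k8 k(2)] k8 unfolding glue_def q_def by blast
    then have q: "q \<in> octagon" "q - p \<in> glue_vectors" using glue_iff by blast+
    have "q \<notin> octverts" using glue_vertex gl glue_sym pv by blast
    moreover have "\<not> on_side m q" if m: "m \<in> {4, 5, 6, 7}" for m
    proof
      assume "on_side m q"
      obtain i where i: "i < 8" "on_side i p" "on_side ((i + 4) mod 8) q"
        using glue_vector_sides[OF p(1) q] by metis
      have "i = k" using two_sides[OF p(1) i(1) k8 _ i(2) k(2)] pv by blast
      then have "(i + 4) mod 8 \<noteq> m" "(i + 4) mod 8 < 8" "m < 8" using k(1) m by auto
      then show False using two_sides[OF q(1) _ _ _ i(3) \<open>on_side m q\<close>] \<open>q \<notin> octverts\<close> by blast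
    qed
    ultimately have "q \<in> half_open_octagon" using q(1) by (simp add: half_open_octagon_def)
    moreover have "proj q = x" using proj_eq_iff[OF p(1) q(1)] q(2) p(2) by auto
    ultimately show thesis using that by blast
  qed
qed

lemma nonneg_cancel_sqrt2:
  fixes x y :: real
  shows "0 \<le> sqrt 2 / 2 * x \<longleftrightarrow> 0 \<le> x" "0 < sqrt 2 / 2 * x \<longleftrightarrow> 0 < x"
    "0 \<le> (1 + sqrt 2) * x \<longleftrightarrow> 0 \<le> x" "0 < (1 + sqrt 2) * x \<longleftrightarrow> 0 < x"
proof -
  have "sqrt 2 / 2 > 0" "1 + sqrt 2 > 0" by (simp_all add: add_pos_pos)
  then show "0 \<le> sqrt 2 / 2 * x \<longleftrightarrow> 0 \<le> x" "0 < sqrt 2 / 2 * x \<longleftrightarrow> 0 < x"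
    "0 \<le> (1 + sqrt 2) * x \<longleftrightarrow> 0 \<le> x" "0 < (1 + sqrt 2) * x \<longleftrightarrow> 0 < x"
    by (simp_all only: zero_le_mult_iff zero_less_mult_iff) auto
qed

lemma core_init:
  "p - init_corner 1 \<in> core (init_quads 1) \<longleftrightarrow>
     p \<noteq> octv 1 \<and> 0 \<le> p$2 \<and> p$1 - p$2 \<le> 1 \<and> p$2 < sqrt 2 / 2 \<and> 0 < p$1 + p$2"
  "p - init_corner 2 \<in> core (init_quads 2) \<longleftrightarrow>
     p \<noteq> octv 3 \<and> p$1 + p$2 \<le> 2 + sqrt 2 \<and> 1 + sqrt 2 / 2 \<le> p$2 \<and> p$2 < 1 + sqrt 2 \<and> p$2 - p$1 < 1 + sqrt 2"
  "p - init_corner 3 \<in> core (init_quads 3) \<longleftrightarrow>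
     p \<noteq> octv 2 \<and> p$1 \<le> 1 + sqrt 2 / 2 \<and> sqrt 2 / 2 \<le> p$2 \<and> p$2 < 1 + sqrt 2 / 2 \<and> - (sqrt 2 / 2) < p$1"
proof -
  note simps = octv_eqs vec2_arith cross_def
  have vals: "bl (init_quads 1) = octv 0 - octv 1" "br (init_quads 1) = octv 2 - octv 1" "dg (init_quads 1) = octv 7 - octv 1"
    "bl (init_quads 2) = octv 6 - octv 3" "br (init_quads 2) = octv 4 - octv 3" "dg (init_quads 2) = octv 5 - octv 3"
    "bl (init_quads 3) = octv 7 - octv 2" "br (init_quads 3) = octv 3 - octv 2" "dg (init_quads 3) = octv 6 - octv 2"
    "init_corner 1 = octv 1" "init_corner 2 = octv 3" "init_corner 3 = octv 2"
    by (simp_all add: init_quads_def init_corner_def)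
  have c: "cross (octv 2 - octv 1) (p - octv 1) = sqrt 2 / 2 * (1 - p$1 + p$2)"
    "cross (p - octv 1) (octv 0 - octv 1) = p$2"
    "cross (octv 7 - octv 1 - (octv 2 - octv 1)) (p - octv 1 - (octv 2 - octv 1)) = (1 + sqrt 2) * (sqrt 2 / 2 - p$2)"
    "cross (octv 0 - octv 1 - (octv 7 - octv 1)) (p - octv 1 - (octv 7 - octv 1)) = sqrt 2 / 2 * (p$1 + p$2)"
    by (simp_all add: simps algebra_simps add_divide_distrib diff_divide_distrib)
  show "p - init_corner 1 \<in> core (init_quads 1) \<longleftrightarrow>
     p \<noteq> octv 1 \<and> 0 \<le> p$2 \<and> p$1 - p$2 \<le> 1 \<and> p$2 < sqrt 2 / 2 \<and> 0 < p$1 + p$2"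
    unfolding core_def half_open_quad_def mem_Collect_eq vals c nonneg_cancel_sqrt2 by auto
  have c: "cross (octv 4 - octv 3) (p - octv 3) = sqrt 2 / 2 * (2 + sqrt 2 - p$1 - p$2)"
    "cross (p - octv 3) (octv 6 - octv 3) = (1 + sqrt 2) * (p$2 - 1 - sqrt 2 / 2)"
    "cross (octv 5 - octv 3 - (octv 4 - octv 3)) (p - octv 3 - (octv 4 - octv 3)) = 1 + sqrt 2 - p$2"
    "cross (octv 6 - octv 3 - (octv 5 - octv 3)) (p - octv 3 - (octv 5 - octv 3)) = sqrt 2 / 2 * (1 + sqrt 2 + p$1 - p$2)"
    by (simp_all add: simps algebra_simps add_divide_distrib diff_divide_distrib)
  show "p - init_corner 2 \<in> core (init_quads 2) \<longleftrightarrow>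
     p \<noteq> octv 3 \<and> p$1 + p$2 \<le> 2 + sqrt 2 \<and> 1 + sqrt 2 / 2 \<le> p$2 \<and> p$2 < 1 + sqrt 2 \<and> p$2 - p$1 < 1 + sqrt 2"
    unfolding core_def half_open_quad_def mem_Collect_eq vals c nonneg_cancel_sqrt2 by auto
  have c: "cross (octv 3 - octv 2) (p - octv 2) = 1 + sqrt 2 / 2 - p$1"
    "cross (p - octv 2) (octv 7 - octv 2) = (1 + sqrt 2) * (p$2 - sqrt 2 / 2)"
    "cross (octv 6 - octv 2 - (octv 3 - octv 2)) (p - octv 2 - (octv 3 - octv 2)) = (1 + sqrt 2) * (1 + sqrt 2 / 2 - p$2)"
    "cross (octv 7 - octv 2 - (octv 6 - octv 2)) (p - octv 2 - (octv 6 - octv 2)) = p$1 + sqrt 2 / 2"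
    by (simp_all add: simps algebra_simps add_divide_distrib diff_divide_distrib)
  show "p - init_corner 3 \<in> core (init_quads 3) \<longleftrightarrow>
     p \<noteq> octv 2 \<and> p$1 \<le> 1 + sqrt 2 / 2 \<and> sqrt 2 / 2 \<le> p$2 \<and> p$2 < 1 + sqrt 2 / 2 \<and> - (sqrt 2 / 2) < p$1"
    unfolding core_def half_open_quad_def mem_Collect_eq vals c nonneg_cancel_sqrt2 by auto
qed

lemma core_init_half_open:
  assumes "i \<in> {1..3}" "z \<in> core (init_quads i)"
  shows "init_corner i + z \<in> half_open_octagon"
proof -
  define p where "p = init_corner i + z"
  have c: "p - init_corner i \<in> core (init_quads i)" using assms(2) by (simp add: p_def)
  have "p \<in> octagon"
    using init_region_octagon[OF assms(1)] core_subset_region[OF convex_init[OF assms(1)]] assms(2) by (auto simp: p_def)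
  moreover have "p \<notin> octverts" "\<forall>k\<in>{4, 5, 6, 7}. \<not> on_side k p"
    using assms(1) c sqrt2_bounds(1) unfolding one_to_three
    by (auto simp only: core_init insert_iff empty_iff) (auto simp: on_side_def mem_octverts octv_eqs vec_eq_iff forall_2)
  ultimately show ?thesis by (simp add: half_open_octagon_def p_def)
qed

lemma half_open_octagon_core:
  assumes "p \<in> half_open_octagon"
  shows "\<exists>i\<in>{1..3}. p - init_corner i \<in> core (init_quads i)"
proof -
  have "p \<in> octagon" "p \<notin> octverts" and ns: "\<not> on_side 4 p" "\<not> on_side 5 p" "\<not> on_side 6 p" "\<not> on_side 7 p"
    using assms by (auto simp: half_open_octagon_def)
  then have "p \<noteq> octv 1" "p \<noteq> octv 3" "p \<noteq> octv 2" by (auto simp: octverts_eq)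
  moreover note p = \<open>p \<in> octagon\<close>[unfolded octagon_eq mem_Collect_eq octagon_ineqs_def]
  have "p$2 < 1 + sqrt 2" "p$2 - p$1 < 1 + sqrt 2" "- (sqrt 2 / 2) < p$1" "0 < p$1 + p$2"
    using p ns by (simp_all add: on_side_def)
  moreover have "p$2 < sqrt 2 / 2 \<or> sqrt 2 / 2 \<le> p$2 \<and> p$2 < 1 + sqrt 2 / 2 \<or> 1 + sqrt 2 / 2 \<le> p$2" by linarith
  ultimately show ?thesis unfolding one_to_three using p core_init[of p] by blast
qed

lemma proj_side_eq:
  assumes "octv c - octv a \<in> insert 0 glue_vectors" "octv a + w = octv b" "octv c + w = octv d" "0 \<le> t" "t \<le> 1"
  shows "proj (octv a + t *\<^sub>R w) = proj (octv c + t *\<^sub>R w)"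
proof -
  have "octv a + t *\<^sub>R w \<in> octagon" "octv c + t *\<^sub>R w \<in> octagon"
    using assms(2-5) octv_in_octagon by (metis octagon_segment)+
  then show ?thesis using assms(1) by (simp add: proj_eq_iff)
qed

definition init_left :: "nat \<Rightarrow> nat" where "init_left = Transposition.transpose 1 2"
definition init_right :: "nat \<Rightarrow> nat" where "init_right = Transposition.transpose 1 2 \<circ> Transposition.transpose 1 3"

lemma init_perms: "init_left 1 = 2" "init_left 2 = 1" "init_left 3 = 3"
  "init_right 1 = 3" "init_right 2 = 1" "init_right 3 = 2"
  by (simp_all add: init_left_def init_right_def Transposition.transpose_def)

lemma glued_init: "glued_quads init_left init_right init_quads"
proof -
  have perm: "init_left permutes {1..3}" "init_right permutes {1..3}"
    unfolding init_left_def init_right_def by (auto intro!: permutes_compose permutes_swap_id)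
  have tr: "translation_on (region (init_quads i)) (emb (init_quads i))" if i: "i \<in> {1..3}" for i
    unfolding translation_on_def
  proof (intro ballI exI[of _ 1] conjI)
    fix z w assume "z \<in> region (init_quads i)" "w \<in> region (init_quads i) \<inter> ball z 1"
    then show "\<exists>p\<in>octagon. p + (w - z) \<in> octagon \<and> proj p = emb (init_quads i) z \<and> proj (p + (w - z)) = emb (init_quads i) w"
      using init_region_octagon[OF i] by (intro bexI[of _ "init_corner i + z"]) (auto simp: emb_init)
  qed simp
  have sing: "emb (init_quads i) 0 = sing" for i
    using octv_in_octagon by (auto simp: emb_init init_corner_def proj_eq_sing octverts_eq)
  have dgs: "dg (init_quads i) = bl (init_quads i) + br (init_quads (init_left i))"
    "dg (init_quads i) = br (init_quads i) + bl (init_quads (init_right i))" if "i \<in> {1..3}" for i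
    using that unfolding one_to_three
    by (auto simp: init_perms init_quads_def octv_eqs vec_eq_iff forall_2 simp del: One_nat_def)
  have gl: "octv 3 - octv 0 \<in> insert 0 glue_vectors" "octv 1 - octv 6 \<in> insert 0 glue_vectors"
    "octv 2 - octv 7 \<in> insert 0 glue_vectors" "octv 1 - octv 4 \<in> insert 0 glue_vectors"
    by (simp_all add: octv_eqs mem_glue_vectors)
  have eqs: "octv 0 + (octv 4 - octv 3) = octv 7" "octv 6 + (octv 2 - octv 1) = octv 5"
    "octv 7 + (octv 3 - octv 2) = octv 6" "octv 4 + (octv 0 - octv 1) = octv 5"
    by (simp_all add: octv_eqs vec_eq_iff forall_2)
  have g: "proj (octv 0 + t *\<^sub>R (octv 4 - octv 3)) = proj (octv 3 + t *\<^sub>R (octv 4 - octv 3))"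
    "proj (octv 6 + t *\<^sub>R (octv 2 - octv 1)) = proj (octv 1 + t *\<^sub>R (octv 2 - octv 1))"
    "proj (octv 7 + t *\<^sub>R (octv 3 - octv 2)) = proj (octv 2 + t *\<^sub>R (octv 3 - octv 2))"
    "proj (octv 4 + t *\<^sub>R (octv 0 - octv 1)) = proj (octv 1 + t *\<^sub>R (octv 0 - octv 1))"
    if "0 \<le> t" "t \<le> 1" for t
    using proj_side_eq[OF gl(1) eqs(1) _ that, of 4] proj_side_eq[OF gl(2) eqs(2) _ that, of 2]
      proj_side_eq[OF gl(3) eqs(3) _ that, of 3] proj_side_eq[OF gl(4) eqs(4) _ that, of 0] by simp_all
  have left: "emb (init_quads i) (bl (init_quads i) + t *\<^sub>R br (init_quads (init_left i))) =
      emb (init_quads (init_left i)) (t *\<^sub>R br (init_quads (init_left i)))" if i: "i \<in> {1..3}" and t: "0 \<le> t" "t \<le> 1" for i t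
    using i g[OF t] unfolding one_to_three
    by (auto simp: init_perms init_quads_def add.assoc[symmetric] simp del: One_nat_def)
  have right: "emb (init_quads i) (br (init_quads i) + t *\<^sub>R bl (init_quads (init_right i))) =
      emb (init_quads (init_right i)) (t *\<^sub>R bl (init_quads (init_right i)))" if i: "i \<in> {1..3}" and t: "0 \<le> t" "t \<le> 1" for i t
    using i g[OF t] unfolding one_to_three
    by (auto simp: init_perms init_quads_def add.assoc[symmetric] simp del: One_nat_def)
  have bij: "bij_betw (\<lambda>(i, z). emb (init_quads i) z) (SIGMA i:{1..3}. core (init_quads i)) (UNIV - {sing})"
    unfolding bij_betw_def
  proof
    show "inj_on (\<lambda>(i, z). emb (init_quads i) z) (SIGMA i:{1..3}. core (init_quads i))"
    proof (rule inj_onI)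
      fix a b assume ab: "a \<in> (SIGMA i:{1..3}. core (init_quads i))" "b \<in> (SIGMA i:{1..3}. core (init_quads i))"
        "(\<lambda>(i, z). emb (init_quads i) z) a = (\<lambda>(i, z). emb (init_quads i) z) b"
      obtain i z j w where e: "a = (i, z)" "b = (j, w)" by (cases a, cases b) auto
      then have i: "i \<in> {1..3}" "z \<in> core (init_quads i)" and j: "j \<in> {1..3}" "w \<in> core (init_quads j)"
        using ab by auto
      have p: "init_corner i + z = init_corner j + w"
        using half_open_octagon_inj[OF core_init_half_open[OF i] core_init_half_open[OF j]] ab(3)
        by (simp add: e emb_init)
      define p where "p = init_corner i + z"
      have "p - init_corner i \<in> core (init_quads i)" "p - init_corner j \<in> core (init_quads j)"
        using i(2) j(2) by (simp_all add: p_def, simp add: p)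
      then have "i = j"
        using i(1) j(1) sqrt2_bounds(1) unfolding one_to_three
        by (auto simp only: core_init insert_iff empty_iff)
      then show "a = b" using p e by simp
    qed
    show "(\<lambda>(i, z). emb (init_quads i) z) ` (SIGMA i:{1..3}. core (init_quads i)) = UNIV - {sing}"
    proof (intro equalityI subsetI)
      fix x assume "x \<in> (\<lambda>(i, z). emb (init_quads i) z) ` (SIGMA i:{1..3}. core (init_quads i))"
      then obtain i z where "i \<in> {1..3}" "z \<in> core (init_quads i)" "x = emb (init_quads i) z" by auto
      then show "x \<in> UNIV - {sing}"
        using core_init_half_open[of i z] by (auto simp: half_open_octagon_def emb_init proj_eq_sing)
    next
      fix x assume "x \<in> UNIV - {sing}"
      then obtain p where p: "p \<in> half_open_octagon" "proj p = x" using half_open_octagon_surj by auto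
      obtain i where "i \<in> {1..3}" "p - init_corner i \<in> core (init_quads i)"
        using half_open_octagon_core[OF p(1)] by blast
      then show "x \<in> (\<lambda>(i, z). emb (init_quads i) z) ` (SIGMA i:{1..3}. core (init_quads i))"
        using p(2) by (intro image_eqI[of _ _ "(i, p - init_corner i)"]) (auto simp: emb_init)
    qed
  qed
  show ?thesis
    unfolding glued_quads_def using perm convex_init tr sing dgs left right bij by blast
qed

section \<open>Chains of moves\<close>

text \<open>All vectors that occur have this form, so that the chains of moves can be checked by integer computations.\<close>

type_synonym ivec = "int \<times> int \<times> int \<times> int"

fun vec_of :: "ivec \<Rightarrow> real^2" where
  "vec_of (a, b, c, d) = vec2 (a + b * (sqrt 2 / 2)) (c + d * (sqrt 2 / 2))"

fun ivec_add :: "ivec \<Rightarrow> ivec \<Rightarrow> ivec" where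
  "ivec_add (a, b, c, d) (a', b', c', d') = (a + a', b + b', c + c', d + d')"

text \<open>The coefficients of \<open>1\<close> and \<open>sqrt 2\<close> in twice the cross product.\<close>

fun ivec_cross :: "ivec \<Rightarrow> ivec \<Rightarrow> int \<times> int" where
  "ivec_cross (a, b, c, d) (a', b', c', d') =
     (2 * (a * c' - c * a') + b * d' - d * b', a * d' + b * c' - c * b' - d * a')"

text \<open>Sufficient for \<open>x + y * sqrt 2 > 0\<close> because \<open>1.4 < sqrt 2 < 1.5\<close>.\<close>

fun pos_sqrt2 :: "int \<times> int \<Rightarrow> bool" where
  "pos_sqrt2 (x, y) \<longleftrightarrow> 10 * x + 14 * y > 0 \<and> 10 * x + 15 * y > 0"

definition nonneg_sqrt2 :: "int \<times> int \<Rightarrow> bool" where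
  "nonneg_sqrt2 x \<longleftrightarrow> x = (0, 0) \<or> pos_sqrt2 x"

lemma vec_of_add: "vec_of (ivec_add v w) = vec_of v + vec_of w"
  by (cases v; cases w) (simp add: vec2_arith algebra_simps add_divide_distrib)

lemma ivec_cross_eq: "2 * cross (vec_of v) (vec_of w) = fst (ivec_cross v w) + snd (ivec_cross v w) * sqrt 2"
proof -
  obtain a b c d where v: "v = (a, b, c, d)" by (cases v)
  obtain a' b' c' d' where w: "w = (a', b', c', d')" by (cases w)
  show ?thesis
    unfolding v w by (simp add: cross_def algebra_simps add_divide_distrib diff_divide_distrib)
qed

lemma pos_sqrt2:
  assumes "pos_sqrt2 x"
  shows "real_of_int (fst x) + real_of_int (snd x) * sqrt 2 > 0"
proof -
  obtain a b where x: "x = (a, b)" by (cases x)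
  then have "real_of_int (10 * a + 14 * b) > 0" "real_of_int (10 * a + 15 * b) > 0"
    using assms unfolding of_int_0_less_iff by simp_all
  then have "10 * real_of_int a + 14 * real_of_int b > 0" "10 * real_of_int a + 15 * real_of_int b > 0"
    by simp_all
  moreover have "real_of_int b * 1.4 \<le> real_of_int b * sqrt 2 \<or> real_of_int b * 1.5 \<le> real_of_int b * sqrt 2"
  proof (cases "b \<ge> 0")
    case True
    then have "real_of_int b * 1.4 \<le> real_of_int b * sqrt 2" using sqrt2_bounds(1) by (intro mult_left_mono) auto
    then show ?thesis ..
  next
    case False
    then have "real_of_int b * 1.5 \<le> real_of_int b * sqrt 2" using sqrt2_bounds(2) by (intro mult_left_mono_neg) auto
    then show ?thesis ..
  qed
  ultimately show ?thesis unfolding x by auto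
qed

lemma cross_vec_of:
  "pos_sqrt2 (ivec_cross v w) \<Longrightarrow> cross (vec_of v) (vec_of w) > 0"
  "nonneg_sqrt2 (ivec_cross v w) \<Longrightarrow> cross (vec_of v) (vec_of w) \<ge> 0"
  "ivec_cross v w = (0, 0) \<Longrightarrow> cross (vec_of v) (vec_of w) = 0"
  using pos_sqrt2[of "ivec_cross v w"] ivec_cross_eq[of v w] by (auto simp: nonneg_sqrt2_def)

text \<open>Vectors in the directions \<open>j * pi / 8\<close>.\<close>

definition sector_vec :: "nat \<Rightarrow> ivec" where
  "sector_vec j = [(1, 0, 0, 0), (1, 2, 1, 0), (1, 0, 1, 0), (1, 0, 1, 2), (0, 0, 1, 0),
     (-1, 0, 1, 2), (-1, 0, 1, 0), (-1, -2, 1, 0), (-1, 0, 0, 0)] ! j"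

text \<open>As sine and cosine of pi / 4 are equal, the double angle formulas give 2 s c = c^2 -
  s^2, that is, (c - s)^2 = 2 s^2.\<close>

lemma cos_pi_8: "sin (pi / 8) > 0" "cos (pi / 8) = (1 + sqrt 2) * sin (pi / 8)"
proof -
  let ?s = "sin (pi / 8)" and ?c = "cos (pi / 8)"
  show s: "?s > 0" by (intro sin_gt_zero) auto
  have c: "?c > 0" by (intro cos_gt_zero) auto
  have "sin (2 * (pi / 8)) = sqrt 2 / 2" "cos (2 * (pi / 8)) = sqrt 2 / 2"
    by (simp_all add: sin_45 cos_45)
  then have 1: "2 * ?s * ?c = ?c\<^sup>2 - ?s\<^sup>2" "?c\<^sup>2 - ?s\<^sup>2 > 0"
    using sqrt2_bounds(1) unfolding sin_double cos_double by linarith+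
  have "?s < ?c" by (rule power2_less_imp_less) (use 1(2) c in linarith)+
  have "(?c - ?s)\<^sup>2 = ?c\<^sup>2 + ?s\<^sup>2 - 2 * ?c * ?s" "(sqrt 2 * ?s)\<^sup>2 = 2 * ?s\<^sup>2"
    by (rule power2_diff) (simp add: power_mult_distrib)
  moreover have "2 * ?c * ?s = 2 * ?s * ?c" by simp
  ultimately have "(?c - ?s)\<^sup>2 = (sqrt 2 * ?s)\<^sup>2" using 1(1) by linarith
  then have "?c - ?s = sqrt 2 * ?s"
    using \<open>?s < ?c\<close> s by (subst (asm) power2_eq_iff_nonneg) auto
  then show "?c = (1 + sqrt 2) * ?s" by (simp add: algebra_simps)
qed

lemma sector_vec_dir:
  assumes "j \<le> 8"
  obtains r where "r > 0" "vec_of (sector_vec j) = r *\<^sub>R dir (real j * pi / 8)"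
proof -
  let ?s = "sin (pi / 8)"
  have a: "cos (3 * pi / 8) = ?s" "sin (3 * pi / 8) = cos (pi / 8)"
    "cos (5 * pi / 8) = - ?s" "sin (5 * pi / 8) = cos (pi / 8)"
    "cos (7 * pi / 8) = - cos (pi / 8)" "sin (7 * pi / 8) = ?s"
  proof -
    have e: "3 * pi / 8 = pi / 2 - pi / 8" "5 * pi / 8 = pi / 2 + pi / 8" "7 * pi / 8 = pi - pi / 8" by simp_all
    show "cos (3 * pi / 8) = ?s" "sin (3 * pi / 8) = cos (pi / 8)"
      "cos (5 * pi / 8) = - ?s" "sin (5 * pi / 8) = cos (pi / 8)"
      "cos (7 * pi / 8) = - cos (pi / 8)" "sin (7 * pi / 8) = ?s"
      unfolding e cos_diff sin_diff cos_add sin_add by simp_all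
  qed
  have b: "cos (2 * pi / 8) = sqrt 2 / 2" "sin (2 * pi / 8) = sqrt 2 / 2" 
    "cos (6 * pi / 8) = - (sqrt 2 / 2)" "sin (6 * pi / 8) = sqrt 2 / 2" "4 * pi / 8 = pi / 2"
    "cos (3 * pi / 4) = - (sqrt 2 / 2)" "sin (3 * pi / 4) = sqrt 2 / 2"
  proof -
    have e: "2 * pi / 8 = pi / 4" "6 * pi / 8 = pi - pi / 4" "3 * pi / 4 = pi - pi / 4" by simp_all
    show "cos (2 * pi / 8) = sqrt 2 / 2" "sin (2 * pi / 8) = sqrt 2 / 2" 
      "cos (6 * pi / 8) = - (sqrt 2 / 2)" "sin (6 * pi / 8) = sqrt 2 / 2"
      "cos (3 * pi / 4) = - (sqrt 2 / 2)" "sin (3 * pi / 4) = sqrt 2 / 2"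
      unfolding e cos_diff sin_diff cos_45 sin_45 by simp_all
  qed simp
  note s = cos_pi_8
  \<comment> \<open>The sector vectors are scaled so that their smallest nonzero coordinate is 1 in
    absolute value.\<close>
  define r where "r = (if odd j then 1 / ?s else if j \<in> {2, 6} then sqrt 2 else 1)"
  have "r > 0" using s(1) by (simp add: r_def)
  moreover have "j = 0 \<or> j = 1 \<or> j = 2 \<or> j = 3 \<or> j = 4 \<or> j = 5 \<or> j = 6 \<or> j = 7 \<or> j = 8"
    using assms by auto
  then have "vec_of (sector_vec j) = r *\<^sub>R dir (real j * pi / 8)"
    using s(1) by (elim disjE; hypsubst) (simp_all add: sector_vec_def r_def dir_def vec2_arith a b cos_45 sin_45 s(2))
  ultimately show thesis using that by blast
qed

lemma cross_dir: "cross (dir a) (dir b) = sin (b - a)"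
  by (simp add: cross_def dir_def sin_diff)

lemma sector_cross:
  assumes "j < 8" "real j * pi / 8 < \<theta>" "\<theta> < real (j + 1) * pi / 8"
  shows "cross (vec_of (sector_vec j)) (dir \<theta>) > 0" "cross (dir \<theta>) (vec_of (sector_vec (j + 1))) > 0"
    "cross (vec_of (sector_vec j)) (vec_of (sector_vec (j + 1))) > 0"
proof -
  obtain r where r: "r > 0" "vec_of (sector_vec j) = r *\<^sub>R dir (real j * pi / 8)"
    using sector_vec_dir[of j] assms(1) by auto
  obtain r' where r': "r' > 0" "vec_of (sector_vec (j + 1)) = r' *\<^sub>R dir (real (j + 1) * pi / 8)"
    using sector_vec_dir[of "j + 1"] assms(1) by auto
  have d: "real (j + 1) * pi / 8 - real j * pi / 8 = pi / 8" by (simp add: field_simps)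
  have "sin (\<theta> - real j * pi / 8) > 0" "sin (real (j + 1) * pi / 8 - \<theta>) > 0"
    using assms(2,3) d pi_gt_zero by (intro sin_gt_zero; linarith)+
  then show "cross (vec_of (sector_vec j)) (dir \<theta>) > 0" "cross (dir \<theta>) (vec_of (sector_vec (j + 1))) > 0"
    using r r' by (simp_all only: cross_simps cross_dir) simp_all
  have "sin (real (j + 1) * pi / 8 - real j * pi / 8) > 0" unfolding d by (rule cos_pi_8(1))
  then show "cross (vec_of (sector_vec j)) (vec_of (sector_vec (j + 1))) > 0"
    using r r' by (simp only: cross_simps cross_dir) simp
qed

text \<open>A test by the two ends of the sector alone, uniform in its interior directions. The
  second condition is not strict because the target quadrangulation has its left sides along the
  upper end of the sector.\<close>

definition ivec_left :: "nat \<Rightarrow> ivec \<Rightarrow> bool" where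
  "ivec_left j v \<longleftrightarrow> pos_sqrt2 (ivec_cross (sector_vec j) v) \<and> nonneg_sqrt2 (ivec_cross (sector_vec (j + 1)) v)"

definition ivec_right :: "nat \<Rightarrow> ivec \<Rightarrow> bool" where
  "ivec_right j v \<longleftrightarrow> nonneg_sqrt2 (ivec_cross v (sector_vec j)) \<and> pos_sqrt2 (ivec_cross v (sector_vec (j + 1)))"

lemma ivec_sides:
  assumes "j < 8" "real j * pi / 8 < \<theta>" "\<theta> < real (j + 1) * pi / 8"
  shows "ivec_left j v \<Longrightarrow> left_of \<theta> (vec_of v)" "ivec_right j v \<Longrightarrow> right_of \<theta> (vec_of v)"
proof -
  let ?e = "vec_of (sector_vec j)" and ?e' = "vec_of (sector_vec (j + 1))"
  note pos = sector_cross[OF assms]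
  \<comment> \<open>Up to the factor \<open>cross ?e ?e'\<close>, \<open>dir \<theta>\<close> is the
    combination of the two sector vectors with the positive coefficients of Cramer's rule.\<close>
  have id: "cross ?e ?e' * cross (dir \<theta>) w = cross (dir \<theta>) ?e' * cross ?e w + cross ?e (dir \<theta>) * cross ?e' w" for w
    by (simp add: cross_def algebra_simps)
  show "left_of \<theta> (vec_of v)" if "ivec_left j v"
  proof -
    have "cross ?e (vec_of v) > 0" "cross ?e' (vec_of v) \<ge> 0"
      using that cross_vec_of by (auto simp: ivec_left_def)
    then have "cross ?e ?e' * cross (dir \<theta>) (vec_of v) > 0"
      unfolding id using pos by (intro add_pos_nonneg mult_pos_pos mult_nonneg_nonneg) auto
    then show ?thesis using pos(3) by (simp add: left_of_iff zero_less_mult_iff)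
  qed
  show "right_of \<theta> (vec_of v)" if "ivec_right j v"
  proof -
    have "cross (vec_of v) ?e \<ge> 0" "cross (vec_of v) ?e' > 0"
      using that cross_vec_of by (auto simp: ivec_right_def)
    then have "cross ?e (vec_of v) \<le> 0" "cross ?e' (vec_of v) < 0"
      using cross_swap[of ?e "vec_of v"] cross_swap[of ?e' "vec_of v"] by auto
    then have "cross ?e ?e' * cross (dir \<theta>) (vec_of v) < 0"
      unfolding id using pos by (intro add_nonpos_neg mult_pos_neg mult_nonneg_nonpos) auto
    then show ?thesis using pos(3) by (simp add: right_of_iff mult_less_0_iff)
  qed
qed

text \<open>The left and right base sides and the two permutations; the entries of the lists with index \<open>0\<close> are
  dummies.\<close>

type_synonym qstate = "ivec list \<times> ivec list \<times> nat list \<times> nat list"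

fun realizes :: "(nat \<Rightarrow> quad) \<Rightarrow> qstate \<Rightarrow> bool" where
  "realizes q (L, R, P, P') \<longleftrightarrow> (\<exists>pl pr. glued_quads pl pr q \<and>
     (\<forall>i\<in>{1..3}. bl (q i) = vec_of (L ! i) \<and> br (q i) = vec_of (R ! i) \<and> pl i = P ! i \<and> pr i = P' ! i))"

fun is_cycle :: "nat list \<Rightarrow> nat list \<Rightarrow> bool" where
  "is_cycle p [x] \<longleftrightarrow> p ! x = x"
| "is_cycle p [x, y] \<longleftrightarrow> p ! x = y \<and> p ! y = x"
| "is_cycle p [x, y, z] \<longleftrightarrow> p ! x = y \<and> p ! y = z \<and> p ! z = x"
| "is_cycle p _ \<longleftrightarrow> False"

text \<open>The flag distinguishes the moves in cycles of the right permutation from those in cycles of the left one.\<close>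

fun run :: "nat \<Rightarrow> (bool \<times> nat list) list \<Rightarrow> qstate \<Rightarrow> qstate option" where
  "run j [] S = Some S"
| "run j ((b, c) # ms) (L, R, P, P') =
    (let D = map (\<lambda>i. ivec_add (L ! i) (R ! (P ! i))) [0..<4] in
     if set c \<subseteq> {1, 2, 3} \<and> (if b then is_cycle P' c \<and> (\<forall>i\<in>set c. ivec_left j (D ! i))
                               else is_cycle P c \<and> (\<forall>i\<in>set c. ivec_right j (D ! i)))
     then run j ms (if b
       then (map (\<lambda>i. if i \<in> set c then D ! i else L ! i) [0..<4], R,
             map (\<lambda>i. if i \<in> set c then P ! (P' ! i) else P ! i) [0..<4], P')
       else (L, map (\<lambda>i. if i \<in> set c then D ! i else R ! i) [0..<4], P,
             map (\<lambda>i. if i \<in> set c then P' ! (P ! i) else P' ! i) [0..<4]))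
     else None)"

lemma is_cycle_cyclic_on:
  assumes "is_cycle p c" "\<And>i. i \<in> set c \<Longrightarrow> f i = p ! i"
  shows "cyclic_on f (set c)"
proof -
  have *: "cyclic_on f S" if x: "x \<in> S" and closed: "\<And>s. s \<in> S \<Longrightarrow> f s \<in> S"
    and reach: "\<And>s. s \<in> S \<Longrightarrow> s \<in> orbit f x" for S x
  proof (rule cyclic_on_singleI[OF x])
    have "s \<in> S" if "s \<in> orbit f x" for s
      using that by induction (use x closed in auto)
    then show "S = orbit f x" using reach by blast
  qed
  from assms(1) show ?thesis
  proof (cases rule: is_cycle.elims(2))
    case (1 x)
    then have "f x = x" using assms(2) by simp
    then have "x \<in> orbit f x" by (metis orbit.base)
    then show ?thesis using 1 \<open>f x = x\<close> by (intro *[of x]) auto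
  next
    case (2 x y)
    then have "f x = y" "f y = x" using assms(2) by auto
    then have "y \<in> orbit f x" "x \<in> orbit f x" by (metis orbit.base, metis orbit.base orbit.step)
    then show ?thesis using 2 \<open>f x = y\<close> \<open>f y = x\<close> by (intro *[of x]) auto
  next
    case (3 x y z)
    then have f: "f x = y" "f y = z" "f z = x" using assms(2) by auto
    then have "y \<in> orbit f x" by (metis orbit.base)
    then have "z \<in> orbit f x" using f by (metis orbit.step)
    then have "x \<in> orbit f x" using f by (metis orbit.step)
    then show ?thesis using 3 f \<open>y \<in> orbit f x\<close> \<open>z \<in> orbit f x\<close> by (intro *[of x]) auto
  qed
qed

text \<open>The tests in \<open>run\<close> refer only to the sector, so one evaluation covers all
  its interior directions. The reflexive closure carries the induction through the empty list; the
  strict one is what the theorem asks for.\<close>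

lemma run_sound:
  assumes j: "j < 8" "real j * pi / 8 < \<theta>" "\<theta> < real (j + 1) * pi / 8"
  shows "run j ms S = Some S' \<Longrightarrow> realizes q S \<Longrightarrow> straddles \<theta> q \<Longrightarrow>
    \<exists>q'. realizes q' S' \<and> straddles \<theta> q' \<and> (diagonal_change \<theta>)\<^sup>*\<^sup>* (cells q) (cells q') \<and>
      (ms \<noteq> [] \<longrightarrow> (diagonal_change \<theta>)\<^sup>+\<^sup>+ (cells q) (cells q'))"
proof (induction ms arbitrary: S q)
  case Nil
  then show ?case by auto
next
  case (Cons m ms)
  obtain b c where m: "m = (b, c)" by (cases m)
  obtain L R P P' where S: "S = (L, R, P, P')" by (cases S)
  define D where "D = map (\<lambda>i. ivec_add (L ! i) (R ! (P ! i))) [0..<4]"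
  define S1 where "S1 = (if b
       then (map (\<lambda>i. if i \<in> set c then D ! i else L ! i) [0..<4], R,
             map (\<lambda>i. if i \<in> set c then P ! (P' ! i) else P ! i) [0..<4], P')
       else (L, map (\<lambda>i. if i \<in> set c then D ! i else R ! i) [0..<4], P,
             map (\<lambda>i. if i \<in> set c then P' ! (P ! i) else P' ! i) [0..<4]))"
  have ok: "set c \<subseteq> {1, 2, 3}" "if b then is_cycle P' c \<and> (\<forall>i\<in>set c. ivec_left j (D ! i))
      else is_cycle P c \<and> (\<forall>i\<in>set c. ivec_right j (D ! i))" and run: "run j ms S1 = Some S'"
    using Cons.prems(1) unfolding m S run.simps Let_def D_def[symmetric] S1_def[symmetric]
    by (simp_all only: split: if_splits) auto
  have c: "set c \<subseteq> {1..3}" using ok(1) by auto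
  obtain pl pr where g: "glued_quads pl pr q" and vals: "\<And>i. i \<in> {1..3} \<Longrightarrow>
      bl (q i) = vec_of (L ! i) \<and> br (q i) = vec_of (R ! i) \<and> pl i = P ! i \<and> pr i = P' ! i"
    using Cons.prems(2) unfolding S by auto
  have I4: "i < 4" if "i \<in> {1..3::nat}" for i using that by auto
  have dg: "dg (q i) = vec_of (D ! i)" if i: "i \<in> {1..3}" for i
    using glued_quadsD(4,8)[OF g i] vals[OF i] vals[of "pl i"] I4[OF i] by (simp add: D_def vec_of_add)
  have "\<exists>q1. realizes q1 S1 \<and> straddles \<theta> q1 \<and> diagonal_change \<theta> (cells q) (cells q1)"
  proof (cases b)
    case True
    have cyc: "cyclic_on pr (set c)" using ok(2) True vals c by (intro is_cycle_cyclic_on[of P']) auto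
    have "left_of \<theta> (dg (q i))" if i: "i \<in> set c" for i
    proof -
      have "ivec_left j (D ! i)" using ok(2) True i by simp
      then show ?thesis using ivec_sides(1)[OF j] dg[OF subsetD[OF c i]] by simp
    qed
    from right_move[OF g Cons.prems(3) c cyc this]
    obtain q1 where q1: "glued_quads (\<lambda>i. if i \<in> set c then pl (pr i) else pl i) pr q1" "straddles \<theta> q1"
      "diagonal_change \<theta> (cells q) (cells q1)"
      "\<And>i. br (q1 i) = br (q i) \<and> bl (q1 i) = (if i \<in> set c then dg (q i) else bl (q i))" by blast
    have "bl (q1 i) = vec_of (map (\<lambda>i. if i \<in> set c then D ! i else L ! i) [0..<4] ! i) \<and> br (q1 i) = vec_of (R ! i) \<and>
        (if i \<in> set c then pl (pr i) else pl i) = map (\<lambda>i. if i \<in> set c then P ! (P' ! i) else P ! i) [0..<4] ! i \<and>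
        pr i = P' ! i" if i: "i \<in> {1..3}" for i
      using q1(4)[of i] vals[OF i] vals[OF glued_quadsD(9)[OF g i]] dg[OF i] I4[OF i] by simp
    then have "realizes q1 S1"
      using q1(1) True by (simp only: S1_def if_True realizes.simps) blast
    then show ?thesis using q1 by blast
  next
    case False
    have cyc: "cyclic_on pl (set c)" using ok(2) False vals c by (intro is_cycle_cyclic_on[of P]) auto
    have "right_of \<theta> (dg (q i))" if i: "i \<in> set c" for i
    proof -
      have "ivec_right j (D ! i)" using ok(2) False i by simp
      then show ?thesis using ivec_sides(2)[OF j] dg[OF subsetD[OF c i]] by simp
    qed
    from left_move[OF g Cons.prems(3) c cyc this]
    obtain q1 where q1: "glued_quads pl (\<lambda>i. if i \<in> set c then pr (pl i) else pr i) q1" "straddles \<theta> q1"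
      "diagonal_change \<theta> (cells q) (cells q1)"
      "\<And>i. bl (q1 i) = bl (q i) \<and> br (q1 i) = (if i \<in> set c then dg (q i) else br (q i))" by blast
    have "bl (q1 i) = vec_of (L ! i) \<and> br (q1 i) = vec_of (map (\<lambda>i. if i \<in> set c then D ! i else R ! i) [0..<4] ! i) \<and>
        pl i = P ! i \<and>
        (if i \<in> set c then pr (pl i) else pr i) = map (\<lambda>i. if i \<in> set c then P' ! (P ! i) else P' ! i) [0..<4] ! i"
      if i: "i \<in> {1..3}" for i
      using q1(4)[of i] vals[OF i] vals[OF glued_quadsD(8)[OF g i]] dg[OF i] I4[OF i] by simp
    then have "realizes q1 S1"
      using q1(1) False by (simp only: S1_def if_False realizes.simps) blast
    then show ?thesis using q1 by blast
  qed
  then obtain q1 where q1: "realizes q1 S1" "straddles \<theta> q1" "diagonal_change \<theta> (cells q) (cells q1)" by blast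
  obtain q' where "realizes q' S'" "straddles \<theta> q'" "(diagonal_change \<theta>)\<^sup>*\<^sup>* (cells q1) (cells q')"
    using Cons.IH[OF run q1(1,2)] by blast
  then show ?case
    using q1(3) by (meson converse_rtranclp_into_rtranclp rtranclp_into_tranclp2)
qed

section \<open>The target quadrangulations\<close>

text \<open>\<open>nu j\<close> is a rotation for even \<open>j\<close> and a reflection for odd
  \<open>j\<close>; in the latter case the ends of the sector are exchanged.\<close>

definition nu_angle :: "nat \<Rightarrow> real \<Rightarrow> real" where
  "nu_angle j t = (if even j then t - real j * pi / 8 else real (j + 1) * pi / 8 - t)"

lemma nu_dir:
  assumes "j < 8"
  shows "nu j *v dir t = dir (nu_angle j t)"
proof -
  have e: "2 * pi / 8 = pi / 4" "6 * pi / 8 = pi - pi / 4" "4 * pi / 8 = pi / 2" "8 * pi / 8 = pi" by simp_all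
  have c: "cos (2 * pi / 8) = sqrt 2 / 2" "sin (2 * pi / 8) = sqrt 2 / 2"
    "cos (6 * pi / 8) = - (sqrt 2 / 2)" "sin (6 * pi / 8) = sqrt 2 / 2"
    "cos (4 * pi / 8) = 0" "sin (4 * pi / 8) = 1" "cos (8 * pi / 8) = - 1" "sin (8 * pi / 8) = 0"
    unfolding e cos_diff sin_diff cos_45 sin_45 by simp_all
  have n: "real (1 + 1) = 2" "real (3 + 1) = 4" "real (5 + 1) = 6" "real (7 + 1) = 8" "real 2 = 2" "real 4 = 4" "real 6 = 6"
    by simp_all
  have p: "even (0::nat)" "odd (1::nat)" "even (2::nat)" "odd (3::nat)" "even (4::nat)" "odd (5::nat)" "even (6::nat)" "odd (7::nat)"
    by simp_all
  show ?thesis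
    using assms unfolding less_8_cases
    by (elim disjE; hypsubst; simp only: nu_eqs mat2_vec nu_angle_def dir_def p if_True if_False n cos_diff sin_diff c;
        simp add: vec_eq_iff forall_2 algebra_simps)
qed

lemma nu_det_pos: "j < 8 \<Longrightarrow> det (nu j) > 0 \<longleftrightarrow> even j"
  unfolding less_8_cases by (elim disjE; hypsubst; simp add: nu_eqs mat2_det)

lemma nu_angle_sector:
  assumes "real j * pi / 8 < t" "t < real (j + 1) * pi / 8"
  shows "0 < nu_angle j t" "nu_angle j t < pi / 8"
proof -
  have "real (j + 1) * pi / 8 = real j * pi / 8 + pi / 8" by (simp add: field_simps)
  then show "0 < nu_angle j t" "nu_angle j t < pi / 8" using assms
    by (cases "even j"; simp only: nu_angle_def if_True if_False; linarith)+
qed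

lemma dir_pi_8: "dir (pi / 8) = sin (pi / 8) *\<^sub>R vec2 (1 + sqrt 2) 1"
  by (simp add: dir_def cos_pi_8(2) vec2_arith mult.commute)

text \<open>\<open>nu j\<close> brings the base sides into the directions 0 and pi / 8, up to sign.
  For odd \<open>j\<close> it exchanges the ends of the sector, but \<open>push\<close> then
  exchanges left and right sides as well. The signs follow from the sides straddling the direction,
  after which the cells are recognized as those of \<open>Q0\<close>.\<close>

lemma target_cells:
  assumes j: "j < 8" "real j * pi / 8 < \<theta>" "\<theta> < real (j + 1) * pi / 8"
    and a: "surf_aut (nu j) B f g"
    and g: "glued_quads pl pr q" and s: "straddles \<theta> q"
    and bl: "\<And>i. i \<in> {1..3} \<Longrightarrow> cross (vec_of (sector_vec (j + 1))) (bl (q i)) = 0"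
    and br: "\<And>i. i \<in> {1..3} \<Longrightarrow> cross (vec_of (sector_vec j)) (br (q i)) = 0"
  shows "i \<in> {1..3} \<Longrightarrow> \<exists>l>0. bl (push (nu j) B f (q i)) = l *\<^sub>R vec2 (1 + sqrt 2) 1"
    "i \<in> {1..3} \<Longrightarrow> \<exists>l>0. br (push (nu j) B f (q i)) = l *\<^sub>R vec2 1 0"
    "cells (\<lambda>i. push (nu j) B f (q i)) = Q0" "cells q = act (matrix_inv (nu j)) Q0"
proof -
  let ?q = "\<lambda>i. push (nu j) B f (q i)" and ?t = "nu_angle j \<theta>"
  note t = nu_angle_sector[OF j(2,3)]
  have d: "nu j *v dir \<theta> = 1 *\<^sub>R dir ?t" using nu_dir[OF j(1)] by simp
  have s': "straddles ?t ?q" by (rule straddles_push[OF a d _ s]) simp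
  have g': "glued_quads (if det (nu j) > 0 then pl else pr) (if det (nu j) > 0 then pr else pl) ?q"
    by (rule glued_push[OF a g])
  have an: "nu_angle j (real (j + 1) * pi / 8) = (if even j then pi / 8 else 0)"
    "nu_angle j (real j * pi / 8) = (if even j then 0 else pi / 8)"
    by (simp_all add: nu_angle_def field_simps)
  have par: "(\<exists>x. bl (?q i) = x *\<^sub>R dir (pi / 8)) \<and> (\<exists>y. br (?q i) = y *\<^sub>R dir 0)" if i: "i \<in> {1..3}" for i
  proof -
    obtain r where r: "r > 0" "vec_of (sector_vec j) = r *\<^sub>R dir (real j * pi / 8)"
      using sector_vec_dir[of j] j(1) by auto
    obtain r' where r': "r' > 0" "vec_of (sector_vec (j + 1)) = r' *\<^sub>R dir (real (j + 1) * pi / 8)"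
      using sector_vec_dir[of "j + 1"] j(1) by auto
    have "vec_of (sector_vec j) \<noteq> 0" "vec_of (sector_vec (j + 1)) \<noteq> 0"
      using sector_cross(3)[OF j] by (auto simp: cross_simps)
    then obtain x y where "bl (q i) = x *\<^sub>R vec_of (sector_vec (j + 1))" "br (q i) = y *\<^sub>R vec_of (sector_vec j)"
      using cross_0_collinear bl[OF i] br[OF i] by metis
    then have "nu j *v bl (q i) = (x * r') *\<^sub>R dir (if even j then pi / 8 else 0)"
      "nu j *v br (q i) = (y * r) *\<^sub>R dir (if even j then 0 else pi / 8)"
      using r(2) r'(2) nu_dir[OF j(1)] an by (simp_all add: matrix_vector_mult_scaleR)
    then show ?thesis
      using nu_det_pos[OF j(1)] by (cases "even j") (auto simp: push_def)
  qed
  have bl': "\<exists>l>0. bl (?q i) = l *\<^sub>R vec2 (1 + sqrt 2) 1" if i: "i \<in> {1..3}" for i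
  proof -
    obtain x where x: "bl (?q i) = x *\<^sub>R dir (pi / 8)" using par[OF i] by blast
    have "left_of ?t (bl (?q i))" using s' i unfolding straddles_def by blast
    then have "x * sin (pi / 8 - ?t) > 0" unfolding left_of_iff x cross_simps cross_dir .
    moreover have "sin (pi / 8 - ?t) > 0" using t pi_gt_zero by (intro sin_gt_zero) linarith+
    ultimately have "x > 0" by (simp add: zero_less_mult_iff)
    then show ?thesis using x cos_pi_8(1) unfolding dir_pi_8 by (intro exI[of _ "x * sin (pi / 8)"]) simp
  qed
  have br': "\<exists>l>0. br (?q i) = l *\<^sub>R vec2 1 0" if i: "i \<in> {1..3}" for i
  proof -
    obtain y where y: "br (?q i) = y *\<^sub>R dir 0" using par[OF i] by blast
    have "right_of ?t (br (?q i))" using s' i unfolding straddles_def by blast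
    then have "y * sin (0 - ?t) < 0" unfolding right_of_iff y cross_simps cross_dir .
    moreover have "sin ?t > 0" using t pi_gt_zero by (intro sin_gt_zero) linarith+
    ultimately have "y > 0" by (simp add: zero_less_mult_iff)
    then show ?thesis using y by (intro exI[of _ y]) (simp add: dir_def)
  qed
  show "i \<in> {1..3} \<Longrightarrow> \<exists>l>0. bl (?q i) = l *\<^sub>R vec2 (1 + sqrt 2) 1" by (rule bl')
  show "i \<in> {1..3} \<Longrightarrow> \<exists>l>0. br (?q i) = l *\<^sub>R vec2 1 0" by (rule br')
  show Q: "cells ?q = Q0" by (rule cells_eq_Q0[OF g' bl' br'])
  show "cells q = act (matrix_inv (nu j)) Q0"
    using Q act_act(2)[OF a, of "cells q"] unfolding cells_push[OF a] surf_aut_matrix_inv[OF a] by simp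
qed

section \<open>Chains of moves between the quadrangulations of the octagon Farey algorithm\<close>

definition octagon_state :: qstate where
  "octagon_state = ([(0, 0, 0, 0), (-1, 0, 0, 0), (-1, -2, 0, 0), (-1, -2, 0, 0)],
     [(0, 0, 0, 0), (0, 1, 0, 1), (0, -1, 0, 1), (0, 0, 1, 0)], [0, 2, 1, 3], [0, 3, 1, 2])"

text \<open>The quadrangulation \<open>Q0\<close>, with base sides in the directions \<open>pi\<close> and \<open>pi / 8\<close>.\<close>

definition farey_state :: qstate where
  "farey_state = ([(0, 0, 0, 0), (-1, -2, 0, 0), (-1, 0, 0, 0), (-1, -2, 0, 0)],
     [(0, 0, 0, 0), (1, 1, 0, 1), (1, 1, 0, 1), (1, 2, 1, 0)], [0, 2, 1, 3], [0, 3, 2, 1])"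

text \<open>The moves for directions in the \<open>j\<close>th sector, found by a search over the well slanted staircases.\<close>

definition farey_moves :: "nat \<Rightarrow> (bool \<times> nat list) list" where
  "farey_moves j = [[],
     [(True, [1, 3]), (True, [1, 3]), (True, [2])],
     [(True, [1, 3]), (False, [1, 3, 2]), (True, [1]), (True, [2, 3])],
     [(True, [1, 3]), (False, [1, 3, 2]), (False, [1, 3, 2]), (True, [1, 2])],
     [(False, [3]), (True, [1, 3]), (True, [1, 3]), (False, [1, 2]), (False, [1, 2]), (True, [2])],
     [(False, [3]), (True, [1, 3]), (False, [1, 3, 2]), (True, [2, 3]), (False, [2])],
     [(False, [1, 2]), (False, [3]), (True, [1, 2, 3]), (False, [2, 3])],
     [(False, [1, 2]), (False, [1, 2]), (False, [3]), (False, [3])]] ! j"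

fun straddle_check :: "nat \<Rightarrow> qstate \<Rightarrow> bool" where
  "straddle_check j (L, R, P, P') \<longleftrightarrow> (\<forall>i\<in>set [1, 2, 3]. ivec_left j (L ! i) \<and> ivec_right j (R ! i))"

fun target_check :: "nat \<Rightarrow> qstate option \<Rightarrow> bool" where
  "target_check j (Some (L, R, P, P')) \<longleftrightarrow> (\<forall>i\<in>set [1, 2, 3]. ivec_cross (sector_vec (j + 1)) (L ! i) = (0, 0) \<and>
     ivec_cross (sector_vec j) (R ! i) = (0, 0))"
| "target_check j None \<longleftrightarrow> False"

lemma farey_check:
  "\<forall>j\<in>set [1, 2, 3, 4, 5, 6, 7]. straddle_check j farey_state \<and> target_check j (run j (farey_moves j) farey_state)"
  by code_simp

text \<open>Two moves in sector 6 lead from the octagon cut along its horizontal diagonals to left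
  sides in direction 7 pi / 8 and right sides in direction 6 pi / 8, the two ends of this
  sector.\<close>

lemma octagon_check:
  "straddle_check 6 octagon_state"
  "run 6 [(True, [1, 3, 2]), (False, [1, 3])] octagon_state =
     Some ([(0, 0, 0, 0), (-1, -1, 0, 1), (-1, -1, 0, 1), (-1, -2, 1, 0)],
       [(0, 0, 0, 0), (-1, -1, 1, 1), (0, -1, 0, 1), (-1, -1, 1, 1)], [0, 3, 2, 1], [0, 2, 1, 3])"
  by code_simp+

lemma straddle_check_straddles:
  assumes "j < 8" "real j * pi / 8 < \<theta>" "\<theta> < real (j + 1) * pi / 8"
    and "realizes q S" "straddle_check j S"
  shows "straddles \<theta> q"
proof -
  obtain L R P P' where S: "S = (L, R, P, P')" by (cases S)
  have v: "bl (q i) = vec_of (L ! i) \<and> br (q i) = vec_of (R ! i)" if "i \<in> {1..3}" for i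
    using assms(4) that unfolding S realizes.simps by blast
  have c: "ivec_left j (L ! i) \<and> ivec_right j (R ! i)" if "i \<in> {1..3}" for i
    using assms(5) that unfolding S one_to_three by auto
  show ?thesis
    unfolding straddles_def using v c ivec_sides[OF assms(1-3)] by simp
qed

lemma target_check_cells:
  assumes j: "j < 8" "real j * pi / 8 < \<theta>" "\<theta> < real (j + 1) * pi / 8"
    and "realizes q S" "target_check j (Some S)" "straddles \<theta> q"
  shows "cells q = act (matrix_inv (nu j)) Q0"
proof -
  obtain L R P P' where S: "S = (L, R, P, P')" by (cases S)
  obtain pl pr where g: "glued_quads pl pr q" and v: "\<And>i. i \<in> {1..3} \<Longrightarrow> bl (q i) = vec_of (L ! i) \<and> br (q i) = vec_of (R ! i)"
    using assms(4) unfolding S by auto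
  obtain B f h where a: "surf_aut (nu j) B f h" using nu_aut[OF j(1)] by blast
  have *: "ivec_cross (sector_vec (j + 1)) (L ! i) = (0, 0)" "ivec_cross (sector_vec j) (R ! i) = (0, 0)"
    if "i \<in> {1..3}" for i
    using assms(5) that unfolding S one_to_three by auto
  show ?thesis
    by (rule target_cells(4)[OF j a g assms(6)]) (use v cross_vec_of(3)[OF *(1)] cross_vec_of(3)[OF *(2)] in auto)
qed

lemma realizes_init: "realizes init_quads octagon_state"
  unfolding octagon_state_def realizes.simps ball_one_to_three
  by (intro exI conjI, rule glued_init)
    (simp_all add: init_perms init_quads_def octv_eqs vec_eq_iff forall_2 del: One_nat_def)

text \<open>Both claims come from one construction. The moves of \<open>octagon_check\<close>,
  followed by the rotation \<open>nu 6\<close>, realize \<open>Q0\<close> by glued parallelograms;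
  their side vectors and permutations satisfy the premises of
  \<open>parallelogram_reflection\<close>, and the reflection so obtained turns the base sides for
  sector 0 into those for the other sectors.\<close>

lemma farey_start:
  "\<exists>q. realizes q farey_state \<and> cells q = Q0"
  "\<exists>f. surf_aut gam gam f f \<and> act gam Q0 = Q0"
proof -
  \<comment> \<open>The midpoint of sector 6, a direction for which \<open>octagon_check\<close>
    makes the moves available.\<close>
  define \<theta> where "\<theta> = 13 * pi / 16"
  have j: "6 < (8::nat)" "real 6 * pi / 8 < \<theta>" "\<theta> < real (6 + 1) * pi / 8" by (simp_all add: \<theta>_def)
  have s: "straddles \<theta> init_quads"
    by (rule straddle_check_straddles[OF j realizes_init octagon_check(1)])
  obtain q where q: "realizes q ([(0, 0, 0, 0), (-1, -1, 0, 1), (-1, -1, 0, 1), (-1, -2, 1, 0)],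
       [(0, 0, 0, 0), (-1, -1, 1, 1), (0, -1, 0, 1), (-1, -1, 1, 1)], [0, 3, 2, 1], [0, 2, 1, 3])" "straddles \<theta> q"
    using run_sound[OF j octagon_check(2) realizes_init s] by blast
  from q(1) obtain pl pr where g: "glued_quads pl pr q" and
    L: "bl (q 1) = vec_of (-1, -1, 0, 1)" "bl (q 2) = vec_of (-1, -1, 0, 1)" "bl (q 3) = vec_of (-1, -2, 1, 0)" and
    R: "br (q 1) = vec_of (-1, -1, 1, 1)" "br (q 2) = vec_of (0, -1, 0, 1)" "br (q 3) = vec_of (-1, -1, 1, 1)" and
    P: "pl 1 = 3" "pl 2 = 2" "pl 3 = 1" "pr 1 = 2" "pr 2 = 1" "pr 3 = 3"
    unfolding realizes.simps ball_one_to_three by (auto simp del: vec_of.simps)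
  obtain B f h where a: "surf_aut (nu 6) B f h" using nu_aut[of 6] by auto
  let ?q = "\<lambda>i. push (nu 6) B f (q i)"
  have det: "det (nu 6) > 0" using nu_det_pos[of 6] by simp
  have bl0: "cross (vec_of (sector_vec (6 + 1))) (bl (q i)) = 0" and br0: "cross (vec_of (sector_vec 6)) (br (q i)) = 0"
    if "i \<in> {1..3}" for i
    using that L R unfolding one_to_three
    by (auto simp del: vec_of.simps intro!: cross_vec_of(3)) (simp_all add: sector_vec_def)
  have T: "i \<in> {1..3} \<Longrightarrow> \<exists>l>0. bl (?q i) = l *\<^sub>R vec2 (1 + sqrt 2) 1"
    "i \<in> {1..3} \<Longrightarrow> \<exists>l>0. br (?q i) = l *\<^sub>R vec2 1 0" "cells ?q = Q0" for i
    by (rule target_cells(1)[OF j a g q(2)] target_cells(2)[OF j a g q(2)] target_cells(3)[OF j a g q(2)];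
        (assumption | erule bl0 | erule br0))+
  have g': "glued_quads pl pr ?q" using glued_push[OF a g] det by simp
  have gam: "gam = mat2 (-1) (2 * (1 + sqrt 2)) 0 1" by (simp add: gam_def)
  have "\<exists>f. surf_aut gam gam f f \<and> act gam (cells ?q) = cells ?q"
  proof (rule parallelogram_reflection[OF g'])
    show "gam ** gam = mat 1" by (simp add: gam mat2_mult mat2_1)
    show "det gam = - 1" by (simp add: gam mat2_det)
    fix i assume i: "i \<in> {1..3::nat}"
    show "gam *v bl (?q i) = bl (?q i)"
      using T(1)[OF i] by (auto simp: gam mat2_vec vec2_arith algebra_simps)
    show "gam *v br (?q i) = - br (?q i)"
      using T(2)[OF i] by (auto simp: gam mat2_vec vec2_arith)
    \<comment> \<open>That the cells are parallelograms shows in the permutations: \<open>pl\<close>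
      exchanges the two cells with equal right sides, \<open>pr\<close> the two with equal left
      sides.\<close>
    show "br (?q (pl i)) = br (?q i)" "bl (?q (pr i)) = bl (?q i)" "pr (pr i) = i"
      using i L R P det unfolding one_to_three by (auto simp: push_def simp del: vec_of.simps One_nat_def)
  qed
  then obtain k where k: "surf_aut gam gam k k" "act gam (cells ?q) = cells ?q" by blast
  then show "\<exists>f. surf_aut gam gam f f \<and> act gam Q0 = Q0" using T(3) by auto
  \<comment> \<open>The cells stay the same as a set. The sides in direction pi / 8 are fixed and
    become right sides, the horizontal ones are reversed and become left sides, which gives
    \<open>farey_state\<close>.\<close>
  let ?q' = "\<lambda>i. push gam gam k (?q i)"
  have det': "\<not> det gam > 0" by (simp add: gam mat2_det)
  have "glued_quads pr pl ?q'" using glued_push[OF k(1) g'] det' by simp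
  moreover have "bl (?q' i) = gam *v (nu 6 *v br (q i))" "br (?q' i) = gam *v (nu 6 *v bl (q i))" for i
    using det det' by (simp_all add: push_def)
  ultimately have "realizes ?q' farey_state"
    unfolding farey_state_def realizes.simps ball_one_to_three
    by (intro exI[of _ pr] exI[of _ pl])
      (simp add: P L R gam nu_eqs mat2_vec vec2_arith algebra_simps add_divide_distrib diff_divide_distrib del: One_nat_def)
  moreover have "cells ?q' = Q0" using k T(3) by (simp add: cells_push[OF k(1)])
  ultimately show "\<exists>q. realizes q farey_state \<and> cells q = Q0" by blast
qed

lemma farey_chain:
  assumes j: "0 < j" "j < 8" "real j * pi / 8 < \<theta>" "\<theta> < real (j + 1) * pi / 8"
  shows "(diagonal_change \<theta>)\<^sup>+\<^sup>+ Q0 (act (matrix_inv (nu j)) Q0)"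
proof -
  obtain q where q: "realizes q farey_state" "cells q = Q0" using farey_start(1) by blast
  have "j \<in> set [1, 2, 3, 4, 5, 6, 7]" using j(1,2) by auto
  then have check: "straddle_check j farey_state" "target_check j (run j (farey_moves j) farey_state)"
    and ne: "farey_moves j \<noteq> []"
    using farey_check by (blast, blast, auto simp: farey_moves_def)
  have s: "straddles \<theta> q" by (rule straddle_check_straddles[OF j(2-4) q(1) check(1)])
  obtain S where S: "run j (farey_moves j) farey_state = Some S"
    using check(2) by (cases "run j (farey_moves j) farey_state") auto
  obtain q' where q': "realizes q' S" "straddles \<theta> q'" "(diagonal_change \<theta>)\<^sup>+\<^sup>+ (cells q) (cells q')"
    using run_sound[OF j(2-4) S q(1) s] ne by blast
  have "cells q' = act (matrix_inv (nu j)) Q0"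
    using target_check_cells[OF j(2-4) q'(1) _ q'(2)] check(2) S by simp
  then show ?thesis using q'(3) q(2) by simp
qed

section \<open>The octagon Farey map\<close>

lemma dir_eqD:
  assumes "r *\<^sub>R dir t = r' *\<^sub>R dir t'" "r > 0" "r' > 0" "t \<in> {0..pi}" "t' \<in> {0..pi}"
  shows "t = t'"
proof -
  have e: "r * cos t = r' * cos t'" "r * sin t = r' * sin t'"
    using assms(1) by (simp_all add: dir_def vec_eq_iff forall_2)
  have sq: "x\<^sup>2 = (x * cos a)\<^sup>2 + (x * sin a)\<^sup>2" for x a :: real
    by (simp add: power_mult_distrib distrib_left[symmetric] del: distrib_left)
  have "r\<^sup>2 = r'\<^sup>2" using sq[of r t] sq[of r' t'] e by simp
  then have "r = r'" using assms(2,3) by (simp add: power2_eq_iff_nonneg)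
  then have "cos t = cos t'" using e(1) assms(2) by simp
  then show ?thesis using assms(4,5) cos_inj_pi[of t t'] by auto
qed

text \<open>\<open>gam\<close> preserves second coordinates, fixes \<open>dir (pi / 8)\<close> and
  reverses orientation. It thus moves directions between 0 and pi / 8 to the other side of pi / 8
  within the upper half-plane; this excludes index 0 after the first step.\<close>

lemma farey_step:
  assumes j: "j < 8" "real j * pi / 8 < t" "t < real (j + 1) * pi / 8"
  shows "farey t \<in> {0..pi}" "pi / 8 < farey t" "\<exists>r>0. (gam ** nu j) *v dir t = r *\<^sub>R dir (farey t)"
proof -
  let ?\<phi> = "nu_angle j t"
  note \<phi> = nu_angle_sector[OF j(2,3)]
  have v: "(gam ** nu j) *v dir t = gam *v dir ?\<phi>"
    using nu_dir[OF j(1)] by (simp add: matrix_vector_mul_assoc[symmetric])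
  have gam: "gam = mat2 (-1) (2 * (1 + sqrt 2)) 0 1" by (simp add: gam_def)
  have "cross (dir 0) (gam *v dir ?\<phi>) = sin ?\<phi>"
    by (simp add: gam mat2_vec dir_def cross_def)
  moreover have "sin ?\<phi> > 0" using \<phi> pi_gt_zero by (intro sin_gt_zero) linarith+
  ultimately have "left_of 0 (gam *v dir ?\<phi>)" by (simp add: left_of_iff)
  then obtain r \<eta> where \<eta>: "r > 0" "0 < \<eta>" "\<eta> < pi" "gam *v dir ?\<phi> = r *\<^sub>R dir \<eta>"
    by (auto simp: left_of_def)
  have f: "farey t = \<eta>"
    unfolding farey_def
  proof (rule the_equality)
    show "\<eta> \<in> {0..pi} \<and> (\<exists>j<8. t \<in> sector j \<and> (\<exists>r>0. (gam ** nu j) *v dir t = r *\<^sub>R dir \<eta>))"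
      using \<eta> j v by (auto simp: sector_def intro!: exI[of _ j] exI[of _ r])
    fix \<eta>' assume "\<eta>' \<in> {0..pi} \<and> (\<exists>j<8. t \<in> sector j \<and> (\<exists>r>0. (gam ** nu j) *v dir t = r *\<^sub>R dir \<eta>'))"
    then obtain j' r' where *: "\<eta>' \<in> {0..pi}" "t \<in> sector j'" "r' > 0" "(gam ** nu j') *v dir t = r' *\<^sub>R dir \<eta>'" by blast
    \<comment> \<open>As \<open>t\<close> is interior to sector \<open>j\<close>, no other closed
      sector contains it, so the description in \<open>farey\<close> has only one branch.\<close>
    have "real j' * pi / 8 < real (j + 1) * pi / 8" "real j * pi / 8 < real (j' + 1) * pi / 8"
      using *(2) j(2,3) unfolding sector_def atLeastAtMost_iff by (meson order_le_less_trans order_less_le_trans)+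
    then have m: "real j' * (pi / 8) < real (j + 1) * (pi / 8)" "real j * (pi / 8) < real (j' + 1) * (pi / 8)"
      unfolding times_divide_eq_right .
    have "real j' < real (j + 1)" using m(1) by (rule mult_right_less_imp_less) simp
    moreover have "real j < real (j' + 1)" using m(2) by (rule mult_right_less_imp_less) simp
    ultimately have "j' = j" by linarith
    then show "\<eta>' = \<eta>" using * \<eta> v by (intro dir_eqD[of r' \<eta>' r \<eta>]) auto
  qed
  show "farey t \<in> {0..pi}" using \<eta> f by simp
  show "\<exists>r>0. (gam ** nu j) *v dir t = r *\<^sub>R dir (farey t)" using \<eta> f v by auto
  have fixed: "gam *v dir (pi / 8) = dir (pi / 8)"
    unfolding dir_pi_8 by (simp add: gam mat2_vec vec2_arith matrix_vector_mult_scaleR algebra_simps)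
  have "r * sin (\<eta> - pi / 8) = cross (dir (pi / 8)) (gam *v dir ?\<phi>)"
    by (simp add: \<eta>(4) cross_simps cross_dir)
  also have "\<dots> = sin (pi / 8 - ?\<phi>)"
    using cross_matrix[of gam "dir (pi / 8)" "dir ?\<phi>"] sin_minus[of "?\<phi> - pi / 8"]
    by (simp add: fixed cross_dir) (simp add: gam mat2_det)
  also have "\<dots> > 0" using \<phi> pi_gt_zero by (intro sin_gt_zero) linarith+
  finally have "sin (\<eta> - pi / 8) > 0" using \<eta>(1) by (simp add: zero_less_mult_iff)
  moreover have "sin (\<eta> - pi / 8) \<le> 0" if "\<eta> \<le> pi / 8"
    using that \<eta>(2) pi_gt_zero sin_ge_zero[of "pi / 8 - \<eta>"] sin_minus[of "pi / 8 - \<eta>"] by simp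
  ultimately show "pi / 8 < farey t" unfolding f by force
qed

lemma act_mult:
  assumes "surf_aut A B f g" "surf_aut A' B' f' g'"
  shows "act (A' ** A) Q = act A' (act A Q)"
  unfolding act_def aut_of_eq[OF surf_aut_compose[OF assms]] aut_of_eq[OF assms(1)] aut_of_eq[OF assms(2)]
  by (simp add: image_image image_comp[symmetric])

theorem theorem1:
  fixes \<theta> :: real and s :: "nat \<Rightarrow> nat"
  assumes "\<theta> \<in> {0..pi}"
    and "\<forall>k. \<forall>j\<le>8. (farey ^^ k) \<theta> \<noteq> real j * pi / 8"
    and "\<forall>k. s k < 8 \<and> (farey ^^ k) \<theta> \<in> sector (s k)"
  shows "(\<forall>k. admissible_quadrangulation \<theta> (farey_quadrangulation s k)) \<and>
         (\<forall>k. (diagonal_change \<theta>)\<^sup>+\<^sup>+ (farey_quadrangulation s k) (farey_quadrangulation s (Suc k)))"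
proof -
  let ?T = "\<lambda>k. (farey ^^ k) \<theta>"
  have sk: "s k < 8" "real (s k) * pi / 8 < ?T k" "?T k < real (s k + 1) * pi / 8" for k
  proof -
    show "s k < 8" using assms(3) by blast
    then have "?T k \<noteq> real (s k) * pi / 8" "?T k \<noteq> real (s k + 1) * pi / 8"
      by (intro assms(2)[rule_format]; simp)+
    then show "real (s k) * pi / 8 < ?T k" "?T k < real (s k + 1) * pi / 8"
      using assms(3)[rule_format, of k] unfolding sector_def by auto
  qed
  have dir: "\<exists>r>0. hmat s k *v dir \<theta> = r *\<^sub>R dir (?T k)" for k
  proof (induction k)
    case 0
    show ?case by (intro exI[of _ 1]) simp
  next
    case (Suc k)
    then obtain r where r: "r > 0" "hmat s k *v dir \<theta> = r *\<^sub>R dir (?T k)" by blast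
    obtain r' where r': "r' > 0" "(gam ** nu (s k)) *v dir (?T k) = r' *\<^sub>R dir (farey (?T k))"
      using farey_step(3)[OF sk] by blast
    have "hmat s (Suc k) *v dir \<theta> = (gam ** nu (s k)) *v (r *\<^sub>R dir (?T k))"
      by (simp only: hmat.simps matrix_vector_mul_assoc[symmetric] r(2))
    also have "\<dots> = (r * r') *\<^sub>R dir (?T (Suc k))"
      by (simp only: matrix_vector_mult_scaleR r'(2)) simp
    finally show ?case using r(1) r'(1) by (intro exI[of _ "r * r'"]) simp
  qed
  obtain fg where fg: "surf_aut gam gam fg fg" and gamQ: "act gam Q0 = Q0" using farey_start(2) by blast
  have haut: "\<exists>B f g. surf_aut (hmat s k) B f g" for k
  proof (induction k)
    case 0
    then show ?case using surf_aut_id by auto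
  next
    case (Suc k)
    then obtain B f g where a: "surf_aut (hmat s k) B f g" by blast
    obtain B' f' g' where b: "surf_aut (nu (s k)) B' f' g'" using nu_aut[OF sk(1)] by blast
    show ?case using surf_aut_compose[OF a surf_aut_compose[OF b fg]] by auto
  qed
  have chain: "(diagonal_change \<theta>)\<^sup>+\<^sup>+ (farey_quadrangulation s k) (farey_quadrangulation s (Suc k))" for k
  proof -
    let ?j = "s (Suc k)"
    obtain B f g where h: "surf_aut (hmat s k) B f g" using haut by blast
    obtain B1 f1 g1 where n: "surf_aut (nu (s k)) B1 f1 g1" using nu_aut[OF sk(1)] by blast
    obtain B2 f2 g2 where n2: "surf_aut (nu ?j) B2 f2 g2" using nu_aut[OF sk(1)] by blast
    have H: "surf_aut (hmat s (Suc k)) (B ** (B1 ** gam)) (fg \<circ> f1 \<circ> f) (g \<circ> (g1 \<circ> fg))"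
      using surf_aut_compose[OF h surf_aut_compose[OF n fg]] by simp
    \<comment> \<open>The inverse of \<open>hmat s (Suc k)\<close>, the common automorphism that
      carries the model step to the actual one.\<close>
    define C where "C = B ** (B1 ** gam)"
    have Hi: "surf_aut C (hmat s (Suc k)) (g \<circ> (g1 \<circ> fg)) (fg \<circ> f1 \<circ> f)"
      using surf_aut_inverse[OF H] by (simp add: C_def)
    \<comment> \<open>Since \<open>gam\<close> is an involution, the inverses of
      \<open>hmat s k\<close> and \<open>nu (s k)\<close> multiply to \<open>C ** gam\<close>, and
      \<open>gam\<close> is then absorbed by \<open>Q0\<close>.\<close>
    have "C ** gam = B ** (B1 ** (gam ** gam))" by (simp add: C_def matrix_mul_assoc)
    then have Cg: "C ** gam = B ** B1" using fg by (simp add: surf_aut_def matrix_mul_rid)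
    have "farey_quadrangulation s k = act (C ** gam) Q0"
      unfolding farey_quadrangulation_def surf_aut_matrix_inv[OF h] surf_aut_matrix_inv[OF n] Cg ..
    also have "\<dots> = act C Q0" by (simp add: act_mult[OF fg Hi] gamQ)
    finally have Q1: "farey_quadrangulation s k = act C Q0" .
    have Q2: "farey_quadrangulation s (Suc k) = act C (act (matrix_inv (nu ?j)) Q0)"
      unfolding farey_quadrangulation_def surf_aut_matrix_inv[OF H] surf_aut_matrix_inv[OF n2]
      by (simp only: C_def[symmetric] act_mult[OF surf_aut_inverse[OF n2] Hi])
    \<comment> \<open>An iterate beyond pi / 8 is not in sector 0, so one of the seven checked
      chains applies.\<close>
    have "?j \<noteq> 0"
      using farey_step(2)[OF sk, of k] sk(3)[of "Suc k"] by (intro notI) simp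
    then have "(diagonal_change (?T (Suc k)))\<^sup>+\<^sup>+ Q0 (act (matrix_inv (nu ?j)) Q0)"
      using sk[of "Suc k"] by (intro farey_chain) simp_all
    moreover obtain r where r: "r > 0" "hmat s (Suc k) *v dir \<theta> = r *\<^sub>R dir (?T (Suc k))" using dir by blast
    have C: "C *v dir (?T (Suc k)) = (1 / r) *\<^sub>R dir \<theta>"
    proof -
      have "r *\<^sub>R (C *v dir (?T (Suc k))) = C *v (hmat s (Suc k) *v dir \<theta>)"
        unfolding r(2) by (simp only: matrix_vector_mult_scaleR)
      then have "r *\<^sub>R (C *v dir (?T (Suc k))) = dir \<theta>"
        unfolding surf_autD(1)[OF Hi] .
      then have "(1 / r) *\<^sub>R dir \<theta> = (1 / r) *\<^sub>R (r *\<^sub>R (C *v dir (?T (Suc k))))" by (rule arg_cong[OF sym])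
      also have "\<dots> = C *v dir (?T (Suc k))" using r(1) by (simp del: funpow.simps)
      finally show ?thesis by (rule sym)
    qed
    have "1 / r > 0" using r(1) by simp
    have "(diagonal_change \<theta>)\<^sup>+\<^sup>+ (act C Q) (act C Q')" if "(diagonal_change (?T (Suc k)))\<^sup>+\<^sup>+ Q Q'" for Q Q'
      using that
    proof (induction rule: tranclp_induct)
      case (base Q')
      then show ?case using diagonal_change_push[OF Hi C \<open>1 / r > 0\<close>] by blast
    next
      case (step Q' Q'')
      then show ?case using diagonal_change_push[OF Hi C \<open>1 / r > 0\<close>] by (meson tranclp.trancl_into_trancl)
    qed
    ultimately show ?thesis unfolding Q1 Q2 by blast
  qed
  \<comment> \<open>Every Q^(k) is the source of some diagonal change, whose definition provides an
    admissible labelling.\<close>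
  have "admissible_quadrangulation \<theta> (farey_quadrangulation s k)" for k
  proof -
    obtain Q where "diagonal_change \<theta> (farey_quadrangulation s k) Q"
      using chain[of k] by (meson tranclpD)
    then show ?thesis unfolding diagonal_change_def admissible_quadrangulation_def by blast
  qed
  then show ?thesis using chain by blast
qed

end
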